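(* Let $\Omega\subset\mathbb{R}^n$ be an open subset. The embedding of $\mathcal{D}'(\Omega)$ in $\mathcal{G}(\Omega)$ is a discrete embedding, i.e. its image is a discrete subset of $\mathcal{G}(\Omega)$ for the sharp topology. Moreover, if $h\in C^\infty(\Omega)^*$ (an invertible element of $C^\infty(\Omega)$) and $f\in\mathcal{G}(\Omega)$, then $\|hf\|=\|f\|$.
   Context: $I=]0,1]$, $\mathbb{K}\in\{\mathbb{R},\mathbb{C}\}$. $\mathcal{G}(\Omega)$ is the simplified Colombeau algebra: nets $(f_\varepsilon)_{\varepsilon\in I}$ of ($\mathbb K$-valued) $C^\infty$ functions on $\Omega$ such that for each compact $K\subset\Omega$ and multi-index $\beta$, $\sup_K|\partial^\beta f_\varepsilon|<\varepsilon^{r}$ for some $r\in\mathbb{R}$ and all small $\varepsilon$, modulo nets for which this holds for every $K$, $\beta$ and every $r\in\mathbb{N}$. $\mathcal{D}'(\Omega)$ is embedded linearly in $\mathcal{G}(\Omega)$ in the usual way (convolution with $\rho_\varepsilon=\varepsilon^{-n}\rho(\cdot/\varepsilon)$, $\rho\in\mathcal S(\mathbb{R}^n)$ a mollifier with integral $1$ and all higher moments zero, for compactly supported distributions, extended by the sheaf property); $C^\infty(\Omega)$ is embedded by constant nets. Sharp topology: fix an exhaustion $(\Omega_m)_{m\in\mathbb{N}}$ of $\Omega$ by relatively compact open subsets. For $f=[(f_\varepsilon)]$ put $V_{mp}(f)=\sup\{a\in\mathbb{R}:\forall|\beta|\le p,\ \sup_{\Omega_m}|\partial^\beta f_\varepsilon|=o(\varepsilon^a)\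 (\varepsilon\to0)\}$, $D_{mp}(f,g)=\exp(-V_{mp}(f-g))$ (with $e^{-\infty}=0$), and $D(f,g)=\sup_m\frac{2D_{mm}(f,g)}{1+D_{mm}(f,g)}$. The sharp topology is that of the metric $D$, and $\|f\|=D(f,0)$. *)

theory Defs
  imports "HOL-Analysis.Analysis" "HOL-Library.Landau_Symbols"
begin

text \<open>Functions on an open set \<open>\<Omega>\<close> are represented by total functions whose values outside \<open>\<Omega>\<close>
  are irrelevant. A partial derivative of order \<open>k\<close> is indexed by a list of \<open>k\<close> coordinate
  directions. All derivatives below are those of smooth functions, for which the order of the
  directions does not matter; hence quantifying over all lists of length at most \<open>p\<close> is the same
  as quantifying over all multi-indices \<open>\<beta>\<close> with \<open>\<bar>\<beta>\<bar> \<le> p\<close>.\<close>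

definition partial_deriv ::
    "'n \<Rightarrow> (real^'n \<Rightarrow> 'b::real_normed_vector) \<Rightarrow> (real^'n \<Rightarrow> 'b)" where
  "partial_deriv i f = (\<lambda>x. vector_derivative (\<lambda>t. f (x + t *\<^sub>R axis i 1)) (at 0))"

primrec partial_derivs ::
    "'n list \<Rightarrow> (real^'n \<Rightarrow> 'b::real_normed_vector) \<Rightarrow> (real^'n \<Rightarrow> 'b)" where
  "partial_derivs [] f = f"
| "partial_derivs (i # is) f = partial_deriv i (partial_derivs is f)"

definition smooth_on :: "(real^'n) set \<Rightarrow> (real^'n \<Rightarrow> 'b::real_normed_vector) \<Rightarrow> bool" where
  "smooth_on \<Omega> f \<longleftrightarrow> (\<forall>\<beta>. partial_derivs \<beta> f differentiable_on \<Omega>)"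

definition smooth_unit :: "(real^'n) set \<Rightarrow> (real^'n \<Rightarrow> 'k::real_normed_field) \<Rightarrow> bool" where
  "smooth_unit \<Omega> h \<longleftrightarrow> smooth_on \<Omega> h \<and> (\<exists>g. smooth_on \<Omega> g \<and> (\<forall>x\<in>\<Omega>. h x * g x = 1))"

text \<open>The supremum is taken in \<open>[0,\<infinity>)\<close>, so that it is \<open>0\<close> over the empty set. It is only used for
  functions that are bounded on \<open>K\<close>.\<close>

definition sup_norm :: "(real^'n) set \<Rightarrow> (real^'n \<Rightarrow> 'b::real_normed_vector) \<Rightarrow> real" where
  "sup_norm K f = Sup (insert 0 ((\<lambda>x. norm (f x)) ` K))"

text \<open>Only the members of a net with index in \<open>{0<..1}\<close> are relevant.

  The scalar field is any type of sort \<open>{real_normed_field, euclidean_space}\<close>. Both \<open>real\<close> and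
  \<open>complex\<close> have this sort, and by Frobenius' theorem these are, up to isometric isomorphism, the
  only such fields.\<close>

type_synonym ('n, 'k) net = "real \<Rightarrow> real^'n \<Rightarrow> 'k"

definition smooth_nets :: "(real^'n) set \<Rightarrow> ('n, 'k::{real_normed_field,euclidean_space}) net set" where
  "smooth_nets \<Omega> = {u. \<forall>\<epsilon>\<in>{0<..1}. smooth_on \<Omega> (u \<epsilon>)}"

definition moderate :: "(real^'n) set \<Rightarrow> ('n, 'k::{real_normed_field,euclidean_space}) net set" where
  "moderate \<Omega> = {u \<in> smooth_nets \<Omega>. \<forall>K \<beta>. compact K \<and> K \<subseteq> \<Omega> \<longrightarrow>
     (\<exists>r::real. \<forall>\<^sub>F \<epsilon> in at_right 0. sup_norm K (partial_derivs \<beta> (u \<epsilon>)) < \<epsilon> powr r)}"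

definition negligible_nets ::
    "(real^'n) set \<Rightarrow> ('n, 'k::{real_normed_field,euclidean_space}) net set" where
  "negligible_nets \<Omega> = {u \<in> smooth_nets \<Omega>. \<forall>K \<beta>. compact K \<and> K \<subseteq> \<Omega> \<longrightarrow>
     (\<forall>r::nat. \<forall>\<^sub>F \<epsilon> in at_right 0. sup_norm K (partial_derivs \<beta> (u \<epsilon>)) < \<epsilon> ^ r)}"

definition colombeau_rel ::
    "(real^'n) set \<Rightarrow> ('n, 'k::{real_normed_field,euclidean_space}) net rel" where
  "colombeau_rel \<Omega> = {(u, v). u \<in> moderate \<Omega> \<and> v \<in> moderate \<Omega> \<and>
     (\<lambda>\<epsilon> x. u \<epsilon> x - v \<epsilon> x) \<in> negligible_nets \<Omega>}"

definition colombeau ::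
    "(real^'n) set \<Rightarrow> ('n, 'k::{real_normed_field,euclidean_space}) net set set" where
  "colombeau \<Omega> = moderate \<Omega> // colombeau_rel \<Omega>"

definition colombeau_class ::
    "(real^'n) set \<Rightarrow> ('n, 'k::{real_normed_field,euclidean_space}) net \<Rightarrow> ('n, 'k) net set" where
  "colombeau_class \<Omega> u = colombeau_rel \<Omega> `` {u}"

text \<open>Operations on classes, in the style of \<^theory>\<open>HOL.Equiv_Relations\<close>: all classes in the
  unions coincide.\<close>

definition colombeau_diff :: "(real^'n) set \<Rightarrow>
    ('n, 'k::{real_normed_field,euclidean_space}) net set \<Rightarrow> ('n, 'k) net set \<Rightarrow> ('n, 'k) net set" where
  "colombeau_diff \<Omega> f g = (\<Union>u\<in>f. \<Union>v\<in>g. colombeau_class \<Omega> (\<lambda>\<epsilon> x. u \<epsilon> x - v \<epsilon> x))"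

definition colombeau_mult :: "(real^'n) set \<Rightarrow>
    ('n, 'k::{real_normed_field,euclidean_space}) net set \<Rightarrow> ('n, 'k) net set \<Rightarrow> ('n, 'k) net set" where
  "colombeau_mult \<Omega> f g = (\<Union>u\<in>f. \<Union>v\<in>g. colombeau_class \<Omega> (\<lambda>\<epsilon> x. u \<epsilon> x * v \<epsilon> x))"

definition smooth_embed ::
    "(real^'n) set \<Rightarrow> (real^'n \<Rightarrow> 'k::{real_normed_field,euclidean_space}) \<Rightarrow> ('n, 'k) net set" where
  "smooth_embed \<Omega> h = colombeau_class \<Omega> (\<lambda>\<epsilon>. h)"

definition colombeau_zero ::
    "(real^'n) set \<Rightarrow> ('n, 'k::{real_normed_field,euclidean_space}) net set" where
  "colombeau_zero \<Omega> = colombeau_class \<Omega> (\<lambda>\<epsilon> x. 0)"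

definition exhaustion :: "(real^'n) set \<Rightarrow> (nat \<Rightarrow> (real^'n) set) \<Rightarrow> bool" where
  "exhaustion \<Omega> \<Omega>s \<longleftrightarrow>
     (\<forall>m. open (\<Omega>s m) \<and> compact (closure (\<Omega>s m)) \<and> closure (\<Omega>s m) \<subseteq> \<Omega> \<and> \<Omega>s m \<subseteq> \<Omega>s (Suc m)) \<and>
     (\<Union>m. \<Omega>s m) = \<Omega>"

definition net_valuation :: "(nat \<Rightarrow> (real^'n) set) \<Rightarrow> nat \<Rightarrow> nat \<Rightarrow>
    ('n, 'k::{real_normed_field,euclidean_space}) net \<Rightarrow> ereal" where
  "net_valuation \<Omega>s m p u = Sup {ereal a | a. \<forall>\<beta>. length \<beta> \<le> p \<longrightarrow>
     (\<lambda>\<epsilon>. sup_norm (\<Omega>s m) (partial_derivs \<beta> (u \<epsilon>))) \<in> o[at_right 0](\<lambda>\<epsilon>. \<epsilon> powr a)}"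

text \<open>The valuation does not depend on the representative, so the image below is a singleton for
  every element of the Colombeau algebra.\<close>

definition valuation :: "(nat \<Rightarrow> (real^'n) set) \<Rightarrow> nat \<Rightarrow> nat \<Rightarrow>
    ('n, 'k::{real_normed_field,euclidean_space}) net set \<Rightarrow> ereal" where
  "valuation \<Omega>s m p f = the_elem (net_valuation \<Omega>s m p ` f)"

text \<open>On the Colombeau algebra the valuation never takes the value \<open>-\<infinity>\<close>.\<close>

definition sharp_pseudodist :: "(real^'n) set \<Rightarrow> (nat \<Rightarrow> (real^'n) set) \<Rightarrow> nat \<Rightarrow> nat \<Rightarrow>
    ('n, 'k::{real_normed_field,euclidean_space}) net set \<Rightarrow> ('n, 'k) net set \<Rightarrow> real" where
  "sharp_pseudodist \<Omega> \<Omega>s m p f g =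
     (let v = valuation \<Omega>s m p (colombeau_diff \<Omega> f g)
      in if v = \<infinity> then 0 else exp (- real_of_ereal v))"

definition sharp_dist :: "(real^'n) set \<Rightarrow> (nat \<Rightarrow> (real^'n) set) \<Rightarrow>
    ('n, 'k::{real_normed_field,euclidean_space}) net set \<Rightarrow> ('n, 'k) net set \<Rightarrow> real" where
  "sharp_dist \<Omega> \<Omega>s f g =
     (SUP m. 2 * sharp_pseudodist \<Omega> \<Omega>s m m f g / (1 + sharp_pseudodist \<Omega> \<Omega>s m m f g))"

definition sharp_norm :: "(real^'n) set \<Rightarrow> (nat \<Rightarrow> (real^'n) set) \<Rightarrow>
    ('n, 'k::{real_normed_field,euclidean_space}) net set \<Rightarrow> real" where
  "sharp_norm \<Omega> \<Omega>s f = sharp_dist \<Omega> \<Omega>s f (colombeau_zero \<Omega>)"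

definition sharp_topology :: "(real^'n) set \<Rightarrow> (nat \<Rightarrow> (real^'n) set) \<Rightarrow>
    ('n, 'k::{real_normed_field,euclidean_space}) net set topology" where
  "sharp_topology \<Omega> \<Omega>s = Metric_space.mtopology (colombeau \<Omega>) (sharp_dist \<Omega> \<Omega>s)"

definition test_functions ::
    "(real^'n) set \<Rightarrow> (real^'n \<Rightarrow> 'k::{real_normed_field,euclidean_space}) set" where
  "test_functions \<Omega> = {\<phi>. smooth_on UNIV \<phi> \<and>
     compact (closure {x. \<phi> x \<noteq> 0}) \<and> closure {x. \<phi> x \<noteq> 0} \<subseteq> \<Omega>}"

text \<open>Continuity of a linear functional on test functions is expressed by the usual seminorm
  estimates on each compact set.\<close>

definition distributions ::
    "(real^'n) set \<Rightarrow> ((real^'n \<Rightarrow> 'k::{real_normed_field,euclidean_space}) \<Rightarrow> 'k) set" where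
  "distributions \<Omega> = {T \<in> extensional (test_functions \<Omega>).
     (\<forall>\<phi>\<in>test_functions \<Omega>. \<forall>\<psi>\<in>test_functions \<Omega>. T (\<lambda>x. \<phi> x + \<psi> x) = T \<phi> + T \<psi>) \<and>
     (\<forall>c. \<forall>\<phi>\<in>test_functions \<Omega>. T (\<lambda>x. c * \<phi> x) = c * T \<phi>) \<and>
     (\<forall>K. compact K \<and> K \<subseteq> \<Omega> \<longrightarrow>
        (\<exists>C N. \<forall>\<phi>\<in>test_functions \<Omega>. closure {x. \<phi> x \<noteq> 0} \<subseteq> K \<longrightarrow>
           norm (T \<phi>) \<le> C * (\<Sum>\<beta> | length \<beta> \<le> N. sup_norm K (partial_derivs \<beta> \<phi>))))}"

definition monomial :: "('n \<Rightarrow> nat) \<Rightarrow> real^'n \<Rightarrow> real" where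
  "monomial \<alpha> x = (\<Prod>i\<in>UNIV. (x $ i) ^ \<alpha> i)"

definition schwartz :: "(real^'n \<Rightarrow> 'k::{real_normed_field,euclidean_space}) \<Rightarrow> bool" where
  "schwartz \<rho> \<longleftrightarrow> smooth_on UNIV \<rho> \<and>
     (\<forall>\<alpha> \<beta>. bounded (range (\<lambda>x. monomial \<alpha> x *\<^sub>R partial_derivs \<beta> \<rho> x)))"

definition mollifier :: "(real^'n \<Rightarrow> 'k::{real_normed_field,euclidean_space}) \<Rightarrow> bool" where
  "mollifier \<rho> \<longleftrightarrow> schwartz \<rho> \<and> (LINT x|lborel. \<rho> x) = 1 \<and>
     (\<forall>\<alpha>. (\<exists>i. \<alpha> i \<noteq> 0) \<longrightarrow> (LINT x|lborel. monomial \<alpha> x *\<^sub>R \<rho> x) = 0)"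

definition scaled_mollifier ::
    "(real^'n \<Rightarrow> 'k::{real_normed_field,euclidean_space}) \<Rightarrow> ('n, 'k) net" where
  "scaled_mollifier \<rho> \<epsilon> x = inverse (\<epsilon> ^ CARD('n)) *\<^sub>R \<rho> (inverse \<epsilon> *\<^sub>R x)"

text \<open>For a test function \<open>\<psi>\<close> and a distribution \<open>T\<close>, the product \<open>\<psi>T\<close> has compact support and is
  thus a functional on all smooth functions; it is in this role that it can be convolved with a
  Schwartz function.\<close>

definition cutoff_dist :: "(real^'n \<Rightarrow> 'k::{real_normed_field,euclidean_space}) \<Rightarrow>
    ((real^'n \<Rightarrow> 'k) \<Rightarrow> 'k) \<Rightarrow> ((real^'n \<Rightarrow> 'k) \<Rightarrow> 'k)" where
  "cutoff_dist \<psi> T = (\<lambda>\<phi>. T (\<lambda>y. \<psi> y * \<phi> y))"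

definition dist_convolve :: "((real^'n \<Rightarrow> 'k::{real_normed_field,euclidean_space}) \<Rightarrow> 'k) \<Rightarrow>
    (real^'n \<Rightarrow> 'k) \<Rightarrow> (real^'n \<Rightarrow> 'k)" where
  "dist_convolve w \<phi> = (\<lambda>x. w (\<lambda>y. \<phi> (x - y)))"

text \<open>By the sheaf property, the image of \<open>T\<close> is the unique element of the Colombeau algebra on
  \<open>\<Omega>\<close> whose restriction to any open \<open>\<omega>\<close> agrees with the restriction of the image
  \<open>[(w * \<rho>\<^sub>\<epsilon>)]\<close> of the compactly supported distribution \<open>w = \<psi>T\<close> whenever \<open>\<psi> = 1\<close> on \<open>\<omega>\<close>
  (so that \<open>w\<close> and \<open>T\<close> agree on \<open>\<omega>\<close>). As an equivalence class of nets, it is the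
  following set.\<close>

definition dist_embed :: "(real^'n \<Rightarrow> 'k::{real_normed_field,euclidean_space}) \<Rightarrow> (real^'n) set \<Rightarrow>
    ((real^'n \<Rightarrow> 'k) \<Rightarrow> 'k) \<Rightarrow> ('n, 'k) net set" where
  "dist_embed \<rho> \<Omega> T = {u \<in> moderate \<Omega>. \<forall>\<omega> \<psi>.
     open \<omega> \<and> \<omega> \<subseteq> \<Omega> \<and> \<psi> \<in> test_functions \<Omega> \<and> (\<forall>x\<in>\<omega>. \<psi> x = 1) \<longrightarrow>
     (\<lambda>\<epsilon> x. u \<epsilon> x - dist_convolve (cutoff_dist \<psi> T) (scaled_mollifier \<rho> \<epsilon>) x)
       \<in> negligible_nets \<omega>}"

end

theory Submission
  imports Defs "HOL-Computational_Algebra.Polynomial"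
begin

text \<open>Multiplication by a smooth unit, and by its inverse, changes the suprema of the derivatives of
  order at most \<open>m\<close> over \<open>\<Omega>s m\<close> only by constant factors, so it preserves every valuation and hence
  the norm. If the images of two distributions have sharp distance less than \<open>1\<close>, all valuations of
  their difference are positive, so it tends to \<open>0\<close> uniformly on each \<open>\<Omega>s m\<close>; as the
  regularisations of a distribution converge to it weakly, the two distributions coincide. Distinct
  points of the image thus have distance at least \<open>1\<close>.

  The weak convergence uses two facts about a functional \<open>L\<close> that is continuous for the smooth
  topology: its value at an average of translates of \<open>a\<close> is bounded by its values at the
  translates, and averages of \<open>a\<close> against \<open>\<rho>\<^sub>\<epsilon>\<close> converge to \<open>a\<close> with all derivatives. The
  integrability of \<open>\<rho>\<close> comes for free, since a non-integrable function would have integral \<open>0\<close>.\<close>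

section \<open>Iterated partial derivatives\<close>

text \<open>The image of a distribution is specified as the set of all nets that agree locally with
  its regularisations. The specification itself yields no member, so a net has to be glued together
  first, and the set has to be identified with a single class; only then is the image known to lie
  in the algebra, where distances make sense.

  The threshold 1 comes from the metric: valuation 0 gives D = exp 0 = 1, and d \<mapsto> 2d/(1+d)
  fixes 1. Distance below 1 therefore forces strictly positive valuations, that is, decay like some
  positive power of \<epsilon> on each \<open>\<Omega>s m\<close>.

  Weak convergence is usually read off from an identity: integrating (w * \<rho>_\<epsilon>) against
  \<phi> gives w applied to an average of \<phi>, which exchanges w with an integral. Here w is the
  cut-off difference of the two distributions, and only smallness of w(\<phi>) is at stake, so an
  inequality suffices, and it is obtained from finite sums.\<close>

lemma partial_deriv_eq:
  assumes "(f has_derivative D) (at x)"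
  shows "partial_deriv i f x = D (axis i 1)"
proof -
  interpret bounded_linear D using assms by (rule has_derivative_bounded_linear)
  have "((\<lambda>t::real. x + t *\<^sub>R axis i 1) has_derivative (\<lambda>t. t *\<^sub>R axis i 1)) (at 0)"
    by (auto intro!: derivative_eq_intros)
  moreover have "(f has_derivative D) (at (x + 0 *\<^sub>R axis i 1))" using assms by simp
  ultimately have "((\<lambda>t. f (x + t *\<^sub>R axis i 1)) has_derivative (\<lambda>t. D (t *\<^sub>R axis i 1))) (at 0)"
    by (rule has_derivative_compose)
  then have "((\<lambda>t. f (x + t *\<^sub>R axis i 1)) has_vector_derivative D (axis i 1)) (at 0)"
    by (simp add: has_vector_derivative_def scaleR)
  then show ?thesis unfolding partial_deriv_def by (rule vector_derivative_at)
qed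

lemma has_derivative_partials:
  fixes f :: "real^'n \<Rightarrow> 'b::real_normed_vector"
  assumes "f differentiable (at x)"
  shows "(f has_derivative (\<lambda>h. \<Sum>i\<in>UNIV. h $ i *\<^sub>R partial_deriv i f x)) (at x)"
proof -
  from assms obtain D where D: "(f has_derivative D) (at x)" by (auto simp: differentiable_def)
  interpret bounded_linear D using D by (rule has_derivative_bounded_linear)
  have "D h = (\<Sum>i\<in>UNIV. h $ i *\<^sub>R partial_deriv i f x)" for h
  proof -
    have "D h = D (\<Sum>i\<in>UNIV. h $ i *\<^sub>R axis i 1)"
      using basis_expansion[of h] by (simp add: scalar_mult_eq_scaleR)
    then show ?thesis by (simp add: sum scaleR partial_deriv_eq[OF D])
  qed
  with D show ?thesis by (metis (no_types, lifting) ext)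
qed

lemma partial_deriv_cong:
  assumes "open \<Omega>" "x \<in> \<Omega>" "\<And>y. y \<in> \<Omega> \<Longrightarrow> f y = g y"
  shows "partial_deriv i f x = partial_deriv i g x"
proof -
  have "((\<lambda>t::real. x + t *\<^sub>R axis i 1) \<longlongrightarrow> x + 0 *\<^sub>R axis i 1) (nhds 0)"
    by (intro tendsto_intros filterlim_ident)
  with assms(1,2) have "\<forall>\<^sub>F t::real in nhds 0. x + t *\<^sub>R axis i 1 \<in> \<Omega>"
    by (simp add: topological_tendstoD)
  then show ?thesis unfolding partial_deriv_def
    by (intro vector_derivative_cong_eq) (auto elim!: eventually_mono simp: assms(3))
qed

lemma partial_derivs_cong:
  assumes "open \<Omega>" "\<And>y. y \<in> \<Omega> \<Longrightarrow> f y = g y" "x \<in> \<Omega>"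
  shows "partial_derivs \<beta> f x = partial_derivs \<beta> g x"
  using assms(3)
proof (induction \<beta> arbitrary: x)
  case (Cons i \<beta>)
  then show ?case using assms(1) by (auto intro: partial_deriv_cong)
qed (simp add: assms)

lemma partial_derivs_append: "partial_derivs (\<beta> @ \<gamma>) f = partial_derivs \<beta> (partial_derivs \<gamma> f)"
  by (induction \<beta>) auto

lemma differentiable_on_cong_open:
  assumes "open \<Omega>" "\<And>y. y \<in> \<Omega> \<Longrightarrow> f y = g y" "f differentiable_on \<Omega>"
  shows "g differentiable_on \<Omega>"
  using assms by (metis differentiable_on_def differentiable_transform_within zero_less_one)

text \<open>Finite orders make products and compositions accessible to induction: the first
  derivative of f g is a sum of products of other functions, so the hypothesis must speak about all
  functions at one order less.\<close>

definition differentiable_upto ::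
    "nat \<Rightarrow> (real^'n) set \<Rightarrow> (real^'n \<Rightarrow> 'b::real_normed_vector) \<Rightarrow> bool" where
  "differentiable_upto k \<Omega> f \<longleftrightarrow> (\<forall>\<beta>. length \<beta> \<le> k \<longrightarrow> partial_derivs \<beta> f differentiable_on \<Omega>)"

lemma smooth_on_iff_upto: "smooth_on \<Omega> f \<longleftrightarrow> (\<forall>k. differentiable_upto k \<Omega> f)"
  by (auto simp: smooth_on_def differentiable_upto_def)

lemma differentiable_upto_0: "differentiable_upto 0 \<Omega> f \<longleftrightarrow> f differentiable_on \<Omega>"
  by (simp add: differentiable_upto_def)

text \<open>Splits off the derivative taken first, which is the last entry of the list, whereas
  \<open>partial_derivs\<close> recurses on the derivative taken last. This is the direction in
  which the product and chain rules can be applied before the remaining derivatives.\<close>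

lemma differentiable_upto_Suc:
  "differentiable_upto (Suc k) \<Omega> f \<longleftrightarrow>
     f differentiable_on \<Omega> \<and> (\<forall>i. differentiable_upto k \<Omega> (partial_deriv i f))"
proof -
  have *: "(\<forall>\<beta>. length \<beta> \<le> Suc k \<longrightarrow> P \<beta>) \<longleftrightarrow> P [] \<and> (\<forall>\<beta> i. length \<beta> \<le> k \<longrightarrow> P (\<beta> @ [i]))"
    for P :: "'a list \<Rightarrow> bool"
  proof (intro iffI allI impI)
    fix \<beta> :: "'a list" assume "P [] \<and> (\<forall>\<beta> i. length \<beta> \<le> k \<longrightarrow> P (\<beta> @ [i]))" "length \<beta> \<le> Suc k"
    then show "P \<beta>" by (cases \<beta> rule: rev_cases) auto
  qed auto
  show ?thesis unfolding differentiable_upto_def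
    by (subst *) (auto simp: partial_derivs_append)
qed

lemma differentiable_upto_mono: "differentiable_upto k \<Omega> f \<Longrightarrow> j \<le> k \<Longrightarrow> differentiable_upto j \<Omega> f"
  by (auto simp: differentiable_upto_def)

lemma differentiable_upto_imp_differentiable:
  "differentiable_upto k \<Omega> f \<Longrightarrow> f differentiable_on \<Omega>"
  by (cases k) (auto simp: differentiable_upto_0 differentiable_upto_Suc)

lemma differentiable_upto_cong:
  assumes "open \<Omega>" "\<And>y. y \<in> \<Omega> \<Longrightarrow> f y = g y" "differentiable_upto k \<Omega> f"
  shows "differentiable_upto k \<Omega> g"
  using assms differentiable_on_cong_open[OF assms(1), of "partial_derivs \<beta> f" "partial_derivs \<beta> g" for \<beta>]
  by (auto simp: differentiable_upto_def partial_derivs_cong[OF assms(1,2)])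

lemma smooth_on_cong:
  assumes "open \<Omega>" "smooth_on \<Omega> f" "\<And>y. y \<in> \<Omega> \<Longrightarrow> f y = g y"
  shows "smooth_on \<Omega> g"
  using assms differentiable_upto_cong[OF assms(1,3)] by (auto simp: smooth_on_iff_upto)

lemma smooth_on_subset: "smooth_on \<Omega> f \<Longrightarrow> \<omega> \<subseteq> \<Omega> \<Longrightarrow> smooth_on \<omega> f"
  by (auto simp: smooth_on_def intro: differentiable_on_subset)

lemma smooth_on_partial_derivs: "smooth_on \<Omega> f \<Longrightarrow> smooth_on \<Omega> (partial_derivs \<beta> f)"
  unfolding smooth_on_def by (metis partial_derivs_append)

lemma smooth_on_partial_deriv: "smooth_on \<Omega> f \<Longrightarrow> smooth_on \<Omega> (partial_deriv i f)"
  using smooth_on_partial_derivs[of \<Omega> f "[i]"] by simp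

lemma smooth_on_differentiable:
  "smooth_on \<Omega> f \<Longrightarrow> open \<Omega> \<Longrightarrow> x \<in> \<Omega> \<Longrightarrow> f differentiable (at x)"
  using differentiable_on_eq_differentiable_at[of \<Omega> f]
  by (metis partial_derivs.simps(1) smooth_on_def)

lemma smooth_on_imp_continuous_on: "smooth_on \<Omega> f \<Longrightarrow> continuous_on \<Omega> f"
  by (metis differentiable_imp_continuous_on partial_derivs.simps(1) smooth_on_def)

lemma smooth_on_deriv_continuous_on: "smooth_on \<Omega> f \<Longrightarrow> continuous_on \<Omega> (partial_derivs \<beta> f)"
  by (simp add: smooth_on_imp_continuous_on smooth_on_partial_derivs)

subsection \<open>Closure properties\<close>

lemma partial_deriv_const [simp]: "partial_deriv i (\<lambda>x. c) = (\<lambda>x. 0)"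
  by (simp add: partial_deriv_def)

lemma partial_derivs_const: "partial_derivs \<beta> (\<lambda>x. c) = (\<lambda>x. if \<beta> = [] then c else 0)"
  by (induction \<beta>) simp_all

lemma smooth_on_const [simp]: "smooth_on \<Omega> (\<lambda>x. c)"
  by (auto simp: smooth_on_def partial_derivs_const)

lemma partial_deriv_linear:
  assumes "bounded_linear L" "f differentiable (at x)"
  shows "partial_deriv i (\<lambda>y. L (f y)) x = L (partial_deriv i f x)"
proof -
  from assms obtain D where D: "(f has_derivative D) (at x)" by (auto simp: differentiable_def)
  show ?thesis
    using partial_deriv_eq[OF bounded_linear.has_derivative[OF assms(1) D]] partial_deriv_eq[OF D]
    by simp
qed

lemma smooth_on_linear:
  assumes "open \<Omega>" "smooth_on \<Omega> f" "bounded_linear L"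
  shows partial_derivs_linear: "x \<in> \<Omega> \<Longrightarrow> partial_derivs \<beta> (\<lambda>y. L (f y)) x = L (partial_derivs \<beta> f x)"
    and "smooth_on \<Omega> (\<lambda>y. L (f y))"
proof -
  show *: "partial_derivs \<beta> (\<lambda>y. L (f y)) x = L (partial_derivs \<beta> f x)" if "x \<in> \<Omega>" for x \<beta>
    using that
  proof (induction \<beta> arbitrary: x)
    case (Cons i \<beta>)
    have "partial_deriv i (partial_derivs \<beta> (\<lambda>y. L (f y))) x
        = partial_deriv i (\<lambda>y. L (partial_derivs \<beta> f y)) x"
      using Cons by (intro partial_deriv_cong[OF assms(1)]) auto
    also have "\<dots> = L (partial_deriv i (partial_derivs \<beta> f) x)"
      using Cons assms
      by (intro partial_deriv_linear smooth_on_differentiable[OF smooth_on_partial_derivs]) auto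
    finally show ?case by simp
  qed auto
  have "(\<lambda>y. L (partial_derivs \<beta> f y)) differentiable_on \<Omega>" for \<beta>
    using smooth_on_differentiable[OF smooth_on_partial_derivs[OF assms(2)] assms(1)]
      bounded_linear.has_derivative[OF assms(3)]
    unfolding differentiable_on_eq_differentiable_at[OF assms(1)] differentiable_def by metis
  then show "smooth_on \<Omega> (\<lambda>y. L (f y))"
    unfolding smooth_on_def
    by (metis (no_types, lifting) * assms(1) differentiable_on_cong_open)
qed

lemma smooth_on_add:
  assumes "open \<Omega>" "smooth_on \<Omega> f" "smooth_on \<Omega> g"
  shows partial_derivs_add:
      "x \<in> \<Omega> \<Longrightarrow> partial_derivs \<beta> (\<lambda>y. f y + g y) x = partial_derivs \<beta> f x + partial_derivs \<beta> g x"
    and "smooth_on \<Omega> (\<lambda>y. f y + g y)"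
proof -
  show *: "partial_derivs \<beta> (\<lambda>y. f y + g y) x = partial_derivs \<beta> f x + partial_derivs \<beta> g x"
    if "x \<in> \<Omega>" for x \<beta>
    using that
  proof (induction \<beta> arbitrary: x)
    case (Cons i \<beta>)
    have "partial_deriv i (partial_derivs \<beta> (\<lambda>y. f y + g y)) x
        = partial_deriv i (\<lambda>y. partial_derivs \<beta> f y + partial_derivs \<beta> g y) x"
      using Cons by (intro partial_deriv_cong[OF assms(1)]) auto
    also have "\<dots> = partial_deriv i (partial_derivs \<beta> f) x + partial_deriv i (partial_derivs \<beta> g) x"
    proof -
      obtain D E where D: "(partial_derivs \<beta> f has_derivative D) (at x)"
        "(partial_derivs \<beta> g has_derivative E) (at x)"
        using smooth_on_differentiable[OF smooth_on_partial_derivs assms(1)] Cons.prems assms(2,3)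
        unfolding differentiable_def by metis
      show ?thesis
        using partial_deriv_eq[OF has_derivative_add[OF D]] D[THEN partial_deriv_eq] by simp
    qed
    finally show ?case by simp
  qed auto
  have "(\<lambda>y. partial_derivs \<beta> f y + partial_derivs \<beta> g y) differentiable_on \<Omega>" for \<beta>
    using assms by (intro differentiable_on_add) (auto simp: smooth_on_def)
  then show "smooth_on \<Omega> (\<lambda>y. f y + g y)"
    unfolding smooth_on_def
    by (metis (no_types, lifting) * assms(1) differentiable_on_cong_open)
qed

lemma smooth_on_scaleR:
  assumes "open \<Omega>" "smooth_on \<Omega> f"
  shows partial_derivs_scaleR:
      "x \<in> \<Omega> \<Longrightarrow> partial_derivs \<beta> (\<lambda>y. c *\<^sub>R f y) x = c *\<^sub>R partial_derivs \<beta> f x"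
    and "smooth_on \<Omega> (\<lambda>y. c *\<^sub>R f y)"
  using smooth_on_linear[OF assms bounded_linear_scaleR_right] by auto

lemma smooth_on_cmult:
  fixes f :: "real^'n \<Rightarrow> 'b::real_normed_algebra"
  assumes "open \<Omega>" "smooth_on \<Omega> f"
  shows partial_derivs_cmult:
      "x \<in> \<Omega> \<Longrightarrow> partial_derivs \<beta> (\<lambda>y. c * f y) x = c * partial_derivs \<beta> f x"
    and "smooth_on \<Omega> (\<lambda>y. c * f y)"
  using smooth_on_linear[OF assms bounded_linear_mult_right] by auto

lemma smooth_on_minus:
  assumes "open \<Omega>" "smooth_on \<Omega> f"
  shows partial_derivs_minus:
      "x \<in> \<Omega> \<Longrightarrow> partial_derivs \<beta> (\<lambda>y. - f y) x = - partial_derivs \<beta> f x"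
    and "smooth_on \<Omega> (\<lambda>y. - f y)"
  using smooth_on_linear[OF assms bounded_linear_minus[OF bounded_linear_ident]] by auto

lemma smooth_on_diff:
  assumes "open \<Omega>" "smooth_on \<Omega> f" "smooth_on \<Omega> g"
  shows partial_derivs_diff:
      "x \<in> \<Omega> \<Longrightarrow> partial_derivs \<beta> (\<lambda>y. f y - g y) x = partial_derivs \<beta> f x - partial_derivs \<beta> g x"
    and "smooth_on \<Omega> (\<lambda>y. f y - g y)"
  using smooth_on_add[OF assms(1,2) smooth_on_minus(2)[OF assms(1,3)]] 
    partial_derivs_minus[OF assms(1,3)] by auto

lemma smooth_on_sum:
  assumes "open \<Omega>" "\<And>j. j \<in> J \<Longrightarrow> smooth_on \<Omega> (f j)"
  shows partial_derivs_sum: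
      "x \<in> \<Omega> \<Longrightarrow> partial_derivs \<beta> (\<lambda>y. \<Sum>j\<in>J. f j y) x = (\<Sum>j\<in>J. partial_derivs \<beta> (f j) x)"
    and "smooth_on \<Omega> (\<lambda>y. \<Sum>j\<in>J. f j y)"
proof -
  have "(\<forall>x\<in>\<Omega>. partial_derivs \<beta> (\<lambda>y. \<Sum>j\<in>J. f j y) x = (\<Sum>j\<in>J. partial_derivs \<beta> (f j) x))
     \<and> smooth_on \<Omega> (\<lambda>y. \<Sum>j\<in>J. f j y)"
    using assms(2)
  proof (induction J rule: infinite_finite_induct)
    case (insert j J)
    then show ?case by (auto simp: partial_derivs_add[OF assms(1)] intro: smooth_on_add(2)[OF assms(1)])
  qed (auto simp: partial_derivs_const)
  then show "x \<in> \<Omega> \<Longrightarrow> partial_derivs \<beta> (\<lambda>y. \<Sum>j\<in>J. f j y) x = (\<Sum>j\<in>J. partial_derivs \<beta> (f j) x)"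
    "smooth_on \<Omega> (\<lambda>y. \<Sum>j\<in>J. f j y)" by auto
qed

section \<open>Products and compositions\<close>

lemma partial_deriv_mult:
  fixes f g :: "real^'n \<Rightarrow> 'b::real_normed_algebra"
  assumes "f differentiable (at x)" "g differentiable (at x)"
  shows "partial_deriv i (\<lambda>y. f y * g y) x = partial_deriv i f x * g x + f x * partial_deriv i g x"
proof -
  from assms obtain D E where D: "(f has_derivative D) (at x)" "(g has_derivative E) (at x)"
    by (auto simp: differentiable_def)
  show ?thesis
    using partial_deriv_eq[OF has_derivative_mult[OF D]] D[THEN partial_deriv_eq] by simp
qed

lemma differentiable_upto_add:
  assumes "open \<Omega>" "differentiable_upto k \<Omega> f" "differentiable_upto k \<Omega> g"
  shows "differentiable_upto k \<Omega> (\<lambda>y. f y + g y)"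
  using assms(2,3)
proof (induction k arbitrary: f g)
  case 0
  then show ?case by (auto simp: differentiable_upto_0 intro: differentiable_on_add)
next
  case (Suc k)
  have d: "f differentiable (at x)" "g differentiable (at x)" if "x \<in> \<Omega>" for x
    using Suc.prems[THEN differentiable_upto_imp_differentiable] that assms(1)
    by (auto simp: differentiable_on_eq_differentiable_at)
  have "differentiable_upto k \<Omega> (partial_deriv i (\<lambda>y. f y + g y))" for i
  proof (rule differentiable_upto_cong[OF assms(1)])
    show "differentiable_upto k \<Omega> (\<lambda>y. partial_deriv i f y + partial_deriv i g y)"
      using Suc by (auto simp: differentiable_upto_Suc)
    fix x assume "x \<in> \<Omega>"
    then obtain D E where D: "(f has_derivative D) (at x)" "(g has_derivative E) (at x)"
      using d[of x] by (auto simp: differentiable_def)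
    show "partial_deriv i f x + partial_deriv i g x = partial_deriv i (\<lambda>y. f y + g y) x"
      using partial_deriv_eq[OF has_derivative_add[OF D]] D[THEN partial_deriv_eq] by simp
  qed
  with Suc.prems show ?case by (auto simp: differentiable_upto_Suc intro: differentiable_on_add)
qed

lemma differentiable_upto_mult:
  fixes f g :: "real^'n \<Rightarrow> 'b::real_normed_algebra"
  assumes "open \<Omega>" "differentiable_upto k \<Omega> f" "differentiable_upto k \<Omega> g"
  shows "differentiable_upto k \<Omega> (\<lambda>y. f y * g y)"
  using assms(2,3)
proof (induction k arbitrary: f g)
  case 0
  then show ?case by (auto simp: differentiable_upto_0 intro: differentiable_on_mult)
next
  case (Suc k)
  have d: "f differentiable (at x)" "g differentiable (at x)" if "x \<in> \<Omega>" for x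
    using Suc.prems[THEN differentiable_upto_imp_differentiable] that assms(1)
    by (auto simp: differentiable_on_eq_differentiable_at)
  have "differentiable_upto k \<Omega> (partial_deriv i (\<lambda>y. f y * g y))" for i
  proof (rule differentiable_upto_cong[OF assms(1)])
    show "differentiable_upto k \<Omega> (\<lambda>y. partial_deriv i f y * g y + f y * partial_deriv i g y)"
      using Suc.prems[THEN differentiable_upto_mono, of k] Suc.prems
      by (intro differentiable_upto_add[OF assms(1)] Suc.IH) (auto simp: differentiable_upto_Suc)
    show "partial_deriv i f x * g x + f x * partial_deriv i g x = partial_deriv i (\<lambda>y. f y * g y) x"
      if "x \<in> \<Omega>" for x using partial_deriv_mult d[OF that] by metis
  qed
  with Suc.prems show ?case by (auto simp: differentiable_upto_Suc intro: differentiable_on_mult)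
qed

lemma smooth_on_mult:
  fixes f g :: "real^'n \<Rightarrow> 'b::real_normed_algebra"
  shows "open \<Omega> \<Longrightarrow> smooth_on \<Omega> f \<Longrightarrow> smooth_on \<Omega> g \<Longrightarrow> smooth_on \<Omega> (\<lambda>y. f y * g y)"
  by (auto simp: smooth_on_iff_upto intro: differentiable_upto_mult)

text \<open>Each derivative doubles the number of summands in the Leibniz rule, hence the power of
  2. The induction removes the derivative taken first, so that the hypothesis applies to the pairs
  (f', g) and (f, g') with the same bounds.\<close>

lemma norm_partial_derivs_mult_le:
  fixes f g :: "real^'n \<Rightarrow> 'b::real_normed_algebra"
  assumes "open \<Omega>" "smooth_on \<Omega> f" "smooth_on \<Omega> g" "x \<in> \<Omega>" "0 \<le> A"
    and "\<And>\<gamma>. length \<gamma> \<le> length \<beta> \<Longrightarrow> norm (partial_derivs \<gamma> f x) \<le> A"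
    and "\<And>\<gamma>. length \<gamma> \<le> length \<beta> \<Longrightarrow> norm (partial_derivs \<gamma> g x) \<le> B"
  shows "norm (partial_derivs \<beta> (\<lambda>y. f y * g y) x) \<le> 2 ^ length \<beta> * A * B"
  using assms(2,3,6,7)
proof (induction \<beta> arbitrary: f g rule: rev_induct)
  case Nil
  show ?case using Nil(3,4)[of "[]"] assms(5)
    by simp (meson mult_mono' norm_ge_zero norm_mult_ineq order_trans)
next
  case (snoc i \<beta>)
  let ?df = "partial_deriv i f" and ?dg = "partial_deriv i g"
  have sm: "smooth_on \<Omega> ?df" "smooth_on \<Omega> ?dg"
    using snoc.prems by (auto intro: smooth_on_partial_deriv)
  have "partial_derivs (\<beta> @ [i]) (\<lambda>y. f y * g y) x
      = partial_derivs \<beta> (\<lambda>y. ?df y * g y + f y * ?dg y) x"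
    unfolding partial_derivs_append partial_derivs.simps
    by (rule partial_derivs_cong[OF assms(1) _ assms(4)], rule partial_deriv_mult)
      (use snoc.prems(1,2) assms(1) in \<open>auto intro: smooth_on_differentiable\<close>)
  also have "\<dots> = partial_derivs \<beta> (\<lambda>y. ?df y * g y) x + partial_derivs \<beta> (\<lambda>y. f y * ?dg y) x"
    by (intro partial_derivs_add[OF assms(1) _ _ assms(4)] smooth_on_mult assms(1) sm snoc.prems(1,2))
  finally have eq: "norm (partial_derivs (\<beta> @ [i]) (\<lambda>y. f y * g y) x)
      \<le> norm (partial_derivs \<beta> (\<lambda>y. ?df y * g y) x) + norm (partial_derivs \<beta> (\<lambda>y. f y * ?dg y) x)"
    by (metis norm_triangle_ineq)
  have "norm (partial_derivs \<gamma> ?df x) \<le> A" "norm (partial_derivs \<gamma> ?dg x) \<le> B"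
    if "length \<gamma> \<le> length \<beta>" for \<gamma>
    using snoc.prems(3,4)[of "\<gamma> @ [i]"] that by (auto simp: partial_derivs_append)
  then have "norm (partial_derivs \<beta> (\<lambda>y. ?df y * g y) x) \<le> 2 ^ length \<beta> * A * B"
    "norm (partial_derivs \<beta> (\<lambda>y. f y * ?dg y) x) \<le> 2 ^ length \<beta> * A * B"
    using snoc.prems(3,4) by (simp_all add: snoc.IH sm snoc.prems(1,2))
  with eq show ?case by simp
qed

text \<open>The outer function comes with the whole sequence of its derivatives: the chain rule
  replaces \<open>G j\<close> by \<open>G (Suc j)\<close>, so the induction has to run over all j at
  once.\<close>

lemma differentiable_upto_compose_real:
  fixes q :: "real^'n \<Rightarrow> real" and G :: "nat \<Rightarrow> real \<Rightarrow> real"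
  assumes "open \<Omega>" "\<And>j t. (G j has_real_derivative G (Suc j) t) (at t)" "differentiable_upto k \<Omega> q"
  shows "differentiable_upto k \<Omega> (\<lambda>x. G j (q x))"
  using assms(3)
proof (induction k arbitrary: j)
  case (0 j)
  have "G j differentiable_on UNIV" for j
    using assms(2) by (meson differentiable_on_def has_field_derivative_imp_has_derivative
        differentiable_def differentiable_at_withinI)
  then show ?case using 0
    by (auto simp: differentiable_upto_0 intro!: differentiable_on_compose[of q \<Omega> "G j"]
        intro: differentiable_on_subset)
next
  case (Suc k j)
  have d: "q differentiable (at x)" if "x \<in> \<Omega>" for x
    using Suc.prems[THEN differentiable_upto_imp_differentiable] that assms(1)
    by (auto simp: differentiable_on_eq_differentiable_at)
  have der: "((\<lambda>x. G j (q x)) has_derivative (\<lambda>h. G (Suc j) (q x) * D h)) (at x)"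
    if "(q has_derivative D) (at x)" for D x
    using has_derivative_compose[OF that assms(2)[of j "q x", unfolded has_field_derivative_def]]
    by simp
  have "differentiable_upto k \<Omega> (partial_deriv i (\<lambda>x. G j (q x)))" for i
  proof (rule differentiable_upto_cong[OF assms(1)])
    show "differentiable_upto k \<Omega> (\<lambda>x. G (Suc j) (q x) * partial_deriv i q x)"
      using Suc.prems differentiable_upto_mono[OF Suc.prems, of k]
      by (intro differentiable_upto_mult[OF assms(1)] Suc.IH) (auto simp: differentiable_upto_Suc)
    show "G (Suc j) (q x) * partial_deriv i q x = partial_deriv i (\<lambda>x. G j (q x)) x" if "x \<in> \<Omega>" for x
      using d[OF that] der partial_deriv_eq unfolding differentiable_def by metis
  qed
  moreover have "(\<lambda>x. G j (q x)) differentiable_on \<Omega>"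
    using d der assms(1) unfolding differentiable_def differentiable_on_eq_differentiable_at[OF assms(1)]
    by blast
  ultimately show ?case by (auto simp: differentiable_upto_Suc)
qed

lemma smooth_on_compose_real:
  fixes q :: "real^'n \<Rightarrow> real"
  assumes "open \<Omega>" "\<And>j t. (G j has_real_derivative G (Suc j) t) (at t)" "smooth_on \<Omega> q"
  shows "smooth_on \<Omega> (\<lambda>x. G j (q x))"
  unfolding smooth_on_iff_upto
  using differentiable_upto_compose_real[OF assms(1), of G] assms(2,3) smooth_on_iff_upto by blast

section \<open>Composition with affine maps\<close>

lemma partial_deriv_affine:
  fixes c :: real
  assumes "f differentiable (at (x + c *\<^sub>R y))"
  shows "partial_deriv i (\<lambda>y. f (x + c *\<^sub>R y)) y = c *\<^sub>R partial_deriv i f (x + c *\<^sub>R y)"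
    and "(\<lambda>y. f (x + c *\<^sub>R y)) differentiable (at y)"
proof -
  from assms obtain D where D: "(f has_derivative D) (at (x + c *\<^sub>R y))" by (auto simp: differentiable_def)
  interpret bounded_linear D using D by (rule has_derivative_bounded_linear)
  have "((\<lambda>y. x + c *\<^sub>R y) has_derivative (\<lambda>h. c *\<^sub>R h)) (at y)"
    by (auto intro!: derivative_eq_intros)
  from has_derivative_compose[OF this D]
  have "((\<lambda>y. f (x + c *\<^sub>R y)) has_derivative (\<lambda>h. D (c *\<^sub>R h))) (at y)" .
  from partial_deriv_eq[OF this] partial_deriv_eq[OF D] this
  show "partial_deriv i (\<lambda>y. f (x + c *\<^sub>R y)) y = c *\<^sub>R partial_deriv i f (x + c *\<^sub>R y)"
    "(\<lambda>y. f (x + c *\<^sub>R y)) differentiable (at y)" by (auto simp: scaleR differentiable_def)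
qed

text \<open>One statement for translations (\<open>c = 1\<close>), reflections
  (\<open>c = -1\<close>) and the dilation of the mollifier
  (\<open>c = inverse \<epsilon>\<close>).\<close>

lemma smooth_on_affine:
  fixes c :: real
  assumes "smooth_on UNIV f"
  shows partial_derivs_affine: "partial_derivs \<beta> (\<lambda>y. f (x + c *\<^sub>R y))
      = (\<lambda>y. c ^ length \<beta> *\<^sub>R partial_derivs \<beta> f (x + c *\<^sub>R y))"
    and "smooth_on UNIV (\<lambda>y. f (x + c *\<^sub>R y))"
proof -
  note d = smooth_on_differentiable[OF smooth_on_partial_derivs[OF assms] open_UNIV UNIV_I]
  show *: "partial_derivs \<beta> (\<lambda>y. f (x + c *\<^sub>R y))
      = (\<lambda>y. c ^ length \<beta> *\<^sub>R partial_derivs \<beta> f (x + c *\<^sub>R y))" for \<beta>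
  proof (induction \<beta>)
    case (Cons i \<beta>)
    show ?case
    proof
      fix y
      have "partial_deriv i (\<lambda>y. c ^ length \<beta> *\<^sub>R partial_derivs \<beta> f (x + c *\<^sub>R y)) y
        = c ^ length \<beta> *\<^sub>R (c *\<^sub>R partial_deriv i (partial_derivs \<beta> f) (x + c *\<^sub>R y))"
        using partial_deriv_affine[OF d]
        by (subst partial_deriv_linear[OF bounded_linear_scaleR_right]) auto
      then show "partial_derivs (i # \<beta>) (\<lambda>y. f (x + c *\<^sub>R y)) y
         = c ^ length (i # \<beta>) *\<^sub>R partial_derivs (i # \<beta>) f (x + c *\<^sub>R y)"
        by (simp add: Cons.IH mult.commute)
    qed
  qed simp
  have "(\<lambda>y. c ^ length \<beta> *\<^sub>R partial_derivs \<beta> f (x + c *\<^sub>R y)) differentiable (at y)" for \<beta> y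
    using partial_deriv_affine(2)[OF d] by (intro differentiable_scaleR) auto
  then show "smooth_on UNIV (\<lambda>y. f (x + c *\<^sub>R y))"
    by (auto simp: smooth_on_def * differentiable_on_eq_differentiable_at)
qed

lemma smooth_on_translate:
  assumes "smooth_on UNIV f"
  shows partial_derivs_translate: "partial_derivs \<beta> (\<lambda>y. f (x + y)) = (\<lambda>y. partial_derivs \<beta> f (x + y))"
    and "smooth_on UNIV (\<lambda>y. f (x + y))"
  using smooth_on_affine[OF assms, where c = 1] by auto

subsection \<open>Symmetry of second derivatives and Taylor estimates\<close>

lemma has_vector_derivative_bound:
  fixes A :: "real \<Rightarrow> 'b::real_normed_vector"
  assumes "0 \<le> t" "\<And>s. s \<in> {0..t} \<Longrightarrow> (A has_vector_derivative A' s) (at s)"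
    "\<And>s. s \<in> {0..t} \<Longrightarrow> norm (A' s) \<le> B"
  shows "norm (A t - A 0) \<le> B * t"
proof -
  have "norm (A t - A 0) \<le> B * norm (t - 0)"
  proof (rule differentiable_bound)
    show "(A has_derivative (\<lambda>h. h *\<^sub>R A' s)) (at s within {0..t})" if "s \<in> {0..t}" for s
      using assms(2)[OF that] by (auto simp: has_vector_derivative_def intro: has_derivative_at_withinI)
    show "onorm (\<lambda>h. h *\<^sub>R A' s) \<le> B" if "s \<in> {0..t}" for s
      using assms(3)[OF that] by (intro onorm_le) (simp add: mult.commute[of B] mult_left_mono)
  qed (use assms(1) in auto)
  then show ?thesis using assms(1) by simp
qed

lemma has_vector_derivative_line:
  fixes f :: "real^'n \<Rightarrow> 'b::real_normed_vector"
  assumes "f differentiable (at (x + s *\<^sub>R v))"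
  shows "((\<lambda>s. f (x + s *\<^sub>R v)) has_vector_derivative
           (\<Sum>i\<in>UNIV. v $ i *\<^sub>R partial_deriv i f (x + s *\<^sub>R v))) (at s)"
proof -
  have "((\<lambda>s::real. x + s *\<^sub>R v) has_derivative (\<lambda>h. h *\<^sub>R v)) (at s)"
    by (auto intro!: derivative_eq_intros)
  from has_derivative_compose[OF this has_derivative_partials[OF assms]]
  show ?thesis by (simp add: has_vector_derivative_def scaleR_sum_right)
qed

lemma has_vector_derivative_axis:
  fixes f :: "real^'n \<Rightarrow> 'b::real_normed_vector"
  assumes "f differentiable (at (x + s *\<^sub>R axis i 1))"
  shows "((\<lambda>s. f (x + s *\<^sub>R axis i 1)) has_vector_derivative partial_deriv i f (x + s *\<^sub>R axis i 1)) (at s)"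
proof -
  have "(\<Sum>j\<in>UNIV. axis i 1 $ j *\<^sub>R partial_deriv j f y) = partial_deriv i f y" for y
    by (simp add: axis_def if_distrib[of "\<lambda>c. c *\<^sub>R _"] cong: if_cong)
  with has_vector_derivative_line[OF assms] show ?thesis by simp
qed

text \<open>The second difference is the increment, along direction i, of the difference of f at two
  points that are \<open>t\<close> apart in direction j. The mean value inequality reduces it to the
  first-order expansion of \<open>partial_deriv i f\<close> at the single point \<open>x\<close>,
  evaluated at displacements of length at most \<open>2 * t\<close> and \<open>t\<close>; their sum
  explains the constant 3.\<close>

lemma second_difference_estimate:
  fixes f :: "real^'n \<Rightarrow> 'b::real_normed_vector"
  assumes "open \<Omega>" "x \<in> \<Omega>" "\<And>y. y \<in> \<Omega> \<Longrightarrow> f differentiable (at y)"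
    and "partial_deriv i f differentiable (at x)" "0 < e"
  shows "\<forall>\<^sub>F t in at_right 0. norm (f (x + t *\<^sub>R axis i 1 + t *\<^sub>R axis j 1) - f (x + t *\<^sub>R axis i 1)
           - f (x + t *\<^sub>R axis j 1) + f x - t\<^sup>2 *\<^sub>R partial_deriv j (partial_deriv i f) x) \<le> 3 * e * t\<^sup>2"
proof -
  let ?g = "partial_deriv i f" and ?a = "axis i 1 :: real^'n" and ?b = "axis j 1 :: real^'n"
  obtain D where D: "(?g has_derivative D) (at x)" using assms(4) by (auto simp: differentiable_def)
  then interpret bounded_linear D by (rule has_derivative_bounded_linear)
  obtain d1 where d1: "0 < d1" "\<And>y. norm (y - x) < d1 \<Longrightarrow> norm (?g y - ?g x - D (y - x)) \<le> e * norm (y - x)"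
    using D \<open>0 < e\<close> unfolding has_derivative_at_alt by blast
  obtain d2 where d2: "0 < d2" "ball x d2 \<subseteq> \<Omega>" using assms(1,2) openE by blast
  \<comment> \<open>Halved because the displacements from \<open>x\<close> reach length
    \<open>2 * t\<close>.\<close>
  define d where "d = min d1 d2 / 2"
  have "d > 0" using d1 d2 by (simp add: d_def)
  have "norm (f (x + t *\<^sub>R ?a + t *\<^sub>R ?b) - f (x + t *\<^sub>R ?a) - f (x + t *\<^sub>R ?b) + f x
      - t\<^sup>2 *\<^sub>R partial_deriv j ?g x) \<le> 3 * e * t\<^sup>2" if t: "0 < t" "t < d" for t
  proof -
    \<comment> \<open>The linear term is chosen so that the derivative of \<open>A\<close> is a
      difference of two first-order errors of \<open>?g\<close> at \<open>x\<close>.\<close>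
    define A where "A s = f ((x + t *\<^sub>R ?b) + s *\<^sub>R ?a) - f (x + s *\<^sub>R ?a) - s *\<^sub>R (t *\<^sub>R D ?b)" for s
    have small: "norm (s *\<^sub>R ?a) \<le> t" "norm (s *\<^sub>R ?a + t *\<^sub>R ?b) \<le> 2 * t" if "s \<in> {0..t}" for s
      using that norm_triangle_ineq[of "s *\<^sub>R ?a" "t *\<^sub>R ?b"] t by auto
    have in\<Omega>: "x + h \<in> \<Omega>" "norm h < d1" if "norm h \<le> 2 * t" for h
      using that t d2 by (auto simp: d_def dist_norm subset_iff)
    have dA: "(A has_vector_derivative (?g ((x + t *\<^sub>R ?b) + s *\<^sub>R ?a) - ?g (x + s *\<^sub>R ?a) - t *\<^sub>R D ?b)) (at s)"
      if s: "s \<in> {0..t}" for s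
      unfolding A_def
      using small[OF s] in\<Omega>[of "s *\<^sub>R ?a"] in\<Omega>[of "s *\<^sub>R ?a + t *\<^sub>R ?b"] t
      by (intro has_vector_derivative_diff has_vector_derivative_axis assms(3))
        (auto simp: algebra_simps intro!: derivative_eq_intros)
    have "norm (?g ((x + t *\<^sub>R ?b) + s *\<^sub>R ?a) - ?g (x + s *\<^sub>R ?a) - t *\<^sub>R D ?b) \<le> 3 * e * t"
      if s: "s \<in> {0..t}" for s
    proof -
      define u v where "u = ?g (x + (s *\<^sub>R ?a + t *\<^sub>R ?b)) - ?g x - D (s *\<^sub>R ?a + t *\<^sub>R ?b)"
        and "v = ?g (x + s *\<^sub>R ?a) - ?g x - D (s *\<^sub>R ?a)"
      have "norm u \<le> e * norm (s *\<^sub>R ?a + t *\<^sub>R ?b)"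
        using d1(2)[of "x + (s *\<^sub>R ?a + t *\<^sub>R ?b)"] small[OF s] in\<Omega>(2) by (simp add: u_def)
      moreover have "norm v \<le> e * norm (s *\<^sub>R ?a)"
        using d1(2)[of "x + s *\<^sub>R ?a"] small[OF s] in\<Omega>(2)[of "s *\<^sub>R ?a"] t by (simp add: v_def)
      moreover have "e * norm (s *\<^sub>R ?a + t *\<^sub>R ?b) \<le> e * (2 * t)" "e * norm (s *\<^sub>R ?a) \<le> e * t"
        using small[OF s] \<open>0 < e\<close> by (auto intro!: mult_left_mono)
      moreover have "?g ((x + t *\<^sub>R ?b) + s *\<^sub>R ?a) - ?g (x + s *\<^sub>R ?a) - t *\<^sub>R D ?b = u - v"
        by (simp add: u_def v_def add scaleR algebra_simps)
      ultimately show ?thesis using norm_triangle_ineq4[of u v] by simp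
    qed
    from has_vector_derivative_bound[OF less_imp_le[OF t(1)] dA this]
    have "norm (A t - A 0) \<le> 3 * e * t * t" by auto
    moreover have "A t - A 0 = f (x + t *\<^sub>R ?a + t *\<^sub>R ?b) - f (x + t *\<^sub>R ?a) - f (x + t *\<^sub>R ?b) + f x
      - t\<^sup>2 *\<^sub>R partial_deriv j ?g x"
      by (simp add: A_def partial_deriv_eq[OF D] power2_eq_square algebra_simps)
    ultimately show ?thesis by (simp add: power2_eq_square algebra_simps)
  qed
  then show ?thesis using \<open>d > 0\<close> unfolding eventually_at_right_field by blast
qed

text \<open>The second difference is symmetric in i and j, and divided by t^2 it is close to either
  mixed derivative. The two estimates with constant 3 * (e / 6) add up to e.\<close>

lemma partial_deriv_commute:
  fixes f :: "real^'n \<Rightarrow> 'b::real_normed_vector"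
  assumes "open \<Omega>" "smooth_on \<Omega> f" "x \<in> \<Omega>"
  shows "partial_deriv i (partial_deriv j f) x = partial_deriv j (partial_deriv i f) x"
proof -
  let ?p = "partial_deriv j (partial_deriv i f) x" and ?q = "partial_deriv i (partial_deriv j f) x"
  note d = smooth_on_differentiable[OF assms(2,1)]
    smooth_on_differentiable[OF smooth_on_partial_deriv[OF assms(2)] assms(1,3)]
  have "norm (?q - ?p) \<le> e" if "0 < e" for e
  proof -
    have "0 < e / 6" using that by simp
    then have E: "\<forall>\<^sub>F t in at_right 0. norm (f (x + t *\<^sub>R axis i 1 + t *\<^sub>R axis j 1) - f (x + t *\<^sub>R axis i 1)
           - f (x + t *\<^sub>R axis j 1) + f x - t\<^sup>2 *\<^sub>R partial_deriv j (partial_deriv i f) x) \<le> 3 * (e / 6) * t\<^sup>2"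
      for i j by (intro second_difference_estimate[OF assms(1,3)] d)
    obtain t :: real where elim:
      "norm (f (x + t *\<^sub>R axis i 1 + t *\<^sub>R axis j 1) - f (x + t *\<^sub>R axis i 1)
           - f (x + t *\<^sub>R axis j 1) + f x - t\<^sup>2 *\<^sub>R ?p) \<le> 3 * (e / 6) * t\<^sup>2"
      "norm (f (x + t *\<^sub>R axis j 1 + t *\<^sub>R axis i 1) - f (x + t *\<^sub>R axis j 1)
           - f (x + t *\<^sub>R axis i 1) + f x - t\<^sup>2 *\<^sub>R ?q) \<le> 3 * (e / 6) * t\<^sup>2" "0 < t"
      using eventually_happens'[OF _ eventually_conj[OF E[of i j]
            eventually_conj[OF E[of j i] eventually_at_right_less]]] by auto
    show "norm (?q - ?p) \<le> e"
    proof -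
      let ?a = "t *\<^sub>R axis i 1 :: real^'n" and ?b = "t *\<^sub>R axis j 1 :: real^'n"
      define w where "w = f (x + ?a + ?b) - f (x + ?a) - f (x + ?b) + f x"
      have "norm (w - t\<^sup>2 *\<^sub>R ?p) \<le> 3 * (e / 6) * t\<^sup>2" using elim(1) by (simp add: w_def)
      moreover have "norm (w - t\<^sup>2 *\<^sub>R ?q) \<le> 3 * (e / 6) * t\<^sup>2"
        using elim(2) by (simp add: w_def algebra_simps)
      moreover have "t\<^sup>2 *\<^sub>R (?q - ?p) = (w - t\<^sup>2 *\<^sub>R ?p) - (w - t\<^sup>2 *\<^sub>R ?q)" by (simp add: algebra_simps)
      then have "norm (t\<^sup>2 *\<^sub>R (?q - ?p)) \<le> norm (w - t\<^sup>2 *\<^sub>R ?p) + norm (w - t\<^sup>2 *\<^sub>R ?q)"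
        by (metis norm_triangle_ineq4)
      ultimately have "norm (t\<^sup>2 *\<^sub>R (?q - ?p)) \<le> e * t\<^sup>2" by linarith
      then have "t\<^sup>2 * norm (?q - ?p) \<le> t\<^sup>2 * e" by (simp add: mult.commute)
      then show ?thesis using elim(3) by (simp only: mult_le_cancel_left_pos zero_less_power)
    qed
  qed
  then have "norm (?q - ?p) \<le> 0" by (rule field_le_epsilon) simp
  then show ?thesis by simp
qed

text \<open>Needed so that the derivatives of a Taylor remainder of \<open>a\<close> are the Taylor
  remainders of the derivatives of \<open>a\<close>.\<close>

lemma partial_derivs_commute:
  fixes f :: "real^'n \<Rightarrow> 'b::real_normed_vector"
  assumes "open \<Omega>" "smooth_on \<Omega> f" "x \<in> \<Omega>"
  shows "partial_derivs \<beta> (partial_deriv i f) x = partial_deriv i (partial_derivs \<beta> f) x"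
  using assms(3)
proof (induction \<beta> arbitrary: x)
  case (Cons j \<beta>)
  have "partial_derivs (j # \<beta>) (partial_deriv i f) x = partial_deriv j (partial_deriv i (partial_derivs \<beta> f)) x"
    unfolding partial_derivs.simps by (rule partial_deriv_cong[OF assms(1) Cons.prems Cons.IH])
  also have "\<dots> = partial_deriv i (partial_deriv j (partial_derivs \<beta> f)) x"
    by (rule partial_deriv_commute[OF assms(1) smooth_on_partial_derivs[OF assms(2)] Cons.prems])
  finally show ?case by simp
qed simp

section \<open>Finitely many seminorms, and functions with bounded derivatives\<close>

lemma finite_lists_length_le_UNIV: "finite {\<beta> :: 'n::finite list. length \<beta> \<le> N}"
  using finite_lists_length_le[of "UNIV :: 'n set" N] by simp

lemma uniform_bound_lists:
  fixes P :: "'n::finite list \<Rightarrow> real \<Rightarrow> bool"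
  assumes ex: "\<And>\<beta>. length \<beta> \<le> N \<Longrightarrow> \<exists>M. P \<beta> M" and mono: "\<And>\<beta> M M'. P \<beta> M \<Longrightarrow> M \<le> M' \<Longrightarrow> P \<beta> M'"
  obtains M where "0 \<le> M" "\<And>\<beta>. length \<beta> \<le> N \<Longrightarrow> P \<beta> M"
proof -
  obtain m where m: "\<And>\<beta>. length \<beta> \<le> N \<Longrightarrow> P \<beta> (m \<beta>)" using ex by metis
  let ?M = "\<Sum>\<beta> | length \<beta> \<le> N. \<bar>m \<beta>\<bar>"
  have "\<bar>m \<beta>\<bar> \<le> ?M" if "length \<beta> \<le> N" for \<beta>
    using that by (intro member_le_sum finite_lists_length_le_UNIV) auto
  then have "P \<beta> ?M" if "length \<beta> \<le> N" for \<beta>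
    using mono[OF m] that by (meson abs_ge_self order_trans)
  moreover have "0 \<le> ?M" by (simp add: sum_nonneg)
  ultimately show ?thesis using that by blast
qed

text \<open>A Schwartz mollifier need not have compact support, so cut-off distributions are applied
  to this larger class. It is stable under translations, dilations and averages against integrable
  weights, and its Lipschitz and Taylor constants are uniform over the whole space.\<close>

definition bounded_smooth :: "(real^'n \<Rightarrow> 'b::real_normed_vector) \<Rightarrow> bool" where
  "bounded_smooth f \<longleftrightarrow> smooth_on UNIV f \<and> (\<forall>\<beta>. bounded (range (partial_derivs \<beta> f)))"

lemma bounded_smoothI:
  "smooth_on UNIV f \<Longrightarrow> (\<And>\<beta>. \<exists>M. \<forall>x. norm (partial_derivs \<beta> f x) \<le> M) \<Longrightarrow> bounded_smooth f"
  by (auto simp: bounded_smooth_def bounded_iff)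

lemma bounded_smooth_smooth: "bounded_smooth f \<Longrightarrow> smooth_on UNIV f"
  by (simp add: bounded_smooth_def)

lemma bounded_smooth_bound: "bounded_smooth f \<Longrightarrow> \<exists>M. \<forall>x. norm (partial_derivs \<beta> f x) \<le> M"
  by (auto simp: bounded_smooth_def bounded_iff)

lemma bounded_smooth_uniform_bound:
  fixes f :: "real^'n \<Rightarrow> 'b::real_normed_vector"
  assumes "bounded_smooth f"
  obtains M where "0 \<le> M" "\<And>\<beta> x. length \<beta> \<le> N \<Longrightarrow> norm (partial_derivs \<beta> f x) \<le> M"
proof (rule uniform_bound_lists[where N = N and P = "\<lambda>\<beta> M. \<forall>x. norm (partial_derivs \<beta> f x) \<le> M"])
  show "\<exists>M. \<forall>x. norm (partial_derivs \<beta> f x) \<le> M" for \<beta>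
    using bounded_smooth_bound[OF assms] by auto
qed (use that in \<open>auto intro: order_trans\<close>)

lemma bounded_smooth_partial_derivs: "bounded_smooth f \<Longrightarrow> bounded_smooth (partial_derivs \<beta> f)"
  unfolding bounded_smooth_def by (metis partial_derivs_append smooth_on_partial_derivs)

lemma bounded_smooth_partial_deriv: "bounded_smooth f \<Longrightarrow> bounded_smooth (partial_deriv i f)"
  using bounded_smooth_partial_derivs[of f "[i]"] by simp

lemma bounded_smooth_add:
  assumes "bounded_smooth f" "bounded_smooth g"
  shows "bounded_smooth (\<lambda>x. f x + g x)"
proof (rule bounded_smoothI)
  note s = assms[THEN bounded_smooth_smooth]
  show "smooth_on UNIV (\<lambda>x. f x + g x)" using s by (rule smooth_on_add(2)[OF open_UNIV])
  fix \<beta>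
  obtain A B where "\<forall>x. norm (partial_derivs \<beta> f x) \<le> A" "\<forall>x. norm (partial_derivs \<beta> g x) \<le> B"
    using assms[THEN bounded_smooth_bound] by metis
  then have "norm (partial_derivs \<beta> (\<lambda>x. f x + g x) x) \<le> A + B" for x
    by (simp add: partial_derivs_add[OF open_UNIV s] norm_triangle_mono)
  then show "\<exists>M. \<forall>x. norm (partial_derivs \<beta> (\<lambda>x. f x + g x) x) \<le> M" by blast
qed

lemma bounded_smooth_linear:
  assumes "bounded_smooth f" "bounded_linear L"
  shows "bounded_smooth (\<lambda>x. L (f x))"
proof (rule bounded_smoothI)
  note s = bounded_smooth_smooth[OF assms(1)]
  show "smooth_on UNIV (\<lambda>x. L (f x))" using s assms(2) by (rule smooth_on_linear(2)[OF open_UNIV])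
  fix \<beta>
  obtain A where "\<forall>x. norm (partial_derivs \<beta> f x) \<le> A"
    using assms(1)[THEN bounded_smooth_bound] by metis
  moreover obtain K where "0 < K" "\<And>x. norm (L x) \<le> norm x * K"
    using bounded_linear.pos_bounded[OF assms(2)] by blast
  ultimately have "norm (partial_derivs \<beta> (\<lambda>x. L (f x)) x) \<le> A * K" for x
    by (metis partial_derivs_linear[OF open_UNIV s assms(2) UNIV_I] mult_right_mono order_trans less_imp_le)
  then show "\<exists>M. \<forall>x. norm (partial_derivs \<beta> (\<lambda>x. L (f x)) x) \<le> M" by blast
qed

lemmas bounded_smooth_scaleR = bounded_smooth_linear[OF _ bounded_linear_scaleR_right]
lemmas bounded_smooth_cmult = bounded_smooth_linear[OF _ bounded_linear_mult_right]
lemmas bounded_smooth_minus = bounded_smooth_linear[OF _ bounded_linear_minus[OF bounded_linear_ident]]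

lemma bounded_smooth_diff:
  "bounded_smooth f \<Longrightarrow> bounded_smooth g \<Longrightarrow> bounded_smooth (\<lambda>x. f x - g x)"
  using bounded_smooth_add[OF _ bounded_smooth_minus, of f g] by simp

lemma bounded_smooth_zero: "bounded_smooth (\<lambda>x. 0)"
  by (rule bounded_smoothI) (auto simp: partial_derivs_const)

lemma bounded_smooth_sum:
  "(\<And>j. j \<in> J \<Longrightarrow> bounded_smooth (f j)) \<Longrightarrow> bounded_smooth (\<lambda>x. \<Sum>j\<in>J. f j x)"
  by (induction J rule: infinite_finite_induct) (auto intro: bounded_smooth_zero bounded_smooth_add)

lemma bounded_smooth_affine:
  assumes "bounded_smooth f"
  shows "bounded_smooth (\<lambda>y. f (x + (c::real) *\<^sub>R y))"
proof (rule bounded_smoothI)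
  note s = bounded_smooth_smooth[OF assms(1)]
  show "smooth_on UNIV (\<lambda>y. f (x + c *\<^sub>R y))" using s by (rule smooth_on_affine)
  fix \<beta>
  obtain A where "\<forall>x. norm (partial_derivs \<beta> f x) \<le> A"
    using assms(1)[THEN bounded_smooth_bound] by metis
  then have "norm (partial_derivs \<beta> (\<lambda>y. f (x + c *\<^sub>R y)) y) \<le> \<bar>c\<bar> ^ length \<beta> * A" for y
    by (auto simp: partial_derivs_affine[OF s] power_abs intro!: mult_left_mono)
  then show "\<exists>M. \<forall>y. norm (partial_derivs \<beta> (\<lambda>y. f (x + c *\<^sub>R y)) y) \<le> M" by blast
qed

lemma bounded_smooth_translate: "bounded_smooth f \<Longrightarrow> bounded_smooth (\<lambda>y. f (x + y))"
  using bounded_smooth_affine[of f x 1] by simp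

lemma bounded_smooth_lipschitz:
  fixes f :: "real^'n \<Rightarrow> 'b::real_normed_vector"
  assumes "bounded_smooth f"
  obtains M where "0 \<le> M" "\<And>x y. norm (f x - f y) \<le> M * norm (x - y)"
proof -
  obtain M where M: "0 \<le> M" "\<And>\<beta> x. length \<beta> \<le> 1 \<Longrightarrow> norm (partial_derivs \<beta> f x) \<le> M"
    using bounded_smooth_uniform_bound[OF assms, of 1] by metis
  have M': "norm (partial_deriv i f x) \<le> M" for i x using M(2)[of "[i]"] by simp
  have "norm (f x - f y) \<le> (real CARD('n) * M) * norm (x - y)" for x y
  proof (rule differentiable_bound[OF convex_UNIV])
    fix x
    show "(f has_derivative (\<lambda>h. \<Sum>i\<in>UNIV. h $ i *\<^sub>R partial_deriv i f x)) (at x)"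
      by (intro has_derivative_partials smooth_on_differentiable[OF bounded_smooth_smooth[OF assms]]) auto
    have "norm (\<Sum>i\<in>UNIV. h $ i *\<^sub>R partial_deriv i f x) \<le> (\<Sum>i\<in>(UNIV::'n set). norm h * M)" for h
      using M' by (intro sum_norm_le) (auto intro!: mult_mono simp: component_le_norm_cart)
    then show "onorm (\<lambda>h. \<Sum>i\<in>UNIV. h $ i *\<^sub>R partial_deriv i f x) \<le> real CARD('n) * M"
      by (intro onorm_le) (simp add: mult_ac)
  qed auto
  with M(1) that[of "real CARD('n) * M"] show ?thesis by simp
qed

text \<open>Along the segment, the derivative of the remainder is the increment of the gradient
  paired with \<open>h\<close>. The increment is itself of order \<open>norm h\<close> by the
  Lipschitz bound, which gives the square with a constant independent of \<open>x\<close>.\<close>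

lemma bounded_smooth_taylor:
  fixes f :: "real^'n \<Rightarrow> 'b::real_normed_vector"
  assumes "bounded_smooth f"
  shows "\<exists>M. \<forall>x h. norm (f (x + h) - f x - (\<Sum>i\<in>UNIV. h $ i *\<^sub>R partial_deriv i f x)) \<le> M * (norm h)\<^sup>2"
proof -
  have "\<exists>M\<ge>0. \<forall>x y. norm (partial_deriv i f x - partial_deriv i f y) \<le> M * norm (x - y)" for i
    using bounded_smooth_lipschitz[OF bounded_smooth_partial_deriv[OF assms]] by metis
  then obtain M where M: "\<And>i. 0 \<le> M i"
    "\<And>i x y. norm (partial_deriv i f x - partial_deriv i f y) \<le> M i * norm (x - y)" by metis
  have "norm (f (x + h) - f x - (\<Sum>i\<in>UNIV. h $ i *\<^sub>R partial_deriv i f x)) \<le> (\<Sum>i\<in>UNIV. M i) * (norm h)\<^sup>2" for x h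
  proof -
    define A where "A s = f (x + s *\<^sub>R h) - s *\<^sub>R (\<Sum>i\<in>UNIV. h $ i *\<^sub>R partial_deriv i f x)" for s
    define A' where "A' s = (\<Sum>i\<in>UNIV. h $ i *\<^sub>R partial_deriv i f (x + s *\<^sub>R h))
        - (\<Sum>i\<in>UNIV. h $ i *\<^sub>R partial_deriv i f x)" for s
    have "(A has_vector_derivative A' s) (at s)" for s
      unfolding A_def A'_def
      by (intro has_vector_derivative_diff has_vector_derivative_line
          smooth_on_differentiable[OF bounded_smooth_smooth[OF assms]])
        (auto intro!: derivative_eq_intros)
    moreover have "norm (A' s) \<le> (\<Sum>i\<in>UNIV. M i) * (norm h)\<^sup>2" if s: "s \<in> {0..1}" for s
    proof -
      have "A' s = (\<Sum>i\<in>UNIV. h $ i *\<^sub>R (partial_deriv i f (x + s *\<^sub>R h) - partial_deriv i f x))"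
        by (simp add: A'_def sum_subtractf scaleR_diff_right)
      also have "norm \<dots> \<le> (\<Sum>i\<in>UNIV. norm h * (M i * norm h))"
      proof (intro sum_norm_le)
        fix i
        have "norm (partial_deriv i f (x + s *\<^sub>R h) - partial_deriv i f x) \<le> M i * norm (s *\<^sub>R h)"
          using M(2)[of i "x + s *\<^sub>R h" x] by simp
        also have "\<dots> \<le> M i * norm h"
          using s M(1) by (intro mult_left_mono) (auto simp: mult_left_le_one_le)
        finally show "norm (h $ i *\<^sub>R (partial_deriv i f (x + s *\<^sub>R h) - partial_deriv i f x))
            \<le> norm h * (M i * norm h)"
          by (auto intro!: mult_mono simp: component_le_norm_cart)
      qed
      also have "\<dots> = (\<Sum>i\<in>UNIV. M i) * (norm h)\<^sup>2"
        unfolding sum_distrib_right by (intro sum.cong) (auto simp: power2_eq_square)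
      finally show ?thesis .
    qed
    ultimately have "norm (A 1 - A 0) \<le> (\<Sum>i\<in>UNIV. M i) * (norm h)\<^sup>2 * 1"
      by (intro has_vector_derivative_bound) auto
    then show ?thesis by (simp add: A_def algebra_simps)
  qed
  then show ?thesis by blast
qed

lemma uniform_bound_lists_mult:
  fixes f :: "'n::finite list \<Rightarrow> 'u \<Rightarrow> 'v \<Rightarrow> real"
  assumes "\<And>\<beta>. \<exists>M. \<forall>u v. f \<beta> u v \<le> M * g u v" "\<And>u v. 0 \<le> g u v"
  obtains M where "0 \<le> M" "\<And>\<beta> u v. length \<beta> \<le> N \<Longrightarrow> f \<beta> u v \<le> M * g u v"
proof (rule uniform_bound_lists[where N = N and P = "\<lambda>\<beta> M. \<forall>u v. f \<beta> u v \<le> M * g u v"])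
  show "\<forall>u v. f \<beta> u v \<le> M' * g u v" if "\<forall>u v. f \<beta> u v \<le> M * g u v" "M \<le> M'" for \<beta> M M'
    using that assms(2) by (meson mult_right_mono order_trans)
qed (use that assms(1) in auto)

section \<open>Continuous functionals on bounded smooth functions\<close>

text \<open>Covers cut-off distributions, with \<open>S\<close> the support of the cutoff, as well
  as integration against an integrable weight, with \<open>S = UNIV\<close> and
  \<open>N = 0\<close>. An arbitrary bound \<open>M\<close> takes the place of suprema, which would
  need boundedness at every use; \<open>0 \<le> M\<close> is not implied by the other condition when
  \<open>S\<close> is empty.\<close>

locale smooth_functional =
  fixes L :: "(real^'n \<Rightarrow> 'k::{real_normed_field,euclidean_space}) \<Rightarrow> 'k"
    and S :: "(real^'n) set" and C :: real and N :: nat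
  assumes apply_add: "bounded_smooth a \<Longrightarrow> bounded_smooth b \<Longrightarrow> L (\<lambda>y. a y + b y) = L a + L b"
    and apply_cmult: "bounded_smooth a \<Longrightarrow> L (\<lambda>y. c * a y) = c * L a"
    and apply_bound: "bounded_smooth a \<Longrightarrow> 0 \<le> M \<Longrightarrow>
      (\<And>\<beta> y. length \<beta> \<le> N \<Longrightarrow> y \<in> S \<Longrightarrow> norm (partial_derivs \<beta> a y) \<le> M) \<Longrightarrow> norm (L a) \<le> C * M"
    and C_nonneg: "0 \<le> C"
begin

lemma apply_scaleR: "bounded_smooth a \<Longrightarrow> L (\<lambda>y. c *\<^sub>R a y) = c *\<^sub>R L a"
  using apply_cmult[of a "of_real c"] by (simp add: scaleR_conv_of_real)

lemma apply_diff:
  assumes "bounded_smooth a" "bounded_smooth b"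
  shows "L (\<lambda>y. a y - b y) = L a - L b"
  using apply_add[OF bounded_smooth_diff[OF assms] assms(2)] by simp

lemma apply_zero: "L (\<lambda>y. 0) = 0"
  using apply_cmult[of "\<lambda>y. 0" 0] by (simp add: bounded_smooth_zero)

lemma apply_sum:
  assumes "\<And>j. j \<in> J \<Longrightarrow> bounded_smooth (f j)"
  shows "L (\<lambda>y. \<Sum>j\<in>J. f j y) = (\<Sum>j\<in>J. L (f j))"
  using assms
  by (induction J rule: infinite_finite_induct) (auto simp: apply_zero apply_add bounded_smooth_sum)

text \<open>Difference quotients of translates converge in every seminorm: the remainder
  \<open>?R h\<close> and its derivatives up to order \<open>N\<close> are at most M * |h|^2
  everywhere, and \<open>L\<close> passes this bound on to its value. The candidate derivative comes
  out of \<open>L\<close> by linearity.\<close>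

lemma apply_translate_has_derivative:
  assumes a: "bounded_smooth a"
  shows "((\<lambda>x. L (\<lambda>y. a (x + y))) has_derivative
           (\<lambda>h. \<Sum>i\<in>UNIV. h $ i *\<^sub>R L (\<lambda>y. partial_deriv i a (x + y)))) (at x)"
proof -
  let ?D = "\<lambda>h. \<Sum>i\<in>UNIV. h $ i *\<^sub>R L (\<lambda>y. partial_deriv i a (x + y))"
  let ?R = "\<lambda>h y. a ((x + h) + y) - a (x + y) - (\<Sum>i\<in>UNIV. h $ i *\<^sub>R partial_deriv i a (x + y))"
  have smooth: "smooth_on UNIV a" using a by (rule bounded_smooth_smooth)
  have bs: "bounded_smooth (\<lambda>y. \<Sum>i\<in>UNIV. h $ i *\<^sub>R partial_deriv i a (x + y))" for h
    by (intro bounded_smooth_sum bounded_smooth_scaleR bounded_smooth_translate bounded_smooth_partial_deriv a)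
  have bR: "bounded_smooth (?R h)" for h
    by (intro bounded_smooth_diff bounded_smooth_translate a bs)
  have LR: "L (?R h) = L (\<lambda>y. a ((x + h) + y)) - L (\<lambda>y. a (x + y)) - ?D h" for h
    by (simp add: apply_diff apply_sum apply_scaleR bounded_smooth_diff bounded_smooth_translate a bs
        bounded_smooth_scaleR bounded_smooth_partial_deriv)
  have dR: "partial_derivs \<beta> (?R h) y = partial_derivs \<beta> a ((x + y) + h) - partial_derivs \<beta> a (x + y)
      - (\<Sum>i\<in>UNIV. h $ i *\<^sub>R partial_deriv i (partial_derivs \<beta> a) (x + y))" for \<beta> h y
  proof -
    have s1: "smooth_on UNIV (\<lambda>y. a (z + y))" for z
      using smooth by (rule smooth_on_translate)
    have s2: "smooth_on UNIV (\<lambda>y. partial_deriv i a (x + y))" for i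
      using smooth by (intro smooth_on_translate(2) smooth_on_partial_deriv)
    have "partial_derivs \<beta> (\<lambda>y. \<Sum>i\<in>UNIV. h $ i *\<^sub>R partial_deriv i a (x + y)) y
        = (\<Sum>i\<in>UNIV. h $ i *\<^sub>R partial_deriv i (partial_derivs \<beta> a) (x + y))"
      using s2 smooth
      by (simp add: partial_derivs_sum[OF open_UNIV smooth_on_scaleR(2)[OF open_UNIV]]
          partial_derivs_scaleR[OF open_UNIV] partial_derivs_translate smooth_on_partial_deriv
          partial_derivs_commute[OF open_UNIV])
    then show ?thesis
      by (simp only: partial_derivs_diff[OF open_UNIV smooth_on_diff(2)[OF open_UNIV s1 s1]
            bounded_smooth_smooth[OF bs] UNIV_I] partial_derivs_diff[OF open_UNIV s1 s1 UNIV_I]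
          partial_derivs_translate[OF smooth]) (simp add: add_ac)
  qed
  obtain M where M: "0 \<le> M" "\<And>\<beta> x h. length \<beta> \<le> N \<Longrightarrow> norm (partial_derivs \<beta> a (x + h) - partial_derivs \<beta> a x
      - (\<Sum>i\<in>UNIV. h $ i *\<^sub>R partial_deriv i (partial_derivs \<beta> a) x)) \<le> M * (norm h)\<^sup>2"
  proof (rule uniform_bound_lists_mult[where N = N and g = "\<lambda>x h. (norm h)\<^sup>2" and
        f = "\<lambda>\<beta> x h. norm (partial_derivs \<beta> a (x + h) - partial_derivs \<beta> a x
          - (\<Sum>i\<in>UNIV. h $ i *\<^sub>R partial_deriv i (partial_derivs \<beta> a) x))"])
  qed (use that bounded_smooth_taylor[OF bounded_smooth_partial_derivs[OF a]] in auto)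
  have est: "norm (L (?R h)) \<le> C * M * (norm h)\<^sup>2" for h
    using apply_bound[OF bR, of "M * (norm h)\<^sup>2" h] M by (simp add: dR mult.assoc)
  have "bounded_linear ?D"
    by (intro bounded_linear_sum bounded_linear_scaleR_const bounded_linear_vec_nth)
  moreover have "\<exists>d>0. \<forall>y. norm (y - x) < d \<longrightarrow>
      norm (L (\<lambda>z. a (y + z)) - L (\<lambda>z. a (x + z)) - ?D (y - x)) \<le> e * norm (y - x)" if "0 < e" for e
  \<comment> \<open>The summand 1 keeps the radius meaningful when \<open>C * M\<close> is
    0.\<close>
  proof (intro exI[of _ "e / (C * M + 1)"] conjI allI impI)
    have pos: "0 < C * M + 1" using C_nonneg M(1) by (simp add: add_nonneg_pos)
    show "0 < e / (C * M + 1)" using pos that by simp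
    fix y assume y: "norm (y - x) < e / (C * M + 1)"
    have "norm (L (\<lambda>z. a (y + z)) - L (\<lambda>z. a (x + z)) - ?D (y - x)) \<le> C * M * (norm (y - x))\<^sup>2"
      using est[of "y - x"] LR[of "y - x"] by simp
    also have "\<dots> \<le> (C * M + 1) * norm (y - x) * norm (y - x)"
      by (auto simp: power2_eq_square algebra_simps)
    also have "\<dots> \<le> e * norm (y - x)"
      using y pos by (intro mult_right_mono) (auto simp: field_simps)
    finally show "norm (L (\<lambda>z. a (y + z)) - L (\<lambda>z. a (x + z)) - ?D (y - x)) \<le> e * norm (y - x)" .
  qed
  ultimately show ?thesis unfolding has_derivative_at_alt by blast
qed

lemma partial_derivs_apply_translate:
  assumes "bounded_smooth a"
  shows "partial_derivs \<beta> (\<lambda>x. L (\<lambda>y. a (x + y))) = (\<lambda>x. L (\<lambda>y. partial_derivs \<beta> a (x + y)))"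
proof (induction \<beta>)
  case (Cons i \<beta>)
  have "(\<Sum>j\<in>UNIV. axis i 1 $ j *\<^sub>R f j) = f i" for f :: "'n \<Rightarrow> 'k"
    by (simp add: axis_def if_distrib[of "\<lambda>c. c *\<^sub>R _"] cong: if_cong)
  then show ?case
    unfolding partial_derivs.simps Cons.IH
    using partial_deriv_eq[OF apply_translate_has_derivative[OF bounded_smooth_partial_derivs[OF assms]]]
    by auto
qed simp

lemma bounded_smooth_apply_translate:
  assumes "bounded_smooth a"
  shows "bounded_smooth (\<lambda>x. L (\<lambda>y. a (x + y)))"
proof (rule bounded_smoothI)
  show "smooth_on UNIV (\<lambda>x. L (\<lambda>y. a (x + y)))"
    using apply_translate_has_derivative[OF bounded_smooth_partial_derivs[OF assms]]
    by (auto simp: smooth_on_def partial_derivs_apply_translate[OF assms]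
        differentiable_on_eq_differentiable_at differentiable_def)
  fix \<beta>
  obtain M where M: "0 \<le> M" "\<And>\<gamma> x. length \<gamma> \<le> N \<Longrightarrow> norm (partial_derivs \<gamma> (partial_derivs \<beta> a) x) \<le> M"
    using bounded_smooth_uniform_bound[OF bounded_smooth_partial_derivs[OF assms], of N] by metis
  note bs = bounded_smooth_partial_derivs[OF assms]
  have "norm (partial_derivs \<beta> (\<lambda>x. L (\<lambda>y. a (x + y))) x) \<le> C * M" for x
    unfolding partial_derivs_apply_translate[OF assms]
    by (intro apply_bound bounded_smooth_translate bs M(1))
      (auto simp: partial_derivs_translate[OF bounded_smooth_smooth[OF bs]] M(2))
  then show "\<exists>M. \<forall>x. norm (partial_derivs \<beta> (\<lambda>x. L (\<lambda>y. a (x + y))) x) \<le> M" by blast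
qed

end

lemma smooth_functional_diff:
  assumes "smooth_functional L S C N" "smooth_functional L' S' C' N'"
  shows "smooth_functional (\<lambda>a. L a - L' a) (S \<union> S') (C + C') (max N N')"
proof -
  interpret L: smooth_functional L S C N by fact
  interpret L': smooth_functional L' S' C' N' by fact
  show ?thesis
  proof
    fix a :: "(real, 'a) vec \<Rightarrow> 'b" and M :: real
    assume a: "bounded_smooth a" "0 \<le> M"
      and M: "\<And>\<beta> y. length \<beta> \<le> max N N' \<Longrightarrow> y \<in> S \<union> S' \<Longrightarrow> norm (partial_derivs \<beta> a y) \<le> M"
    then have "norm (L a) \<le> C * M" "norm (L' a) \<le> C' * M"
      by (simp_all add: L.apply_bound L'.apply_bound)
    then show "norm (L a - L' a) \<le> (C + C') * M"
      using norm_triangle_ineq4[of "L a" "L' a"] by (simp add: distrib_right)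
  qed (auto simp: L.apply_add L'.apply_add L.apply_cmult L'.apply_cmult L.C_nonneg L'.C_nonneg algebra_simps)
qed

text \<open>Convolution evaluates a functional at \<open>\<lambda>y. a (x - y)\<close>. Reflecting
  the functional turns this into the translates \<open>\<lambda>y. a (x + y)\<close>, for which the
  derivative is known.\<close>

lemma smooth_functional_reflect:
  assumes "smooth_functional L S C N"
  shows "smooth_functional (\<lambda>a. L (\<lambda>y. a (- y))) (uminus ` S) C N"
proof -
  interpret smooth_functional L S C N by fact
  have bs: "bounded_smooth (\<lambda>y. a (- y))" if "bounded_smooth a" for a :: "(real, 'a) vec \<Rightarrow> 'b"
    using bounded_smooth_affine[OF that, of 0 "-1"] by simp
  show ?thesis
  proof
    fix a :: "(real, 'a) vec \<Rightarrow> 'b" and M :: real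
    assume a: "bounded_smooth a" "0 \<le> M"
      and M: "\<And>\<beta> y. length \<beta> \<le> N \<Longrightarrow> y \<in> uminus ` S \<Longrightarrow> norm (partial_derivs \<beta> a y) \<le> M"
    have "norm (partial_derivs \<beta> (\<lambda>y. a (- y)) y) = norm (partial_derivs \<beta> a (- y))" for \<beta> y
      using partial_derivs_affine[OF bounded_smooth_smooth[OF a(1)], of \<beta> 0 "-1"] by (simp add: power_abs)
    then show "norm (L (\<lambda>y. a (- y))) \<le> C * M"
      using M by (intro apply_bound bs a) auto
  qed (auto simp: apply_add apply_cmult bs C_nonneg)
qed

subsection \<open>Averages of translates\<close>

lemma smooth_on_UNIV_borel_measurable:
  fixes a :: "real^'n \<Rightarrow> 'b::real_normed_vector"
  shows "smooth_on UNIV a \<Longrightarrow> a \<in> borel_measurable borel"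
  by (intro borel_measurable_continuous_onI smooth_on_imp_continuous_on)

lemma bounded_smooth_mult_integrable:
  fixes a :: "real^'n \<Rightarrow> 'k::{real_normed_field,euclidean_space}"
  assumes "bounded_smooth a" "integrable lborel b"
  shows "integrable lborel (\<lambda>z. a z * b z)"
proof -
  obtain M where M: "\<And>x. norm (a x) \<le> M"
    using bounded_smooth_bound[OF assms(1), of "[]"] by auto
  have [measurable]: "a \<in> borel_measurable borel"
    by (rule smooth_on_UNIV_borel_measurable[OF bounded_smooth_smooth[OF assms(1)]])
  show ?thesis
  proof (rule Bochner_Integration.integrable_bound)
    show "integrable lborel (\<lambda>z. M * norm (b z))" using assms(2) by simp
    show "(\<lambda>z. a z * b z) \<in> borel_measurable lborel" using assms(2) by simp
    have "norm (a z * b z) \<le> norm (M * norm (b z))" for z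
      using M[of z] by (simp add: norm_mult abs_mult mult_right_mono order_trans[OF _ abs_ge_self])
    then show "AE z in lborel. norm (a z * b z) \<le> norm (M * norm (b z))" by simp
  qed
qed

text \<open>Regarding integration as a functional of order 0 makes differentiation under the
  integral sign an instance of differentiating along translates.\<close>

lemma smooth_functional_integral:
  fixes b :: "real^'n \<Rightarrow> 'k::{real_normed_field,euclidean_space}"
  assumes b: "integrable lborel b"
  shows "smooth_functional (\<lambda>a. LINT z|lborel. a (c *\<^sub>R z) * b z) UNIV (LINT z|lborel. norm (b z)) 0"
proof
  have int: "integrable lborel (\<lambda>z. a (c *\<^sub>R z) * b z)" if "bounded_smooth a" for a :: "real^'n \<Rightarrow> 'k"
    using bounded_smooth_affine[OF that, of 0 c] b by (intro bounded_smooth_mult_integrable) auto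
  fix a d :: "real^'n \<Rightarrow> 'k" assume a: "bounded_smooth a"
  show "(LINT z|lborel. (a (c *\<^sub>R z) + d (c *\<^sub>R z)) * b z)
      = (LINT z|lborel. a (c *\<^sub>R z) * b z) + (LINT z|lborel. d (c *\<^sub>R z) * b z)" if "bounded_smooth d"
    by (simp add: distrib_right int a that)
  show "(LINT z|lborel. e * a (c *\<^sub>R z) * b z) = e * (LINT z|lborel. a (c *\<^sub>R z) * b z)" for e
    by (simp add: mult.assoc)
  show "norm (LINT z|lborel. a (c *\<^sub>R z) * b z) \<le> (LINT z|lborel. norm (b z)) * M"
    if "0 \<le> M" and M: "\<And>\<beta> y. length \<beta> \<le> 0 \<Longrightarrow> y \<in> UNIV \<Longrightarrow> norm (partial_derivs \<beta> a y) \<le> M" for M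
  proof -
    have "norm (LINT z|lborel. a (c *\<^sub>R z) * b z) \<le> (LINT z|lborel. norm (b z) * M)"
      by (intro Bochner_Integration.integral_norm_bound_integral int a)
        (use M[of "[]"] b in \<open>auto simp: norm_mult mult.commute[of "norm (b _)"] intro!: mult_right_mono\<close>)
    then show ?thesis by simp
  qed
qed simp

lemma bounded_smooth_average:
  fixes b :: "real^'n \<Rightarrow> 'k::{real_normed_field,euclidean_space}"
  assumes "integrable lborel b" "bounded_smooth a"
  shows "bounded_smooth (\<lambda>y. LINT z|lborel. a (y + c *\<^sub>R z) * b z)"
    and partial_derivs_average: "partial_derivs \<beta> (\<lambda>y. LINT z|lborel. a (y + c *\<^sub>R z) * b z)
          = (\<lambda>y. LINT z|lborel. partial_derivs \<beta> a (y + c *\<^sub>R z) * b z)"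
  using smooth_functional.bounded_smooth_apply_translate[OF smooth_functional_integral[OF assms(1)] assms(2)]
    smooth_functional.partial_derivs_apply_translate[OF smooth_functional_integral[OF assms(1)] assms(2)]
  by auto

text \<open>A finite cover by balls of radius \<open>\<eta>\<close> with centres in
  \<open>K\<close>, made disjoint and cut down to \<open>K\<close>. The partition is recorded as an
  identity of indicators, the form in which it splits an integrand.\<close>

lemma compact_small_partition:
  fixes K :: "(real^'n) set"
  assumes "compact K" "0 < \<eta>"
  shows "\<exists>(m::nat) A d. (\<forall>i. A i \<in> sets borel) \<and> (\<forall>i<m. d i \<in> K \<and> (\<forall>x\<in>A i. norm (x - d i) \<le> \<eta>)) \<and>
    (\<forall>x. (\<Sum>i<m. indicator (A i) x) = (indicator K x :: real))"
proof -
  obtain D where D: "finite D" "D \<subseteq> K" "K \<subseteq> (\<Union>x\<in>D. ball x \<eta>)"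
    using seq_compact_imp_totally_bounded[of K] assms compact_eq_seq_compact_metric by blast
  obtain xs where xs: "set xs = D" using finite_list[OF D(1)] by blast
  define B where "B i = ball (xs ! i) \<eta>" for i
  define A where "A i = K \<inter> disjointed B i" for i
  have "range B \<subseteq> sets borel" by (auto simp: B_def)
  then have "disjointed B i \<in> sets borel" for i
    using sets.range_disjointed_sets by blast
  then have 1: "A i \<in> sets borel" for i
    using borel_compact[OF assms(1)] by (simp add: A_def)
  have 2: "norm (x - xs ! i) \<le> \<eta>" if "x \<in> A i" for i x
    using that disjointed_subset[of B i] by (auto simp: A_def B_def dist_norm norm_minus_commute)
  have "disjoint_family_on A {..<length xs}"
    using disjoint_family_disjointed[of B] by (auto simp: disjoint_family_on_def A_def)
  then have "indicator (\<Union>i<length xs. A i) x = (\<Sum>i<length xs. indicator (A i) x :: real)" for x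
    by (intro indicator_UN_disjoint) auto
  moreover have "(\<Union>i<length xs. A i) = K"
  proof -
    have "(\<Union>i<length xs. A i) = K \<inter> (\<Union>i\<in>{0..<length xs}. disjointed B i)"
      by (auto simp: A_def)
    also have "\<dots> = K \<inter> (\<Union>i\<in>{0..<length xs}. B i)" by (simp only: finite_UN_disjointed_eq)
    also have "\<dots> = K"
    proof -
      have "K \<subseteq> (\<Union>i\<in>{0..<length xs}. B i)"
        using D(3) unfolding B_def xs[symmetric] set_conv_nth by fastforce
      then show ?thesis by blast
    qed
    finally show ?thesis .
  qed
  ultimately have "(\<Sum>i<length xs. indicator (A i) x) = (indicator K x :: real)" for x by metis
  then show ?thesis
    by - (rule exI[of _ "length xs"], rule exI[of _ A], rule exI[of _ "\<lambda>i. xs ! i"],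
      use 1 2 D(2) xs in auto)
qed

text \<open>When the weight lives within \<open>\<eta>\<close> of \<open>d\<close>, all translates
  may be replaced by the one at \<open>d\<close>, carrying the total weight \<open>?c\<close>. In
  each seminorm of order at most \<open>N\<close> this costs at most \<Lambda> * \<eta> times the L1
  norm of \<open>b\<close>, an error that is proportional to the mass of \<open>b\<close> and
  vanishes with \<open>\<eta>\<close>.\<close>

lemma (in smooth_functional) norm_apply_average_le_local:
  assumes a: "bounded_smooth a" and b: "integrable lborel b"
    and supp: "\<And>x. b x \<noteq> 0 \<Longrightarrow> norm (x - d) \<le> \<eta>" and M: "norm (L (\<lambda>y. a (d + y))) \<le> M"
    and \<Lambda>: "0 \<le> \<Lambda>" "\<And>\<beta> x y. length \<beta> \<le> N \<Longrightarrow>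
      norm (partial_derivs \<beta> a x - partial_derivs \<beta> a y) \<le> \<Lambda> * norm (x - y)" and "0 \<le> \<eta>"
  shows "norm (L (\<lambda>y. LINT x|lborel. a (y + x) * b x)) \<le> (M + C * \<Lambda> * \<eta>) * (LINT x|lborel. norm (b x))"
proof -
  let ?B = "LINT x|lborel. norm (b x)" and ?c = "LINT x|lborel. b x"
  let ?conv = "\<lambda>y. LINT x|lborel. a (y + x) * b x" and ?s = "\<lambda>y. ?c * a (d + y)"
  have bs: "bounded_smooth ?conv" using bounded_smooth_average(1)[OF b a, of 1] by simp
  have bs': "bounded_smooth ?s" by (intro bounded_smooth_cmult bounded_smooth_translate a)
  have der: "norm (partial_derivs \<beta> (\<lambda>y. ?conv y - ?s y) y) \<le> \<Lambda> * \<eta> * ?B" if \<beta>: "length \<beta> \<le> N" for \<beta> y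
  proof -
    let ?a = "partial_derivs \<beta> a"
    have int: "integrable lborel (\<lambda>x. ?a (y + x) * b x)"
      by (intro bounded_smooth_mult_integrable bounded_smooth_translate bounded_smooth_partial_derivs a b)
    have int': "integrable lborel (\<lambda>x. ?a (d + y) * b x)" using b by simp
    have "partial_derivs \<beta> ?conv y = (LINT x|lborel. ?a (y + x) * b x)"
      using partial_derivs_average[OF b a, of \<beta> 1] by simp
    moreover have "partial_derivs \<beta> ?s y = (LINT x|lborel. ?a (d + y) * b x)"
      using a[THEN bounded_smooth_smooth] b
      by (simp add: partial_derivs_cmult[OF open_UNIV] smooth_on_translate partial_derivs_translate mult.commute)
    ultimately have "partial_derivs \<beta> (\<lambda>y. ?conv y - ?s y) y
        = (LINT x|lborel. ?a (y + x) * b x) - (LINT x|lborel. ?a (d + y) * b x)"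
      by (simp only: partial_derivs_diff[OF open_UNIV bs[THEN bounded_smooth_smooth] bs'[THEN bounded_smooth_smooth] UNIV_I])
    also have "\<dots> = (LINT x|lborel. (?a (y + x) - ?a (d + y)) * b x)"
      unfolding left_diff_distrib by (intro Bochner_Integration.integral_diff[symmetric] int int')
    also have "norm \<dots> \<le> (LINT x|lborel. \<Lambda> * \<eta> * norm (b x))"
    proof (intro Bochner_Integration.integral_norm_bound_integral)
      show "integrable lborel (\<lambda>x. (?a (y + x) - ?a (d + y)) * b x)"
        unfolding left_diff_distrib by (intro Bochner_Integration.integrable_diff int int')
      show "norm ((?a (y + x) - ?a (d + y)) * b x) \<le> \<Lambda> * \<eta> * norm (b x)" for x
      proof (cases "b x = 0")
        case False
        have "norm (?a (y + x) - ?a (d + y)) \<le> \<Lambda> * norm (x - d)"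
          using \<Lambda>(2)[OF \<beta>, of "y + x" "d + y"] by (simp add: algebra_simps)
        also have "\<dots> \<le> \<Lambda> * \<eta>" using supp[OF False] \<Lambda>(1) by (intro mult_left_mono)
        finally show ?thesis by (simp add: norm_mult mult_right_mono)
      qed simp
    qed (use b in simp)
    finally show ?thesis by simp
  qed
  have "norm (L ?conv - ?c * L (\<lambda>y. a (d + y))) = norm (L (\<lambda>y. ?conv y - ?s y))"
    by (simp add: apply_diff[OF bs bs'] apply_cmult bounded_smooth_translate a)
  also have "\<dots> \<le> C * (\<Lambda> * \<eta> * ?B)"
    using der \<Lambda>(1) \<open>0 \<le> \<eta>\<close> by (intro apply_bound bounded_smooth_diff bs bs') auto
  finally have "norm (L ?conv) \<le> C * (\<Lambda> * \<eta> * ?B) + norm (?c * L (\<lambda>y. a (d + y)))"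
    using norm_triangle_ineq2[of "L ?conv" "?c * L (\<lambda>y. a (d + y))"] by linarith
  also have "norm (?c * L (\<lambda>y. a (d + y))) \<le> ?B * M"
    unfolding norm_mult using M by (intro mult_mono integral_norm_bound) auto
  finally show ?thesis by (simp add: algebra_simps)
qed

text \<open>Splitting the average over a fine partition of the support replaces an exchange of the
  functional with the integral.\<close>

lemma (in smooth_functional) norm_apply_average_le:
  assumes a: "bounded_smooth a" and b: "integrable lborel b" and "compact K"
    and supp: "\<And>x. x \<notin> K \<Longrightarrow> b x = 0"
    and M: "\<And>x. x \<in> K \<Longrightarrow> norm (L (\<lambda>y. a (x + y))) \<le> M"
  shows "norm (L (\<lambda>y. LINT x|lborel. a (y + x) * b x)) \<le> M * (LINT x|lborel. norm (b x))"
proof -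
  let ?B = "LINT x|lborel. norm (b x)"
  obtain \<Lambda> where \<Lambda>: "0 \<le> \<Lambda>" "\<And>\<beta> x y. length \<beta> \<le> N \<Longrightarrow>
      norm (partial_derivs \<beta> a x - partial_derivs \<beta> a y) \<le> \<Lambda> * norm (x - y)"
  proof (rule uniform_bound_lists_mult[where N = N and g = "\<lambda>x y. norm (x - y)" and
        f = "\<lambda>\<beta> x y. norm (partial_derivs \<beta> a x - partial_derivs \<beta> a y)"])
    show "\<exists>M. \<forall>x y. norm (partial_derivs \<beta> a x - partial_derivs \<beta> a y) \<le> M * norm (x - y)" for \<beta>
      using bounded_smooth_lipschitz[OF bounded_smooth_partial_derivs[OF a]] by metis
  qed (use that in auto)
  have est: "norm (L (\<lambda>y. LINT x|lborel. a (y + x) * b x)) \<le> (M + C * \<Lambda> * \<eta>) * ?B" if "0 < \<eta>" for \<eta>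
  proof -
    obtain m and A :: "nat \<Rightarrow> (real^'n) set" and d where A: "\<forall>i. A i \<in> sets borel"
      and small: "\<forall>i<m. d i \<in> K \<and> (\<forall>x\<in>A i. norm (x - d i) \<le> \<eta>)"
      and part: "\<forall>x. (\<Sum>i<m. indicator (A i) x) = (indicator K x :: real)"
      using compact_small_partition[OF \<open>compact K\<close> \<open>0 < \<eta>\<close>] by (elim exE conjE) (rule that)
    \<comment> \<open>Restrictions of the weight to the cells. Their norms add up to
      \<open>norm (b x)\<close> pointwise, so the local errors sum to one total independent of the
      number of cells.\<close>
    define f where "f i x = (indicator (A i) x :: real) *\<^sub>R b x" for i x
    have int: "integrable lborel (f i)" for i
      unfolding f_def using b A by (intro integrable_mult_indicator) auto
    have sum: "(\<Sum>i<m. f i x) = b x" "(\<Sum>i<m. norm (f i x)) = norm (b x)" for x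
      using supp[of x] part[rule_format, of x]
      by (cases "x \<in> K"; simp add: f_def scaleR_sum_left[symmetric] sum_distrib_right[symmetric])+
    have bs: "bounded_smooth (\<lambda>y. LINT x|lborel. a (y + x) * f i x)" for i
      using bounded_smooth_average(1)[OF int a, where c = 1] by simp
    have "(LINT x|lborel. a (y + x) * b x) = (\<Sum>i<m. LINT x|lborel. a (y + x) * f i x)" for y
      unfolding sum(1)[symmetric] sum_distrib_left
      by (intro Bochner_Integration.integral_sum bounded_smooth_mult_integrable bounded_smooth_translate a int)
    then have "L (\<lambda>y. LINT x|lborel. a (y + x) * b x) = (\<Sum>i<m. L (\<lambda>y. LINT x|lborel. a (y + x) * f i x))"
      by (simp add: apply_sum bs)
    also have "norm \<dots> \<le> (\<Sum>i<m. (M + C * \<Lambda> * \<eta>) * (LINT x|lborel. norm (f i x)))"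
    proof (intro sum_norm_le norm_apply_average_le_local[OF a int] \<Lambda>)
      fix i assume "i \<in> {..<m}"
      with small have i: "d i \<in> K" "\<And>x. x \<in> A i \<Longrightarrow> norm (x - d i) \<le> \<eta>" by auto
      show "norm (L (\<lambda>y. a (d i + y))) \<le> M" by (rule M[OF i(1)])
      show "norm (x - d i) \<le> \<eta>" if "f i x \<noteq> 0" for x
        using that i(2) by (auto simp: f_def indicator_def split: if_splits)
    qed (use \<open>0 < \<eta>\<close> in auto)
    also have "\<dots> = (M + C * \<Lambda> * \<eta>) * (LINT x|lborel. (\<Sum>i<m. norm (f i x)))"
      using int by (simp add: sum_distrib_left Bochner_Integration.integral_sum)
    finally show ?thesis by (simp only: sum(2))
  qed
  \<comment> \<open>The left side of \<open>est\<close> does not involve \<open>\<eta>\<close>, so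
    the error term disappears as the mesh tends to 0.\<close>
  have "((\<lambda>\<eta>. (M + C * \<Lambda> * \<eta>) * ?B) \<longlongrightarrow> (M + C * \<Lambda> * 0) * ?B) (at_right 0)"
    by (intro tendsto_intros)
  moreover have "\<forall>\<^sub>F \<eta>::real in at_right 0. norm (L (\<lambda>y. LINT x|lborel. a (y + x) * b x)) \<le> (M + C * \<Lambda> * \<eta>) * ?B"
    using eventually_at_right_less by eventually_elim (rule est)
  ultimately show ?thesis using tendsto_lowerbound[of _ "(M + C * \<Lambda> * 0) * ?B"] by fastforce
qed

section \<open>Approximate identities\<close>

lemma average_uniform_limit:
  fixes b :: "real^'n \<Rightarrow> 'k::{real_normed_field,euclidean_space}"
  assumes b: "integrable lborel b" "(LINT z|lborel. b z) = 1" and a: "bounded_smooth a"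
    and \<epsilon>: "\<epsilon> \<longlonglongrightarrow> 0" and "0 < e"
  shows "\<forall>\<^sub>F k in sequentially. \<forall>y. norm ((LINT z|lborel. a (y + \<epsilon> k *\<^sub>R z) * b z) - a y) \<le> e"
proof -
  obtain A where A: "0 \<le> A" "\<And>x. norm (a x) \<le> A"
    using bounded_smooth_uniform_bound[OF a, of 0] by (metis le_refl list.size(3) partial_derivs.simps(1))
  obtain \<Lambda> where \<Lambda>: "0 \<le> \<Lambda>" "\<And>x y. norm (a x - a y) \<le> \<Lambda> * norm (x - y)"
    using bounded_smooth_lipschitz[OF a] by metis
  have [measurable]: "b \<in> borel_measurable borel" using borel_measurable_integrable[OF b(1)] by simp
  \<comment> \<open>A majorant free of \<open>y\<close>, which makes the convergence uniform. The
    Lipschitz bound gives convergence to 0, but \<open>norm z * norm (b z)\<close> need not be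
    integrable; the cap \<open>2 * A\<close> provides the dominating function.\<close>
  let ?g = "\<lambda>k z. min (2 * A) (\<Lambda> * \<bar>\<epsilon> k\<bar> * norm z) * norm (b z)"
  have gb: "norm (?g k z) \<le> 2 * A * norm (b z)" for k z
    using A(1) \<Lambda>(1) by (auto simp: abs_mult intro!: mult_right_mono)
  have gint: "integrable lborel (?g k)" for k
  proof (rule Bochner_Integration.integrable_bound)
    show "integrable lborel (\<lambda>z. 2 * A * norm (b z))" using b(1) by simp
    show "AE z in lborel. norm (?g k z) \<le> norm (2 * A * norm (b z))"
      using order_trans[OF gb abs_ge_self] by simp
  qed simp
  have "(\<lambda>k. LINT z|lborel. ?g k z) \<longlonglongrightarrow> (LINT z|(lborel::(real^'n) measure). (0::real))"
  proof (rule Bochner_Integration.integral_dominated_convergence)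
    show "integrable lborel (\<lambda>z. 2 * A * norm (b z))" using b(1) by simp
    have "(\<lambda>k. ?g k z) \<longlonglongrightarrow> min (2 * A) (\<Lambda> * \<bar>0\<bar> * norm z) * norm (b z)" for z
      by (intro tendsto_intros \<epsilon>)
    then show "AE z in lborel. (\<lambda>k. ?g k z) \<longlonglongrightarrow> 0" using A(1) by simp
    show "AE z in lborel. norm (?g k z) \<le> 2 * A * norm (b z)" for k using gb by simp
  qed auto
  then have "\<forall>\<^sub>F k in sequentially. (LINT z|lborel. ?g k z) < e"
    using \<open>0 < e\<close> by (simp add: order_tendstoD)
  then show ?thesis
  proof (eventually_elim, intro allI)
    fix k y assume k: "(LINT z|lborel. ?g k z) < e"
    have int: "integrable lborel (\<lambda>z. a (y + \<epsilon> k *\<^sub>R z) * b z)"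
      by (intro bounded_smooth_mult_integrable bounded_smooth_affine a b)
    have "(LINT z|lborel. a (y + \<epsilon> k *\<^sub>R z) * b z) - a y
        = (LINT z|lborel. a (y + \<epsilon> k *\<^sub>R z) * b z) - (LINT z|lborel. a y * b z)"
      using b by simp
    also have "\<dots> = (LINT z|lborel. (a (y + \<epsilon> k *\<^sub>R z) - a y) * b z)"
      using int b by (subst Bochner_Integration.integral_diff[symmetric]) (auto simp: left_diff_distrib)
    also have "norm \<dots> \<le> (LINT z|lborel. ?g k z)"
    proof (intro Bochner_Integration.integral_norm_bound_integral gint)
      show "integrable lborel (\<lambda>z. (a (y + \<epsilon> k *\<^sub>R z) - a y) * b z)"
        using Bochner_Integration.integrable_diff[OF int, of "\<lambda>z. a y * b z"] b(1)
        by (simp add: left_diff_distrib)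
      fix z
      have "norm (a (y + \<epsilon> k *\<^sub>R z) - a y) \<le> 2 * A"
        using norm_triangle_ineq4[of "a (y + \<epsilon> k *\<^sub>R z)" "a y"] A(2)[of "y + \<epsilon> k *\<^sub>R z"] A(2)[of y] by linarith
      moreover have "norm (a (y + \<epsilon> k *\<^sub>R z) - a y) \<le> \<Lambda> * \<bar>\<epsilon> k\<bar> * norm z"
        using \<Lambda>(2)[of "y + \<epsilon> k *\<^sub>R z" y] by (simp add: mult.assoc)
      ultimately show "norm ((a (y + \<epsilon> k *\<^sub>R z) - a y) * b z) \<le> ?g k z"
        unfolding norm_mult by (intro mult_right_mono) auto
    qed
    finally show "norm ((LINT z|lborel. a (y + \<epsilon> k *\<^sub>R z) * b z) - a y) \<le> e" using k by linarith
  qed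
qed

text \<open>Only the finitely many derivatives up to order \<open>N\<close> enter the bound for
  \<open>L\<close>. Each is averaged in the same way as \<open>a\<close>, so from some index on all
  of them are uniformly close to their limits.\<close>

lemma (in smooth_functional) apply_average_tendsto:
  assumes b: "integrable lborel b" "(LINT z|lborel. b z) = 1" and a: "bounded_smooth a"
    and \<epsilon>: "\<epsilon> \<longlonglongrightarrow> 0"
  shows "(\<lambda>k. L (\<lambda>y. LINT z|lborel. a (y + \<epsilon> k *\<^sub>R z) * b z)) \<longlonglongrightarrow> L a"
proof (rule tendstoI)
  fix e :: real assume "0 < e"
  define e' where "e' = e / (C + 1) / 2"
  have e': "0 < e'" using \<open>0 < e\<close> C_nonneg by (simp add: e'_def)
  have "\<forall>\<^sub>F k in sequentially. \<forall>\<beta>\<in>{\<beta>. length \<beta> \<le> N}. \<forall>y.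
      norm ((LINT z|lborel. partial_derivs \<beta> a (y + \<epsilon> k *\<^sub>R z) * b z) - partial_derivs \<beta> a y) \<le> e'"
    by (intro eventually_ball_finite finite_lists_length_le_UNIV ballI
        average_uniform_limit b \<epsilon> e' bounded_smooth_partial_derivs a)
  then show "\<forall>\<^sub>F k in sequentially. dist (L (\<lambda>y. LINT z|lborel. a (y + \<epsilon> k *\<^sub>R z) * b z)) (L a) < e"
  proof eventually_elim
    case (elim k)
    let ?c = "\<lambda>y. LINT z|lborel. a (y + \<epsilon> k *\<^sub>R z) * b z"
    have bs: "bounded_smooth ?c" by (rule bounded_smooth_average(1)[OF b(1) a])
    have "norm (L (\<lambda>y. ?c y - a y)) \<le> C * e'"
    proof (rule apply_bound)
      fix \<beta> :: "'n list" and y assume "length \<beta> \<le> N"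
      then show "norm (partial_derivs \<beta> (\<lambda>y. ?c y - a y) y) \<le> e'"
        using elim
        by (simp add: partial_derivs_diff[OF open_UNIV bs[THEN bounded_smooth_smooth] a[THEN bounded_smooth_smooth]]
            partial_derivs_average[OF b(1) a])
    qed (use e' in \<open>auto intro: bounded_smooth_diff bs a\<close>)
    also have "\<dots> < e"
      using C_nonneg \<open>0 < e\<close> by (simp add: e'_def field_simps add_nonneg_pos)
    finally show ?case by (simp add: apply_diff bs a dist_norm)
  qed
qed

lemma lborel_integral_affine:
  fixes f :: "real^'n \<Rightarrow> 'b::{banach,second_countable_topology}"
  assumes "c \<noteq> 0" and [measurable]: "f \<in> borel_measurable borel"
  shows "(LINT x|lborel. f x) = \<bar>c\<bar> ^ CARD('n) *\<^sub>R (LINT x|lborel. f (t + c *\<^sub>R x))"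
  by (subst lborel_affine[OF assms(1), of t])
    (simp add: integral_density integral_distr)

section \<open>Cutoff functions\<close>

text \<open>For \<open>p = 1\<close> this is the classical exp(-1/t). The polynomial parameter
  closes the family under differentiation.\<close>

definition flat :: "real poly \<Rightarrow> real \<Rightarrow> real" where
  "flat p t = (if 0 < t then poly p (1 / t) * exp (- (1 / t)) else 0)"

lemma poly_over_exp_tendsto_0: "((\<lambda>s::real. poly p s / exp s) \<longlongrightarrow> 0) at_top"
proof -
  have "((\<lambda>s::real. \<Sum>i\<le>degree p. coeff p i * (s ^ i / exp s)) \<longlongrightarrow> (\<Sum>i\<le>degree p. coeff p i * 0)) at_top"
    by (intro tendsto_sum tendsto_mult tendsto_const tendsto_power_div_exp_0)
  then show ?thesis by (simp add: poly_altdef sum_divide_distrib)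
qed

text \<open>With s = 1/t, differentiating p(s) exp(-s) in t gives s^2 (p(s) - p'(s)) exp(-s), and
  \<open>[:0, 0, 1:]\<close> is s^2. At 0 the right difference quotient is s p(s) exp(-s), which
  tends to 0 because the exponential beats every polynomial.\<close>

lemma flat_has_derivative:
  "(flat p has_real_derivative flat ([:0, 0, 1:] * (p - pderiv p)) t) (at t)"
proof -
  let ?q = "[:0, 0, 1:] * (p - pderiv p)"
  consider "0 < t" | "t < 0" | "t = 0" by linarith
  then show ?thesis
  proof cases
    case 1
    have "((\<lambda>t. poly p (1 / t) * exp (- (1 / t))) has_real_derivative flat ?q t) (at t)"
      using 1 unfolding flat_def
      by (auto intro!: derivative_eq_intros DERIV_chain2[OF poly_DERIV]
          simp: power2_eq_square field_simps)
    then show ?thesis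
    proof (rule has_field_derivative_transform_within_open)
      show "open {0::real<..}" "t \<in> {0<..}" using 1 by auto
    qed (auto simp: flat_def)
  next
    case 2
    have "((\<lambda>t. 0) has_real_derivative flat ?q t) (at t)" using 2 by (simp add: flat_def)
    then show ?thesis
    proof (rule has_field_derivative_transform_within_open)
      show "open {..<0::real}" "t \<in> {..<0}" using 2 by auto
    qed (auto simp: flat_def)
  next
    case 3
    have "((\<lambda>h. (flat p (0 + h) - flat p 0) / h) \<longlongrightarrow> 0) (at_right 0)"
    proof (rule Lim_transform_eventually)
      have "((\<lambda>h::real. poly ([:0, 1:] * p) (inverse h) / exp (inverse h)) \<longlongrightarrow> 0) (at_right 0)"
        by (rule filterlim_compose[OF poly_over_exp_tendsto_0 filterlim_inverse_at_top_right])
      then show "((\<lambda>h::real. poly ([:0, 1:] * p) (1 / h) / exp (1 / h)) \<longlongrightarrow> 0) (at_right 0)"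
        by (simp add: inverse_eq_divide)
      show "\<forall>\<^sub>F h in at_right 0. poly ([:0, 1:] * p) (1 / h) / exp (1 / h) = (flat p (0 + h) - flat p 0) / h"
        using eventually_at_right_less[of "0::real"]
        by eventually_elim (simp add: flat_def exp_minus divide_inverse)
    qed
    moreover have "((\<lambda>h. (flat p (0 + h) - flat p 0) / h) \<longlongrightarrow> 0) (at_left 0)"
    proof (rule Lim_transform_eventually)
      show "\<forall>\<^sub>F h in at_left 0. 0 = (flat p (0 + h) - flat p 0) / h"
        unfolding eventually_at_filter by (simp add: flat_def)
    qed simp
    ultimately show ?thesis using 3 by (simp add: DERIV_def flat_def filterlim_split_at)
  qed
qed

lemma flat_one_pos_iff: "0 < flat 1 t \<longleftrightarrow> 0 < t"
  by (simp add: flat_def)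

lemma flat_one_nonneg: "0 \<le> flat 1 t"
  by (simp add: flat_def)

lemma flat_nonpos: "t \<le> 0 \<Longrightarrow> flat p t = 0"
  by (simp add: flat_def)

lemma smooth_on_flat:
  fixes q :: "real^'n \<Rightarrow> real"
  assumes "smooth_on UNIV q"
  shows "smooth_on UNIV (\<lambda>x. flat p (q x))"
proof -
  \<comment> \<open>\<open>?G j\<close> is the j-th derivative of \<open>flat p\<close>.\<close>
  let ?G = "\<lambda>j. flat (((\<lambda>p. [:0, 0, 1:] * (p - pderiv p)) ^^ j) p)"
  have "(?G j has_real_derivative ?G (Suc j) t) (at t)" for j t
    using flat_has_derivative by simp
  then have "smooth_on UNIV (\<lambda>x. ?G 0 (q x))"
    by (intro smooth_on_compose_real[where G = ?G, OF open_UNIV _ assms])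
  then show ?thesis by simp
qed

lemma smooth_on_bounded_linear:
  assumes "bounded_linear L"
  shows "smooth_on UNIV (L :: real^'n \<Rightarrow> 'b::real_normed_vector)"
proof -
  have d: "(L has_derivative L) (at x)" for x
    by (rule bounded_linear.has_derivative[OF assms has_derivative_ident])
  then have "partial_deriv i L = (\<lambda>x. L (axis i 1))" for i
    by (simp add: partial_deriv_eq fun_eq_iff)
  moreover have "L differentiable_on UNIV"
    using d by (auto simp: differentiable_on_def differentiable_def)
  moreover have "differentiable_upto k UNIV (\<lambda>x::real^'n. c)" for k and c :: 'b
    using smooth_on_const[of "UNIV :: (real^'n) set" c] unfolding smooth_on_iff_upto by blast
  ultimately have "differentiable_upto k UNIV L" for k
    by (cases k) (auto simp: differentiable_upto_0 differentiable_upto_Suc)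
  then show ?thesis by (simp add: smooth_on_iff_upto)
qed

lemma smooth_on_dist_square: "smooth_on UNIV (\<lambda>x::real^'n. r - (norm (x - a))\<^sup>2)"
proof -
  have "smooth_on UNIV (\<lambda>x::real^'n. x $ i - a $ i)" for i
    by (intro smooth_on_diff(2)[OF open_UNIV] smooth_on_const smooth_on_bounded_linear bounded_linear_vec_nth)
  then have "smooth_on UNIV (\<lambda>x::real^'n. r - (\<Sum>i\<in>UNIV. (x $ i - a $ i) * (x $ i - a $ i)))"
    by (intro smooth_on_diff(2)[OF open_UNIV smooth_on_const] smooth_on_sum(2)[OF open_UNIV]
        smooth_on_mult[OF open_UNIV])
  moreover have "(norm (x - a))\<^sup>2 = (\<Sum>i\<in>UNIV. (x $ i - a $ i) * (x $ i - a $ i))" for x :: "real^'n"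
    by (simp add: power2_norm_eq_inner inner_vec_def)
  ultimately show ?thesis by simp
qed

lemma compact_closure_subset:
  fixes A :: "'a::metric_space set"
  shows "closure A \<subseteq> B \<Longrightarrow> compact B \<Longrightarrow> compact (closure A)"
  by (metis closed_closure compact_Int_closed inf.absorb_iff2)

text \<open>With \<open>\<Phi>\<close> a sum of bumps that exceeds \<open>c\<close> on \<open>K\<close>, the function
  \<open>1 - flat 1 (c - \<Phi>) / flat 1 c\<close> is \<open>1\<close> where \<open>\<Phi> \<ge> c\<close> and \<open>0\<close> where \<open>\<Phi> = 0\<close>.\<close>

lemma smooth_cutoff_exists:
  fixes K U :: "(real^'n) set"
  assumes "compact K" "open U" "K \<subseteq> U"
  obtains \<theta> :: "real^'n \<Rightarrow> real" and V where "smooth_on UNIV \<theta>" "open V" "K \<subseteq> V" "\<And>x. x \<in> V \<Longrightarrow> \<theta> x = 1"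
    "compact (closure {x. \<theta> x \<noteq> 0})" "closure {x. \<theta> x \<noteq> 0} \<subseteq> U"
proof -
  obtain r where r: "\<And>a. a \<in> K \<Longrightarrow> 0 < r a \<and> cball a (r a) \<subseteq> U"
    using assms(2,3) open_contains_cball by (metis subsetD)
  have "K \<subseteq> (\<Union>a\<in>K. ball a (r a))" using r by force
  then obtain D where D: "D \<subseteq> K" "finite D" "K \<subseteq> (\<Union>a\<in>D. ball a (r a))"
    using compactE_image[OF assms(1), of K "\<lambda>a. ball a (r a)"] by auto
  define \<Phi> where "\<Phi> x = (\<Sum>a\<in>D. flat 1 ((r a)\<^sup>2 - (norm (x - a))\<^sup>2))" for x
  have sm: "smooth_on UNIV \<Phi>"
    unfolding \<Phi>_def by (intro smooth_on_sum(2)[OF open_UNIV] smooth_on_flat smooth_on_dist_square)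
  then have cont: "continuous_on A \<Phi>" for A
    using smooth_on_imp_continuous_on continuous_on_subset by blast
  have \<Phi>_nonneg: "0 \<le> \<Phi> x" for x unfolding \<Phi>_def by (intro sum_nonneg flat_one_nonneg)
  have \<Phi>_pos: "0 < \<Phi> x" if x: "x \<in> K" for x
  proof -
    obtain a where a: "a \<in> D" "x \<in> ball a (r a)" using D(3) x by auto
    then have "(norm (x - a))\<^sup>2 < (r a)\<^sup>2"
      by (intro power_strict_mono) (auto simp: dist_norm norm_minus_commute)
    then show ?thesis unfolding \<Phi>_def using a(1) D(2)
      by (intro sum_pos2[of _ a]) (auto simp: flat_one_pos_iff flat_one_nonneg)
  qed
  \<comment> \<open>A level strictly below the minimum of \<open>\<Phi>\<close> on \<open>K\<close>:
    strictness makes \<open>{x. c < \<Phi> x}\<close> an open neighbourhood of \<open>K\<close>, so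
    the cutoff is 1 near \<open>K\<close> and not merely on it.\<close>
  obtain c where c: "0 < c" "\<And>x. x \<in> K \<Longrightarrow> c < \<Phi> x"
  proof (cases "K = {}")
    case False
    obtain x0 where x0: "x0 \<in> K" "\<And>x. x \<in> K \<Longrightarrow> \<Phi> x0 \<le> \<Phi> x"
      using continuous_attains_inf[OF assms(1) False cont] by blast
    show ?thesis
    proof (rule that)
      show "0 < \<Phi> x0 / 2" using \<Phi>_pos x0(1) by simp
      show "\<Phi> x0 / 2 < \<Phi> x" if "x \<in> K" for x using x0(2)[OF that] \<Phi>_pos[OF x0(1)] by linarith
    qed
  qed (use that[of 1] in auto)
  define \<theta> where "\<theta> x = 1 - (1 / flat 1 c) * flat 1 (c - \<Phi> x)" for x
  have "smooth_on UNIV \<theta>"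
    unfolding \<theta>_def
    by (intro smooth_on_diff(2)[OF open_UNIV] smooth_on_cmult(2)[OF open_UNIV] smooth_on_const smooth_on_flat sm)
  moreover have "open {x. c < \<Phi> x}" by (intro open_Collect_less continuous_on_const cont)
  moreover have "K \<subseteq> {x. c < \<Phi> x}" using c by auto
  moreover have "\<theta> x = 1" if "x \<in> {x. c < \<Phi> x}" for x
    using that by (simp add: \<theta>_def flat_nonpos)
  moreover have supp: "closure {x. \<theta> x \<noteq> 0} \<subseteq> (\<Union>a\<in>D. cball a (r a))"
  proof (rule closure_minimal)
    show "{x. \<theta> x \<noteq> 0} \<subseteq> (\<Union>a\<in>D. cball a (r a))"
    proof
      fix x assume "x \<in> {x. \<theta> x \<noteq> 0}"
      then have "\<Phi> x \<noteq> 0" using c(1) by (auto simp: \<theta>_def flat_def)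
      then obtain a where a: "a \<in> D" "flat 1 ((r a)\<^sup>2 - (norm (x - a))\<^sup>2) \<noteq> 0"
        unfolding \<Phi>_def by (meson sum.neutral)
      then have "(norm (x - a))\<^sup>2 \<le> (r a)\<^sup>2" by (auto simp: flat_def split: if_splits)
      then have "norm (x - a) \<le> r a" using r[of a] a(1) D(1) by (auto simp: power2_le_iff_abs_le)
      then show "x \<in> (\<Union>a\<in>D. cball a (r a))" using a(1) by (auto simp: dist_norm norm_minus_commute)
    qed
    show "closed (\<Union>a\<in>D. cball a (r a))" using D(2) by (intro closed_UN) auto
  qed
  moreover have "compact (closure {x. \<theta> x \<noteq> 0})"
    using D(2) by (intro compact_closure_subset[OF supp] compact_UN) auto
  moreover have "(\<Union>a\<in>D. cball a (r a)) \<subseteq> U" using r D(1) by blast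
  ultimately show ?thesis
    by (intro that[of \<theta> "{x. c < \<Phi> x}"]) auto
qed

section \<open>Test functions and distributions\<close>

lemma cutoff_test_function_exists:
  fixes K U :: "(real^'n) set"
  assumes "compact K" "open U" "K \<subseteq> U"
  obtains \<theta> :: "real^'n \<Rightarrow> 'k::{real_normed_field,euclidean_space}" and V
  where "\<theta> \<in> test_functions U" "open V" "K \<subseteq> V" "\<And>x. x \<in> V \<Longrightarrow> \<theta> x = 1"
proof -
  obtain \<theta> V where \<theta>: "smooth_on UNIV \<theta>" "open V" "K \<subseteq> V" "\<And>x. x \<in> V \<Longrightarrow> \<theta> x = 1"
    "compact (closure {x. \<theta> x \<noteq> (0::real)})" "closure {x. \<theta> x \<noteq> 0} \<subseteq> U"
    by (rule smooth_cutoff_exists[OF assms]) blast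
  have "(\<lambda>x. of_real (\<theta> x) :: 'k) \<in> test_functions U"
    using \<theta> smooth_on_linear(2)[OF open_UNIV \<theta>(1) bounded_linear_of_real] by (simp add: test_functions_def)
  then show ?thesis using \<theta> by (intro that[of "\<lambda>x. of_real (\<theta> x)" V]) auto
qed

lemma test_functions_smooth: "\<phi> \<in> test_functions \<Omega> \<Longrightarrow> smooth_on UNIV \<phi>"
  by (simp add: test_functions_def)

lemma test_functions_support:
  "\<phi> \<in> test_functions \<Omega> \<Longrightarrow> compact (closure {x. \<phi> x \<noteq> 0})"
  "\<phi> \<in> test_functions \<Omega> \<Longrightarrow> closure {x. \<phi> x \<noteq> 0} \<subseteq> \<Omega>"
  by (simp_all add: test_functions_def)

lemma not_in_support_eq_0: "x \<notin> closure {x. \<phi> x \<noteq> 0} \<Longrightarrow> \<phi> x = 0"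
  using closure_subset[of "{x. \<phi> x \<noteq> 0}"] by auto

lemma partial_derivs_eq_0_outside_support:
  assumes "x \<notin> closure {x. \<phi> x \<noteq> 0}"
  shows "partial_derivs \<beta> \<phi> x = 0"
proof -
  have "partial_derivs \<beta> \<phi> x = partial_derivs \<beta> (\<lambda>x. 0) x"
    using assms by (intro partial_derivs_cong[of "- closure {x. \<phi> x \<noteq> 0}"]) (auto intro: not_in_support_eq_0)
  then show ?thesis by (simp add: partial_derivs_const)
qed

lemma test_functions_bounded_smooth:
  assumes "\<phi> \<in> test_functions \<Omega>"
  shows "bounded_smooth \<phi>"
proof (rule bounded_smoothI)
  show s: "smooth_on UNIV \<phi>" using assms by (rule test_functions_smooth)
  fix \<beta>
  let ?K = "closure {x. \<phi> x \<noteq> 0}"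
  have "compact (partial_derivs \<beta> \<phi> ` ?K)"
    using test_functions_support(1)[OF assms] smooth_on_deriv_continuous_on[OF s]
    by (intro compact_continuous_image) (auto intro: continuous_on_subset)
  then have "bounded (partial_derivs \<beta> \<phi> ` ?K)" by (rule compact_imp_bounded)
  then obtain M where "\<forall>y\<in>partial_derivs \<beta> \<phi> ` ?K. norm y \<le> M" unfolding bounded_iff by blast
  then have "norm (partial_derivs \<beta> \<phi> x) \<le> max M 0" for x
    by (cases "x \<in> ?K") (auto simp: partial_derivs_eq_0_outside_support le_max_iff_disj)
  then show "\<exists>M. \<forall>x. norm (partial_derivs \<beta> \<phi> x) \<le> M" by blast
qed

lemma test_functions_subset_support:
  assumes "\<psi> \<in> test_functions \<Omega>" "smooth_on UNIV \<phi>" "\<And>x. \<psi> x = 0 \<Longrightarrow> \<phi> x = 0"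
  shows "\<phi> \<in> test_functions \<Omega>" "closure {x. \<phi> x \<noteq> 0} \<subseteq> closure {x. \<psi> x \<noteq> 0}"
proof -
  show *: "closure {x. \<phi> x \<noteq> 0} \<subseteq> closure {x. \<psi> x \<noteq> 0}"
    using assms(3) by (intro closure_mono) auto
  have "compact (closure {x. \<phi> x \<noteq> 0})"
    using * test_functions_support(1)[OF assms(1)] by (rule compact_closure_subset)
  then show "\<phi> \<in> test_functions \<Omega>"
    using test_functions_support(2)[OF assms(1)] assms(2) * by (auto simp: test_functions_def)
qed

lemma test_functions_mult:
  assumes "\<psi> \<in> test_functions \<Omega>" "smooth_on UNIV a"
  shows "(\<lambda>x. \<psi> x * a x) \<in> test_functions \<Omega>"
    and "closure {x. \<psi> x * a x \<noteq> 0} \<subseteq> closure {x. \<psi> x \<noteq> 0}"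
  using test_functions_subset_support[OF assms(1), of "\<lambda>x. \<psi> x * a x"]
    smooth_on_mult[OF open_UNIV test_functions_smooth[OF assms(1)] assms(2)] by auto

lemma test_functions_add:
  assumes "\<phi> \<in> test_functions \<Omega>" "\<psi> \<in> test_functions \<Omega>"
  shows "(\<lambda>x. \<phi> x + \<psi> x) \<in> test_functions \<Omega>"
proof -
  have "{x. \<phi> x + \<psi> x \<noteq> 0} \<subseteq> {x. \<phi> x \<noteq> 0} \<union> {x. \<psi> x \<noteq> 0}" by auto
  then have *: "closure {x. \<phi> x + \<psi> x \<noteq> 0} \<subseteq> closure {x. \<phi> x \<noteq> 0} \<union> closure {x. \<psi> x \<noteq> 0}"
    unfolding closure_Un[symmetric] by (rule closure_mono)
  have "compact (closure {x. \<phi> x \<noteq> 0} \<union> closure {x. \<psi> x \<noteq> 0})"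
    using assms by (intro compact_Un test_functions_support)
  then have "compact (closure {x. \<phi> x + \<psi> x \<noteq> 0})"
    using * by (intro compact_closure_subset)
  then show ?thesis
    using * assms smooth_on_add(2)[OF open_UNIV] by (auto simp: test_functions_def)
qed

lemma test_functions_diff:
  assumes "\<phi> \<in> test_functions \<Omega>" "\<psi> \<in> test_functions \<Omega>"
  shows "(\<lambda>x. \<phi> x - \<psi> x) \<in> test_functions \<Omega>"
  using test_functions_add[OF assms(1) test_functions_mult(1)[OF assms(2) smooth_on_const[of UNIV "-1"]]]
  by simp

lemma sup_norm_le: "0 \<le> M \<Longrightarrow> (\<And>x. x \<in> K \<Longrightarrow> norm (f x) \<le> M) \<Longrightarrow> sup_norm K f \<le> M"
  unfolding sup_norm_def by (intro cSup_least) auto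

lemma distributionsD:
  assumes "T \<in> distributions \<Omega>"
  shows "\<phi> \<in> test_functions \<Omega> \<Longrightarrow> \<psi> \<in> test_functions \<Omega> \<Longrightarrow> T (\<lambda>x. \<phi> x + \<psi> x) = T \<phi> + T \<psi>"
    and "\<phi> \<in> test_functions \<Omega> \<Longrightarrow> T (\<lambda>x. c * \<phi> x) = c * T \<phi>"
    and "compact K \<Longrightarrow> K \<subseteq> \<Omega> \<Longrightarrow> \<exists>C N. \<forall>\<phi>\<in>test_functions \<Omega>. closure {x. \<phi> x \<noteq> 0} \<subseteq> K \<longrightarrow>
           norm (T \<phi>) \<le> C * (\<Sum>\<beta> | length \<beta> \<le> N. sup_norm K (partial_derivs \<beta> \<phi>))"
  using assms by (simp_all add: distributions_def)

lemma distributions_diff: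
  assumes "T \<in> distributions \<Omega>" "\<phi> \<in> test_functions \<Omega>" "\<psi> \<in> test_functions \<Omega>"
  shows "T (\<lambda>x. \<phi> x - \<psi> x) = T \<phi> - T \<psi>"
  using distributionsD(1)[OF assms(1) test_functions_diff[OF assms(2,3)] assms(3)] by simp

text \<open>Multiplication by \<open>\<psi>\<close> confines every argument to one fixed compact
  set, where the seminorm estimate of \<open>T\<close> applies; the Leibniz bound then transfers it
  to \<open>a\<close>. The constant collects the number \<open>?c\<close> of derivatives, the factor
  \<open>2 ^ N\<close> and the bound \<open>A\<close> on \<open>\<psi>\<close>. The given
  \<open>C\<close> has no prescribed sign, hence its absolute value.\<close>

lemma cutoff_dist_smooth_functional:
  fixes T :: "(real^'n \<Rightarrow> 'k::{real_normed_field,euclidean_space}) \<Rightarrow> 'k"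
  assumes T: "T \<in> distributions \<Omega>" and \<psi>: "\<psi> \<in> test_functions \<Omega>"
  obtains C N where "smooth_functional (cutoff_dist \<psi> T) (closure {x. \<psi> x \<noteq> 0}) C N"
proof -
  let ?K = "closure {x. \<psi> x \<noteq> 0}"
  obtain C N where CN: "\<And>\<phi>. \<phi> \<in> test_functions \<Omega> \<Longrightarrow> closure {x. \<phi> x \<noteq> 0} \<subseteq> ?K \<Longrightarrow>
      norm (T \<phi>) \<le> C * (\<Sum>\<beta> | length \<beta> \<le> N. sup_norm ?K (partial_derivs \<beta> \<phi>))"
    using distributionsD(3)[OF T test_functions_support[OF \<psi>]] by blast
  obtain A where A: "0 \<le> A" "\<And>\<beta> x. length \<beta> \<le> N \<Longrightarrow> norm (partial_derivs \<beta> \<psi> x) \<le> A"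
    using bounded_smooth_uniform_bound[OF test_functions_bounded_smooth[OF \<psi>], of N] by metis
  let ?c = "real (card {\<beta> :: 'n list. length \<beta> \<le> N})"
  let ?C = "\<bar>C\<bar> * (?c * (2 ^ N * A))"
  note test = test_functions_mult[OF \<psi> bounded_smooth_smooth]
  have "smooth_functional (cutoff_dist \<psi> T) ?K ?C N"
  proof
    fix a b :: "real^'n \<Rightarrow> 'k" assume a: "bounded_smooth a"
    show "cutoff_dist \<psi> T (\<lambda>y. a y + b y) = cutoff_dist \<psi> T a + cutoff_dist \<psi> T b" if b: "bounded_smooth b"
      using distributionsD(1)[OF T test(1)[OF a] test(1)[OF b]] by (simp add: cutoff_dist_def distrib_left)
    show "cutoff_dist \<psi> T (\<lambda>y. c * a y) = c * cutoff_dist \<psi> T a" for c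
      using distributionsD(2)[OF T test(1)[OF a], of c] by (simp add: cutoff_dist_def mult.left_commute)
    fix M :: real assume "0 \<le> M"
      and M: "\<And>\<beta> y. length \<beta> \<le> N \<Longrightarrow> y \<in> ?K \<Longrightarrow> norm (partial_derivs \<beta> a y) \<le> M"
    have "norm (T (\<lambda>y. \<psi> y * a y)) \<le> C * (\<Sum>\<beta> | length \<beta> \<le> N. sup_norm ?K (partial_derivs \<beta> (\<lambda>y. \<psi> y * a y)))"
      by (rule CN[OF test[OF a]])
    also have "\<dots> \<le> \<bar>C\<bar> * (\<Sum>\<beta> | length \<beta> \<le> N. sup_norm ?K (partial_derivs \<beta> (\<lambda>y. \<psi> y * a y)))"
    proof (intro mult_right_mono sum_nonneg)
      show "0 \<le> sup_norm ?K (partial_derivs \<beta> (\<lambda>y. \<psi> y * a y))" for \<beta>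
      proof -
        \<comment> \<open>The supremum of an unbounded set of reals is unspecified, so even
          nonnegativity relies on boundedness.\<close>
        have "bdd_above ((\<lambda>x. norm (partial_derivs \<beta> (\<lambda>y. \<psi> y * a y) x)) ` ?K)"
          using bounded_smooth_bound[OF test_functions_bounded_smooth[OF test(1)[OF a]], of \<beta>]
          by (auto simp: bdd_above_def)
        then show ?thesis unfolding sup_norm_def by (intro cSup_upper) auto
      qed
    qed simp
    also have "\<dots> \<le> \<bar>C\<bar> * (\<Sum>\<beta> :: 'n list | length \<beta> \<le> N. 2 ^ N * A * M)"
    proof (intro mult_left_mono sum_mono sup_norm_le)
      fix \<beta> :: "'n list" and x assume \<beta>: "\<beta> \<in> {\<beta>. length \<beta> \<le> N}" and x: "x \<in> ?K"
      have "norm (partial_derivs \<beta> (\<lambda>y. \<psi> y * a y) x) \<le> 2 ^ length \<beta> * A * M"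
        using \<beta> x A M
        by (intro norm_partial_derivs_mult_le[OF open_UNIV test_functions_smooth[OF \<psi>] bounded_smooth_smooth[OF a]]) auto
      also have "\<dots> \<le> 2 ^ N * A * M"
        using \<beta> A(1) \<open>0 \<le> M\<close> by (intro mult_right_mono power_increasing) auto
      finally show "norm (partial_derivs \<beta> (\<lambda>y. \<psi> y * a y) x) \<le> 2 ^ N * A * M" .
    qed (use A(1) \<open>0 \<le> M\<close> in auto)
    also have "\<dots> = ?C * M" by simp
    finally show "norm (cutoff_dist \<psi> T a) \<le> ?C * M" by (simp add: cutoff_dist_def)
  qed (use A(1) in simp)
  then show ?thesis by (rule that)
qed

section \<open>Nets and the Colombeau algebra\<close>

lemma eventually_small: "\<forall>\<^sub>F \<epsilon>::real in at_right 0. 0 < \<epsilon> \<and> \<epsilon> < 1"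
  unfolding eventually_at_right_field by (intro exI[of _ 1]) auto

lemma powr_le_powr_small: "0 < \<epsilon> \<Longrightarrow> \<epsilon> < 1 \<Longrightarrow> a \<le> b \<Longrightarrow> \<epsilon> powr b \<le> \<epsilon> powr (a::real)"
  using powr_mono'[of a b \<epsilon>] by simp

section \<open>Suprema of derivatives over relatively compact sets\<close>

lemma smooth_on_deriv_bounded:
  assumes "smooth_on \<Omega> f" "compact (closure K)" "closure K \<subseteq> \<Omega>"
  shows "bdd_above ((\<lambda>x. norm (partial_derivs \<beta> f x)) ` K)"
proof -
  have "compact ((\<lambda>x. norm (partial_derivs \<beta> f x)) ` closure K)"
    using assms smooth_on_deriv_continuous_on[OF assms(1)]
    by (intro compact_continuous_image continuous_on_norm) (auto intro: continuous_on_subset)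
  then have "bdd_above ((\<lambda>x. norm (partial_derivs \<beta> f x)) ` closure K)"
    by (intro bounded_imp_bdd_above compact_imp_bounded)
  then show ?thesis by (rule bdd_above_mono) (use closure_subset in blast)
qed

lemma sup_norm_le_iff:
  assumes "smooth_on \<Omega> f" "compact (closure K)" "closure K \<subseteq> \<Omega>" "0 \<le> M"
  shows "sup_norm K (partial_derivs \<beta> f) \<le> M \<longleftrightarrow> (\<forall>x\<in>K. norm (partial_derivs \<beta> f x) \<le> M)"
proof
  have "norm (partial_derivs \<beta> f x) \<le> sup_norm K (partial_derivs \<beta> f)" if "x \<in> K" for x
    unfolding sup_norm_def using smooth_on_deriv_bounded[OF assms(1-3)] that by (intro cSup_upper) auto
  then show "\<forall>x\<in>K. norm (partial_derivs \<beta> f x) \<le> M" if "sup_norm K (partial_derivs \<beta> f) \<le> M"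
    using that order_trans by blast
qed (intro sup_norm_le assms(4), auto)

lemma sup_norm_nonneg:
  assumes "smooth_on \<Omega> f" "compact (closure K)" "closure K \<subseteq> \<Omega>"
  shows "0 \<le> sup_norm K (partial_derivs \<beta> f)"
  unfolding sup_norm_def using smooth_on_deriv_bounded[OF assms] by (intro cSup_upper) auto

lemma smooth_netsD: "u \<in> smooth_nets \<Omega> \<Longrightarrow> 0 < \<epsilon> \<Longrightarrow> \<epsilon> \<le> 1 \<Longrightarrow> smooth_on \<Omega> (u \<epsilon>)"
  by (auto simp: smooth_nets_def)

lemma smooth_nets_add:
  "open \<Omega> \<Longrightarrow> u \<in> smooth_nets \<Omega> \<Longrightarrow> v \<in> smooth_nets \<Omega> \<Longrightarrow> (\<lambda>\<epsilon> x. u \<epsilon> x + v \<epsilon> x) \<in> smooth_nets \<Omega>"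
  by (auto simp: smooth_nets_def intro: smooth_on_add(2))

lemma smooth_nets_minus: "open \<Omega> \<Longrightarrow> u \<in> smooth_nets \<Omega> \<Longrightarrow> (\<lambda>\<epsilon> x. - u \<epsilon> x) \<in> smooth_nets \<Omega>"
  by (auto simp: smooth_nets_def intro: smooth_on_minus(2))

lemma smooth_nets_diff:
  "open \<Omega> \<Longrightarrow> u \<in> smooth_nets \<Omega> \<Longrightarrow> v \<in> smooth_nets \<Omega> \<Longrightarrow> (\<lambda>\<epsilon> x. u \<epsilon> x - v \<epsilon> x) \<in> smooth_nets \<Omega>"
  by (auto simp: smooth_nets_def intro: smooth_on_diff(2))

lemma smooth_nets_mult:
  "open \<Omega> \<Longrightarrow> u \<in> smooth_nets \<Omega> \<Longrightarrow> v \<in> smooth_nets \<Omega> \<Longrightarrow> (\<lambda>\<epsilon> x. u \<epsilon> x * v \<epsilon> x) \<in> smooth_nets \<Omega>"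
  by (auto simp: smooth_nets_def intro: smooth_on_mult)

lemma smooth_nets_const: "smooth_on \<Omega> h \<Longrightarrow> (\<lambda>\<epsilon>. h) \<in> smooth_nets \<Omega>"
  by (auto simp: smooth_nets_def)

lemma moderate_imp_smooth_nets: "u \<in> moderate \<Omega> \<Longrightarrow> u \<in> smooth_nets \<Omega>"
  by (simp add: moderate_def)

lemma negligible_imp_smooth_nets: "u \<in> negligible_nets \<Omega> \<Longrightarrow> u \<in> smooth_nets \<Omega>"
  by (simp add: negligible_nets_def)

text \<open>Moderateness, negligibility and the valuation are all expressed through this condition.\<close>

definition decay :: "(real^'n) set \<Rightarrow> nat \<Rightarrow> real \<Rightarrow> ('n, 'k::{real_normed_field,euclidean_space}) net \<Rightarrow> bool" where
  "decay A p a u \<longleftrightarrow> (\<forall>c>0. \<forall>\<^sub>F \<epsilon> in at_right 0. \<forall>\<beta>. length \<beta> \<le> p \<longrightarrow>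
     (\<forall>x\<in>A. norm (partial_derivs \<beta> (u \<epsilon>) x) \<le> c * \<epsilon> powr a))"

lemma decayD:
  assumes "decay A p a u" "0 < c"
  shows "\<forall>\<^sub>F \<epsilon> in at_right 0. \<forall>\<beta>. length \<beta> \<le> p \<longrightarrow> (\<forall>x\<in>A. norm (partial_derivs \<beta> (u \<epsilon>) x) \<le> c * \<epsilon> powr a)"
  using assms by (simp add: decay_def)

text \<open>A bound of order \<epsilon>^b with any constant suffices for little-o of \<epsilon>^a:
  the surplus power \<epsilon>^(b-a) eventually absorbs the constant.\<close>

lemma decayI:
  assumes "\<forall>\<^sub>F \<epsilon> in at_right 0. \<forall>\<beta>. length \<beta> \<le> p \<longrightarrow> (\<forall>x\<in>A. norm (partial_derivs \<beta> (u \<epsilon>) x) \<le> C * \<epsilon> powr b)"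
    and "a < b"
  shows "decay A p a u"
  unfolding decay_def
proof (intro allI impI)
  fix c :: real assume "0 < c"
  have "\<forall>\<^sub>F \<epsilon>::real in at_right 0. 0 \<le> \<epsilon>" using eventually_small by eventually_elim simp
  then have "((\<lambda>\<epsilon>::real. C * \<epsilon> powr (b - a)) \<longlongrightarrow> C * 0 powr (b - a)) (at_right 0)"
    using assms(2) by (intro tendsto_mult_left tendsto_powr' tendsto_ident_at tendsto_const) auto
  then have "\<forall>\<^sub>F \<epsilon> in at_right 0. C * \<epsilon> powr (b - a) < c" using \<open>0 < c\<close> by (simp add: order_tendstoD)
  with assms(1) eventually_small
  show "\<forall>\<^sub>F \<epsilon> in at_right 0. \<forall>\<beta>. length \<beta> \<le> p \<longrightarrow> (\<forall>x\<in>A. norm (partial_derivs \<beta> (u \<epsilon>) x) \<le> c * \<epsilon> powr a)"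
  proof eventually_elim
    case (elim \<epsilon>)
    have "C * \<epsilon> powr b = (C * \<epsilon> powr (b - a)) * \<epsilon> powr a" using elim(2) by (simp add: powr_diff)
    also have "\<dots> \<le> c * \<epsilon> powr a" using elim(3) by (intro mult_right_mono) auto
    finally show ?case using elim(1) by (meson order_trans)
  qed
qed

lemma decay_mono: "decay A p a u \<Longrightarrow> b \<le> a \<Longrightarrow> decay A p b u"
  using decayI[OF decayD[of A p a u 1], of b] by (cases "a = b") auto

lemma decay_subset:
  assumes "decay A q a u" "B \<subseteq> A" "p \<le> q"
  shows "decay B p a u"
  unfolding decay_def
proof (intro allI impI)
  fix c :: real assume "0 < c"
  from decayD[OF assms(1) this] show "\<forall>\<^sub>F \<epsilon> in at_right 0. \<forall>\<beta>. length \<beta> \<le> p \<longrightarrow>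
     (\<forall>x\<in>B. norm (partial_derivs \<beta> (u \<epsilon>) x) \<le> c * \<epsilon> powr a)"
    by eventually_elim (use assms(2,3) in auto)
qed

lemma decay_Union:
  assumes "finite D" "\<And>d. d \<in> D \<Longrightarrow> decay (B d) p a u"
  shows "decay (\<Union>d\<in>D. B d) p a u"
  unfolding decay_def
proof (intro allI impI)
  fix c :: real assume "0 < c"
  then have "\<forall>\<^sub>F \<epsilon> in at_right 0. \<forall>d\<in>D. \<forall>\<beta>. length \<beta> \<le> p \<longrightarrow>
     (\<forall>x\<in>B d. norm (partial_derivs \<beta> (u \<epsilon>) x) \<le> c * \<epsilon> powr a)"
    by (intro eventually_ball_finite assms(1) ballI decayD assms(2))
  then show "\<forall>\<^sub>F \<epsilon> in at_right 0. \<forall>\<beta>. length \<beta> \<le> p \<longrightarrow>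
     (\<forall>x\<in>\<Union>d\<in>D. B d. norm (partial_derivs \<beta> (u \<epsilon>) x) \<le> c * \<epsilon> powr a)"
    by eventually_elim auto
qed

lemma decay_cong:
  assumes "open \<Omega>" "A \<subseteq> \<Omega>" "decay A p a u" "\<And>\<epsilon> x. x \<in> \<Omega> \<Longrightarrow> u \<epsilon> x = v \<epsilon> x"
  shows "decay A p a v"
proof -
  have "partial_derivs \<beta> (v \<epsilon>) x = partial_derivs \<beta> (u \<epsilon>) x" if "x \<in> A" for \<beta> \<epsilon> x
    using assms(2,4) that by (intro partial_derivs_cong[OF assms(1)]) auto
  then show ?thesis using assms(3) by (simp add: decay_def)
qed

lemma decay_add:
  assumes "open \<Omega>" "A \<subseteq> \<Omega>" "u \<in> smooth_nets \<Omega>" "v \<in> smooth_nets \<Omega>" "decay A p a u" "decay A p a v"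
  shows "decay A p a (\<lambda>\<epsilon> x. u \<epsilon> x + v \<epsilon> x)"
  unfolding decay_def
proof (intro allI impI)
  fix c :: real assume "0 < c"
  then have "0 < c / 2" by simp
  from eventually_small decayD[OF assms(5) this] decayD[OF assms(6) this]
  show "\<forall>\<^sub>F \<epsilon> in at_right 0. \<forall>\<beta>. length \<beta> \<le> p \<longrightarrow>
     (\<forall>x\<in>A. norm (partial_derivs \<beta> (\<lambda>x. u \<epsilon> x + v \<epsilon> x) x) \<le> c * \<epsilon> powr a)"
  proof (eventually_elim, intro allI impI ballI)
    fix \<epsilon> x and \<beta> :: "'a list"
    assume \<epsilon>: "0 < \<epsilon> \<and> \<epsilon> < 1" and \<beta>: "length \<beta> \<le> p" and x: "x \<in> A"
      and uv: "\<forall>\<beta>. length \<beta> \<le> p \<longrightarrow> (\<forall>x\<in>A. norm (partial_derivs \<beta> (u \<epsilon>) x) \<le> c / 2 * \<epsilon> powr a)"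
        "\<forall>\<beta>. length \<beta> \<le> p \<longrightarrow> (\<forall>x\<in>A. norm (partial_derivs \<beta> (v \<epsilon>) x) \<le> c / 2 * \<epsilon> powr a)"
    have "partial_derivs \<beta> (\<lambda>x. u \<epsilon> x + v \<epsilon> x) x = partial_derivs \<beta> (u \<epsilon>) x + partial_derivs \<beta> (v \<epsilon>) x"
      using \<epsilon> x assms(2) by (intro partial_derivs_add[OF assms(1) assms(3,4)[THEN smooth_netsD]]) auto
    also have "norm \<dots> \<le> c / 2 * \<epsilon> powr a + c / 2 * \<epsilon> powr a"
      using uv \<beta> x by (intro norm_triangle_mono) auto
    finally show "norm (partial_derivs \<beta> (\<lambda>x. u \<epsilon> x + v \<epsilon> x) x) \<le> c * \<epsilon> powr a" by simp
  qed
qed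

text \<open>Only one factor needs to be little-o; the other may merely be bounded by a multiple of
  \<epsilon>^a. With a fixed smooth function as the first factor and \<open>a = 0\<close>, the
  exponent of \<open>v\<close> is preserved.\<close>

lemma decay_mult:
  assumes "open \<Omega>" "A \<subseteq> \<Omega>" "u \<in> smooth_nets \<Omega>" "v \<in> smooth_nets \<Omega>" "decay A p b v"
    and H: "\<forall>\<^sub>F \<epsilon> in at_right 0. \<forall>\<beta>. length \<beta> \<le> p \<longrightarrow> (\<forall>x\<in>A. norm (partial_derivs \<beta> (u \<epsilon>) x) \<le> H * \<epsilon> powr a)"
      "0 \<le> H"
  shows "decay A p (a + b) (\<lambda>\<epsilon> x. u \<epsilon> x * v \<epsilon> x)"
  unfolding decay_def
proof (intro allI impI)
  fix c :: real assume "0 < c"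
  \<comment> \<open>Cancels the Leibniz factor and the bound on \<open>u\<close>;
    \<open>H + 1\<close> because \<open>H\<close> may be 0.\<close>
  define d where "d = c / (2 ^ p * (H + 1))"
  have "0 < d" using \<open>0 < c\<close> \<open>0 \<le> H\<close> by (simp add: d_def)
  from eventually_small H(1) decayD[OF assms(5) this]
  show "\<forall>\<^sub>F \<epsilon> in at_right 0. \<forall>\<beta>. length \<beta> \<le> p \<longrightarrow>
     (\<forall>x\<in>A. norm (partial_derivs \<beta> (\<lambda>x. u \<epsilon> x * v \<epsilon> x) x) \<le> c * \<epsilon> powr (a + b))"
  proof (eventually_elim, intro allI impI ballI)
    fix \<epsilon> x and \<beta> :: "'a list"
    assume \<epsilon>: "0 < \<epsilon> \<and> \<epsilon> < 1" and \<beta>: "length \<beta> \<le> p" and x: "x \<in> A"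
      and uv: "\<forall>\<beta>. length \<beta> \<le> p \<longrightarrow> (\<forall>x\<in>A. norm (partial_derivs \<beta> (u \<epsilon>) x) \<le> H * \<epsilon> powr a)"
        "\<forall>\<beta>. length \<beta> \<le> p \<longrightarrow> (\<forall>x\<in>A. norm (partial_derivs \<beta> (v \<epsilon>) x) \<le> d * \<epsilon> powr b)"
    have "norm (partial_derivs \<beta> (\<lambda>x. u \<epsilon> x * v \<epsilon> x) x) \<le> 2 ^ length \<beta> * (H * \<epsilon> powr a) * (d * \<epsilon> powr b)"
      using \<epsilon> \<beta> x uv \<open>0 \<le> H\<close> assms(2)
      by (intro norm_partial_derivs_mult_le[OF assms(1) assms(3,4)[THEN smooth_netsD]]) auto
    also have "\<dots> \<le> 2 ^ p * ((H + 1) * \<epsilon> powr a) * (d * \<epsilon> powr b)"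
      using \<beta> \<open>0 \<le> H\<close> \<open>0 < d\<close> by (intro mult_right_mono mult_mono power_increasing) auto
    also have "\<dots> = c * \<epsilon> powr (a + b)"
      using \<open>0 \<le> H\<close> by (simp add: d_def powr_add)
    finally show "norm (partial_derivs \<beta> (\<lambda>x. u \<epsilon> x * v \<epsilon> x) x) \<le> c * \<epsilon> powr (a + b)" .
  qed
qed

lemma smooth_on_uniform_bound:
  fixes h :: "real^'n \<Rightarrow> 'b::real_normed_vector"
  assumes "smooth_on \<Omega> h" "compact (closure A)" "closure A \<subseteq> \<Omega>"
  obtains H where "0 \<le> H" "\<And>\<beta> x. length \<beta> \<le> p \<Longrightarrow> x \<in> A \<Longrightarrow> norm (partial_derivs \<beta> h x) \<le> H"
proof (rule uniform_bound_lists[where N = p and P = "\<lambda>\<beta> H. \<forall>x\<in>A. norm (partial_derivs \<beta> h x) \<le> H"])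
  show "\<exists>H. \<forall>x\<in>A. norm (partial_derivs \<beta> h x) \<le> H" for \<beta>
    using smooth_on_deriv_bounded[OF assms, of \<beta>] by (auto simp: bdd_above_def)
qed (use that in \<open>auto intro: order_trans\<close>)

lemma decay_smooth_mult:
  assumes "open \<Omega>" "compact (closure A)" "closure A \<subseteq> \<Omega>" "smooth_on \<Omega> h" "u \<in> smooth_nets \<Omega>" "decay A p a u"
  shows "decay A p a (\<lambda>\<epsilon> x. h x * u \<epsilon> x)"
proof -
  obtain H where H: "0 \<le> H" "\<And>\<beta> x. length \<beta> \<le> p \<Longrightarrow> x \<in> A \<Longrightarrow> norm (partial_derivs \<beta> h x) \<le> H"
    using smooth_on_uniform_bound[OF assms(4,2,3), of p] by metis
  have "\<forall>\<^sub>F \<epsilon>::real in at_right 0. \<forall>\<beta>. length \<beta> \<le> p \<longrightarrow> (\<forall>x\<in>A. norm (partial_derivs \<beta> h x) \<le> H * \<epsilon> powr 0)"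
    using eventually_small by eventually_elim (simp add: H(2))
  moreover have "A \<subseteq> \<Omega>" using assms(3) closure_subset by blast
  ultimately show ?thesis
    using decay_mult[OF assms(1) _ smooth_nets_const[OF assms(4)] assms(5,6) _ H(1), of 0] by simp
qed

lemma decay_minus:
  assumes "open \<Omega>" "compact (closure A)" "closure A \<subseteq> \<Omega>" "u \<in> smooth_nets \<Omega>" "decay A p a u"
  shows "decay A p a (\<lambda>\<epsilon> x. - u \<epsilon> x)"
  using decay_smooth_mult[OF assms(1-3) smooth_on_const[of \<Omega> "-1"] assms(4,5)] by simp

lemma decay_eventually_sup_norm_less:
  assumes "u \<in> smooth_nets \<Omega>" "decay K p a u" "length \<beta> \<le> p" "b < a"
  shows "\<forall>\<^sub>F \<epsilon> in at_right 0. sup_norm K (partial_derivs \<beta> (u \<epsilon>)) < \<epsilon> powr b"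
  using eventually_small decayD[OF assms(2) zero_less_one]
proof eventually_elim
  case (elim \<epsilon>)
  have "sup_norm K (partial_derivs \<beta> (u \<epsilon>)) \<le> \<epsilon> powr a"
    using elim(2) assms(3) by (intro sup_norm_le) auto
  also have "\<dots> < \<epsilon> powr b" using elim(1) assms(4) by (intro powr_less_mono') auto
  finally show ?case .
qed

lemma decay_if_sup_norm_less:
  assumes u: "u \<in> smooth_nets \<Omega>" and K: "compact K" "K \<subseteq> \<Omega>" and "a < b"
    and "\<And>\<beta>. length \<beta> \<le> p \<Longrightarrow> \<forall>\<^sub>F \<epsilon> in at_right 0. sup_norm K (partial_derivs \<beta> (u \<epsilon>)) < \<epsilon> powr b"
  shows "decay K p a u"
proof (rule decayI[OF _ \<open>a < b\<close>])
  have "\<forall>\<^sub>F \<epsilon> in at_right 0. \<forall>\<beta>\<in>{\<beta>. length \<beta> \<le> p}. sup_norm K (partial_derivs \<beta> (u \<epsilon>)) < \<epsilon> powr b"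
    using assms(5) by (intro eventually_ball_finite finite_lists_length_le_UNIV) auto
  with eventually_small show "\<forall>\<^sub>F \<epsilon> in at_right 0. \<forall>\<beta>. length \<beta> \<le> p \<longrightarrow>
      (\<forall>x\<in>K. norm (partial_derivs \<beta> (u \<epsilon>) x) \<le> 1 * \<epsilon> powr b)"
  proof (eventually_elim, intro allI impI)
    fix \<epsilon> and \<beta> :: "'a list" assume \<epsilon>: "0 < \<epsilon> \<and> \<epsilon> < 1" and "length \<beta> \<le> p"
      and "\<forall>\<beta>\<in>{\<beta>. length \<beta> \<le> p}. sup_norm K (partial_derivs \<beta> (u \<epsilon>)) < \<epsilon> powr b"
    then have "sup_norm K (partial_derivs \<beta> (u \<epsilon>)) \<le> 1 * \<epsilon> powr b" by (auto intro: less_imp_le)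
    then show "\<forall>x\<in>K. norm (partial_derivs \<beta> (u \<epsilon>) x) \<le> 1 * \<epsilon> powr b"
      using \<epsilon> K by (subst (asm) sup_norm_le_iff[OF smooth_netsD[OF u]]) (auto simp: compact_imp_closed)
  qed
qed

text \<open>Passing between a strict inequality and little-o costs a positive amount of exponent,
  here 1. This is harmless because the exponent is only asserted to exist; for negligible nets it is
  arbitrary.\<close>

lemma moderate_iff:
  fixes u :: "('n::finite, 'k::{real_normed_field,euclidean_space}) net"
  shows "u \<in> moderate \<Omega> \<longleftrightarrow> u \<in> smooth_nets \<Omega> \<and> (\<forall>K p. compact K \<and> K \<subseteq> \<Omega> \<longrightarrow> (\<exists>a. decay K p a u))"
proof (intro iffI conjI allI impI)
  assume u: "u \<in> moderate \<Omega>"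
  then show s: "u \<in> smooth_nets \<Omega>" by (rule moderate_imp_smooth_nets)
  fix K p assume K: "compact K \<and> K \<subseteq> \<Omega>"
  \<comment> \<open>The sign is reversed so that a larger \<open>M\<close> weakens the condition,
    the monotonicity under which finitely many bounds can be merged.\<close>
  let ?P = "\<lambda>\<beta> M. \<forall>\<^sub>F \<epsilon> in at_right 0. sup_norm K (partial_derivs \<beta> (u \<epsilon>)) < \<epsilon> powr (- M)"
  obtain M where M: "\<And>\<beta>. length \<beta> \<le> p \<Longrightarrow> ?P \<beta> M"
  proof (rule uniform_bound_lists[where N = p and P = ?P])
    show "\<exists>M. ?P \<beta> M" for \<beta>
    proof -
      obtain r where "\<forall>\<^sub>F \<epsilon> in at_right 0. sup_norm K (partial_derivs \<beta> (u \<epsilon>)) < \<epsilon> powr r"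
        using u K unfolding moderate_def by blast
      then show ?thesis by (intro exI[of _ "- r"]) simp
    qed
    show "?P \<beta> M'" if "?P \<beta> M" "M \<le> M'" for \<beta> M M'
      using that(1) eventually_small
    proof eventually_elim
      case (elim \<epsilon>)
      have "\<epsilon> powr (- M) \<le> \<epsilon> powr (- M')" using elim(2) that(2) by (intro powr_le_powr_small) auto
      with elim(1) show ?case by (rule less_le_trans)
    qed
  qed blast
  show "\<exists>a. decay K p a u"
    using K by (intro exI[of _ "- M - 1"] decay_if_sup_norm_less[OF s _ _ _ M]) auto
next
  assume u: "u \<in> smooth_nets \<Omega> \<and> (\<forall>K p. compact K \<and> K \<subseteq> \<Omega> \<longrightarrow> (\<exists>a. decay K p a u))"
  have "\<exists>r::real. \<forall>\<^sub>F \<epsilon> in at_right 0. sup_norm K (partial_derivs \<beta> (u \<epsilon>)) < \<epsilon> powr r"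
    if K: "compact K \<and> K \<subseteq> \<Omega>" for K \<beta>
  proof -
    obtain a where "decay K (length \<beta>) a u" using u K by blast
    from decay_eventually_sup_norm_less[OF conjunct1[OF u] this, of \<beta> "a - 1"] show ?thesis by auto
  qed
  with u show "u \<in> moderate \<Omega>" by (simp add: moderate_def)
qed

lemma negligible_iff:
  fixes u :: "('n::finite, 'k::{real_normed_field,euclidean_space}) net"
  shows "u \<in> negligible_nets \<Omega> \<longleftrightarrow> u \<in> smooth_nets \<Omega> \<and> (\<forall>K p a. compact K \<and> K \<subseteq> \<Omega> \<longrightarrow> decay K p a u)"
proof -
  have eq: "(\<forall>\<^sub>F \<epsilon> in at_right 0. f \<epsilon> < \<epsilon> ^ r) \<longleftrightarrow> (\<forall>\<^sub>F \<epsilon> in at_right 0. f \<epsilon> < \<epsilon> powr real r)" for f and r :: nat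
    by (rule eventually_cong[OF eventually_small]) (simp add: powr_realpow)
  show ?thesis
  proof (intro iffI conjI allI impI)
    assume u: "u \<in> negligible_nets \<Omega>"
    then show s: "u \<in> smooth_nets \<Omega>" by (rule negligible_imp_smooth_nets)
    fix K p a assume K: "compact K \<and> K \<subseteq> \<Omega>"
    obtain r :: nat where r: "a < real r" using reals_Archimedean2 by blast
    show "decay K p a u"
      using u K r by (intro decay_if_sup_norm_less[OF s, of K a "real r"]) (auto simp: negligible_nets_def eq)
  next
    assume u: "u \<in> smooth_nets \<Omega> \<and> (\<forall>K p a. compact K \<and> K \<subseteq> \<Omega> \<longrightarrow> decay K p a u)"
    have "\<forall>\<^sub>F \<epsilon> in at_right 0. sup_norm K (partial_derivs \<beta> (u \<epsilon>)) < \<epsilon> ^ r"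
      if "compact K \<and> K \<subseteq> \<Omega>" for K \<beta> r
      unfolding eq using u that
      by (intro decay_eventually_sup_norm_less[of u \<Omega> K "length \<beta>" "real r + 1"]) auto
    with u show "u \<in> negligible_nets \<Omega>" by (simp add: negligible_nets_def)
  qed
qed

section \<open>Moderate nets as an algebra, negligible nets as an ideal\<close>

lemma negligible_subset: "u \<in> negligible_nets \<Omega> \<Longrightarrow> \<omega> \<subseteq> \<Omega> \<Longrightarrow> u \<in> negligible_nets \<omega>"
  unfolding negligible_iff smooth_nets_def by (blast intro: smooth_on_subset order_trans)

lemma negligible_imp_moderate: "u \<in> negligible_nets \<Omega> \<Longrightarrow> u \<in> moderate \<Omega>"
  unfolding negligible_iff moderate_iff by blast

lemma moderate_const:
  assumes "smooth_on \<Omega> h"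
  shows "(\<lambda>\<epsilon>. h) \<in> moderate \<Omega>"
  unfolding moderate_iff
proof (intro conjI allI impI smooth_nets_const assms)
  fix K p assume K: "compact K \<and> K \<subseteq> \<Omega>"
  then have "compact (closure K)" "closure K \<subseteq> \<Omega>" by (simp_all add: compact_imp_closed)
  then obtain H where H: "\<And>\<beta> x. length \<beta> \<le> p \<Longrightarrow> x \<in> K \<Longrightarrow> norm (partial_derivs \<beta> h x) \<le> H"
    using smooth_on_uniform_bound[OF assms] by metis
  have "\<forall>\<^sub>F \<epsilon>::real in at_right 0. \<forall>\<beta>. length \<beta> \<le> p \<longrightarrow> (\<forall>x\<in>K. norm (partial_derivs \<beta> h x) \<le> H * \<epsilon> powr 0)"
    using eventually_small by eventually_elim (simp add: H)
  from decayI[OF this, of "-1"] show "\<exists>a. decay K p a (\<lambda>\<epsilon>. h)" by auto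
qed

lemma moderate_add:
  assumes "open \<Omega>" "u \<in> moderate \<Omega>" "v \<in> moderate \<Omega>"
  shows "(\<lambda>\<epsilon> x. u \<epsilon> x + v \<epsilon> x) \<in> moderate \<Omega>"
  unfolding moderate_iff
proof (intro conjI allI impI)
  note s = assms(2,3)[THEN moderate_imp_smooth_nets]
  show "(\<lambda>\<epsilon> x. u \<epsilon> x + v \<epsilon> x) \<in> smooth_nets \<Omega>" using assms(1) s by (rule smooth_nets_add)
  fix K p assume K: "compact K \<and> K \<subseteq> \<Omega>"
  then obtain a b where "decay K p a u" "decay K p b v"
    using assms(2,3) unfolding moderate_iff by metis
  then have "decay K p (min a b) u" "decay K p (min a b) v" by (auto intro: decay_mono)
  then show "\<exists>a. decay K p a (\<lambda>\<epsilon> x. u \<epsilon> x + v \<epsilon> x)"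
    using decay_add[OF assms(1) conjunct2[OF K] s] by blast
qed

lemma decay_product:
  assumes "open \<Omega>" "A \<subseteq> \<Omega>" "u \<in> smooth_nets \<Omega>" "v \<in> smooth_nets \<Omega>" "decay A p a u" "decay A p b v"
  shows "decay A p (a + b) (\<lambda>\<epsilon> x. u \<epsilon> x * v \<epsilon> x)"
  by (rule decay_mult[OF assms(1-4,6) decayD[OF assms(5) zero_less_one] zero_le_one])

lemma moderate_mult:
  assumes "open \<Omega>" "u \<in> moderate \<Omega>" "v \<in> moderate \<Omega>"
  shows "(\<lambda>\<epsilon> x. u \<epsilon> x * v \<epsilon> x) \<in> moderate \<Omega>"
  unfolding moderate_iff
proof (intro conjI allI impI)
  note s = assms(2,3)[THEN moderate_imp_smooth_nets]
  show "(\<lambda>\<epsilon> x. u \<epsilon> x * v \<epsilon> x) \<in> smooth_nets \<Omega>" using assms(1) s by (rule smooth_nets_mult)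
  fix K p assume K: "compact K \<and> K \<subseteq> \<Omega>"
  then obtain a b where "decay K p a u" "decay K p b v"
    using assms(2,3) unfolding moderate_iff by metis
  then show "\<exists>a. decay K p a (\<lambda>\<epsilon> x. u \<epsilon> x * v \<epsilon> x)"
    using decay_product[OF assms(1) conjunct2[OF K] s] by blast
qed

lemma moderate_minus:
  assumes "open \<Omega>" "u \<in> moderate \<Omega>"
  shows "(\<lambda>\<epsilon> x. - u \<epsilon> x) \<in> moderate \<Omega>"
  using moderate_mult[OF assms(1) moderate_const[OF smooth_on_const[of \<Omega> "-1"]] assms(2)] by simp

lemma moderate_diff:
  assumes "open \<Omega>" "u \<in> moderate \<Omega>" "v \<in> moderate \<Omega>"
  shows "(\<lambda>\<epsilon> x. u \<epsilon> x - v \<epsilon> x) \<in> moderate \<Omega>"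
  using moderate_add[OF assms(1,2) moderate_minus[OF assms(1,3)]] by simp

lemma negligible_mult:
  assumes "open \<Omega>" "u \<in> negligible_nets \<Omega>" "v \<in> moderate \<Omega>"
  shows "(\<lambda>\<epsilon> x. u \<epsilon> x * v \<epsilon> x) \<in> negligible_nets \<Omega>"
  unfolding negligible_iff
proof (intro conjI allI impI)
  note s = negligible_imp_smooth_nets[OF assms(2)] moderate_imp_smooth_nets[OF assms(3)]
  show "(\<lambda>\<epsilon> x. u \<epsilon> x * v \<epsilon> x) \<in> smooth_nets \<Omega>" using assms(1) s by (rule smooth_nets_mult)
  fix K p a assume K: "compact K \<and> K \<subseteq> \<Omega>"
  then obtain b where "decay K p b v" using assms(3) unfolding moderate_iff by blast
  moreover have "decay K p (a - b) u" using assms(2) K unfolding negligible_iff by blast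
  ultimately show "decay K p a (\<lambda>\<epsilon> x. u \<epsilon> x * v \<epsilon> x)"
    using decay_product[OF assms(1) conjunct2[OF K] s, of p "a - b" b] by simp
qed

lemma negligible_add:
  assumes "open \<Omega>" "u \<in> negligible_nets \<Omega>" "v \<in> negligible_nets \<Omega>"
  shows "(\<lambda>\<epsilon> x. u \<epsilon> x + v \<epsilon> x) \<in> negligible_nets \<Omega>"
  using assms unfolding negligible_iff by (auto intro: smooth_nets_add decay_add)

lemma negligible_minus:
  assumes "open \<Omega>" "u \<in> negligible_nets \<Omega>"
  shows "(\<lambda>\<epsilon> x. - u \<epsilon> x) \<in> negligible_nets \<Omega>"
  using negligible_mult[OF assms moderate_const[OF smooth_on_const[of \<Omega> "-1"]]] by simp

lemma negligible_diff:
  assumes "open \<Omega>" "u \<in> negligible_nets \<Omega>" "v \<in> negligible_nets \<Omega>"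
  shows "(\<lambda>\<epsilon> x. u \<epsilon> x - v \<epsilon> x) \<in> negligible_nets \<Omega>"
  using negligible_add[OF assms(1,2) negligible_minus[OF assms(1,3)]] by simp

lemma negligible_zero: "(\<lambda>\<epsilon> x. 0) \<in> negligible_nets \<Omega>"
  by (simp add: negligible_iff smooth_nets_const decay_def partial_derivs_const)

subsection \<open>Classes of nets\<close>

lemma mem_colombeau_class:
  "v \<in> colombeau_class \<Omega> u \<longleftrightarrow> u \<in> moderate \<Omega> \<and> v \<in> moderate \<Omega> \<and> (\<lambda>\<epsilon> x. u \<epsilon> x - v \<epsilon> x) \<in> negligible_nets \<Omega>"
  by (simp add: colombeau_class_def colombeau_rel_def)

lemma colombeau_class_self: "u \<in> moderate \<Omega> \<Longrightarrow> u \<in> colombeau_class \<Omega> u"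
  by (simp add: mem_colombeau_class negligible_zero)

lemma equiv_colombeau_rel:
  assumes "open \<Omega>"
  shows "equiv (moderate \<Omega>) (colombeau_rel \<Omega>)"
proof (rule equivI)
  show "colombeau_rel \<Omega> \<subseteq> moderate \<Omega> \<times> moderate \<Omega>" by (auto simp: colombeau_rel_def)
  show "refl_on (moderate \<Omega>) (colombeau_rel \<Omega>)"
    by (auto simp: refl_on_def colombeau_rel_def negligible_zero)
  show "sym (colombeau_rel \<Omega>)"
    using negligible_minus[OF assms] by (fastforce simp: sym_def colombeau_rel_def)
  show "trans (colombeau_rel \<Omega>)"
  proof (rule transI)
    fix u v w assume "(u, v) \<in> colombeau_rel \<Omega>" "(v, w) \<in> colombeau_rel \<Omega>"
    then show "(u, w) \<in> colombeau_rel \<Omega>"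
      using negligible_add[OF assms, of "\<lambda>\<epsilon> x. u \<epsilon> x - v \<epsilon> x" "\<lambda>\<epsilon> x. v \<epsilon> x - w \<epsilon> x"]
      by (auto simp: colombeau_rel_def)
  qed
qed

lemma colombeau_class_eq_iff:
  assumes "open \<Omega>" "u \<in> moderate \<Omega>" "v \<in> moderate \<Omega>"
  shows "colombeau_class \<Omega> u = colombeau_class \<Omega> v \<longleftrightarrow> (\<lambda>\<epsilon> x. u \<epsilon> x - v \<epsilon> x) \<in> negligible_nets \<Omega>"
  using eq_equiv_class_iff[OF equiv_colombeau_rel[OF assms(1)] assms(2,3)] assms(2,3)
  by (simp add: colombeau_class_def colombeau_rel_def)

lemma colombeau_class_in: "u \<in> moderate \<Omega> \<Longrightarrow> colombeau_class \<Omega> u \<in> colombeau \<Omega>"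
  by (auto simp: colombeau_def colombeau_class_def intro: quotientI)

lemma colombeau_cases:
  assumes "f \<in> colombeau \<Omega>"
  obtains u where "u \<in> moderate \<Omega>" "f = colombeau_class \<Omega> u"
  using assms by (auto simp: colombeau_def colombeau_class_def elim!: quotientE)

lemma colombeau_diff_class:
  assumes "open \<Omega>" "u \<in> moderate \<Omega>" "v \<in> moderate \<Omega>"
  shows "colombeau_diff \<Omega> (colombeau_class \<Omega> u) (colombeau_class \<Omega> v) = colombeau_class \<Omega> (\<lambda>\<epsilon> x. u \<epsilon> x - v \<epsilon> x)"
proof -
  have "colombeau_class \<Omega> (\<lambda>\<epsilon> x. u' \<epsilon> x - v' \<epsilon> x) = colombeau_class \<Omega> (\<lambda>\<epsilon> x. u \<epsilon> x - v \<epsilon> x)"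
    if "u' \<in> colombeau_class \<Omega> u" "v' \<in> colombeau_class \<Omega> v" for u' v'
  proof -
    have m: "u' \<in> moderate \<Omega>" "v' \<in> moderate \<Omega>" "(\<lambda>\<epsilon> x. u \<epsilon> x - u' \<epsilon> x) \<in> negligible_nets \<Omega>"
      "(\<lambda>\<epsilon> x. v \<epsilon> x - v' \<epsilon> x) \<in> negligible_nets \<Omega>"
      using that by (auto simp: mem_colombeau_class)
    have "(\<lambda>\<epsilon> x. (u' \<epsilon> x - v' \<epsilon> x) - (u \<epsilon> x - v \<epsilon> x)) = (\<lambda>\<epsilon> x. (v \<epsilon> x - v' \<epsilon> x) - (u \<epsilon> x - u' \<epsilon> x))"
      by (simp add: algebra_simps)
    then show ?thesis
      using colombeau_class_eq_iff[OF assms(1) moderate_diff[OF assms(1) m(1,2)] moderate_diff[OF assms]]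
        negligible_diff[OF assms(1) m(4,3)] by simp
  qed
  then show ?thesis
    using colombeau_class_self[OF assms(2)] colombeau_class_self[OF assms(3)]
    unfolding colombeau_diff_def by blast
qed

lemma colombeau_mult_class:
  assumes "open \<Omega>" "u \<in> moderate \<Omega>" "v \<in> moderate \<Omega>"
  shows "colombeau_mult \<Omega> (colombeau_class \<Omega> u) (colombeau_class \<Omega> v) = colombeau_class \<Omega> (\<lambda>\<epsilon> x. u \<epsilon> x * v \<epsilon> x)"
proof -
  have "colombeau_class \<Omega> (\<lambda>\<epsilon> x. u' \<epsilon> x * v' \<epsilon> x) = colombeau_class \<Omega> (\<lambda>\<epsilon> x. u \<epsilon> x * v \<epsilon> x)"
    if "u' \<in> colombeau_class \<Omega> u" "v' \<in> colombeau_class \<Omega> v" for u' v'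
  proof -
    have m: "u' \<in> moderate \<Omega>" "v' \<in> moderate \<Omega>" "(\<lambda>\<epsilon> x. u \<epsilon> x - u' \<epsilon> x) \<in> negligible_nets \<Omega>"
      "(\<lambda>\<epsilon> x. v \<epsilon> x - v' \<epsilon> x) \<in> negligible_nets \<Omega>"
      using that by (auto simp: mem_colombeau_class)
    have "(\<lambda>\<epsilon> x. u \<epsilon> x * v \<epsilon> x - u' \<epsilon> x * v' \<epsilon> x)
        = (\<lambda>\<epsilon> x. (u \<epsilon> x - u' \<epsilon> x) * v \<epsilon> x + (v \<epsilon> x - v' \<epsilon> x) * u' \<epsilon> x)"
      by (simp add: algebra_simps)
    then show ?thesis
      using colombeau_class_eq_iff[OF assms(1) moderate_mult[OF assms] moderate_mult[OF assms(1) m(1,2)]]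
        negligible_add[OF assms(1) negligible_mult[OF assms(1) m(3) assms(3)] negligible_mult[OF assms(1) m(4,1)]]
      by simp
  qed
  then show ?thesis
    using colombeau_class_self[OF assms(2)] colombeau_class_self[OF assms(3)]
    unfolding colombeau_mult_def by blast
qed

section \<open>Valuations and the sharp metric\<close>

lemma exhaustionD:
  assumes "exhaustion \<Omega> \<Omega>s"
  shows "open (\<Omega>s m)" "compact (closure (\<Omega>s m))" "closure (\<Omega>s m) \<subseteq> \<Omega>" "\<Omega>s m \<subseteq> \<Omega>"
  using assms closure_subset[of "\<Omega>s m"] unfolding exhaustion_def by auto

text \<open>The index can also be pushed above a given \<open>n\<close>: the sharp metric only uses
  the pairs with order of derivatives equal to the index of the set, so both must be made large
  together.\<close>

lemma exhaustion_absorbs: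
  assumes "exhaustion \<Omega> \<Omega>s" "compact K" "K \<subseteq> \<Omega>"
  obtains m where "n \<le> m" "K \<subseteq> \<Omega>s m"
proof -
  have "\<Omega>s i \<subseteq> \<Omega>s (Suc i)" for i using assms(1) unfolding exhaustion_def by simp
  then have mono: "\<Omega>s i \<subseteq> \<Omega>s j" if "i \<le> j" for i j using that by (rule lift_Suc_mono_le)
  have "K \<subseteq> (\<Union>m\<in>UNIV. \<Omega>s m)" using assms(1,3) unfolding exhaustion_def by simp
  then obtain F where F: "finite F" "K \<subseteq> (\<Union>m\<in>F. \<Omega>s m)"
    using compactE_image[OF assms(2), of UNIV \<Omega>s] exhaustionD(1)[OF assms(1)] by auto
  define k where "k = Max (insert n F)"
  have "n \<le> k" "\<And>i. i \<in> F \<Longrightarrow> i \<le> k" using F(1) by (auto simp: k_def)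
  then show ?thesis using F(2) mono by (intro that[of k]) blast+
qed

text \<open>Two changes of form: the quantifier over the finitely many derivatives moves inside the
  eventual statement, and for small \<epsilon> the supremum over the relatively compact
  \<open>\<Omega>s m\<close> is finite, so bounding it means bounding every value.\<close>

lemma net_valuation_eq:
  assumes "exhaustion \<Omega> \<Omega>s" "u \<in> smooth_nets \<Omega>"
  shows "net_valuation \<Omega>s m p u = Sup (ereal ` {a. decay (\<Omega>s m) p a u})"
proof -
  have "(\<forall>\<beta>. length \<beta> \<le> p \<longrightarrow> (\<lambda>\<epsilon>. sup_norm (\<Omega>s m) (partial_derivs \<beta> (u \<epsilon>))) \<in> o[at_right 0](\<lambda>\<epsilon>. \<epsilon> powr a)) \<longleftrightarrow>
      decay (\<Omega>s m) p a u" for a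
  proof -
    have "(\<forall>\<^sub>F \<epsilon> in at_right 0. \<forall>\<beta>\<in>{\<beta>. length \<beta> \<le> p}. norm (sup_norm (\<Omega>s m) (partial_derivs \<beta> (u \<epsilon>))) \<le> c * norm (\<epsilon> powr a)) \<longleftrightarrow>
      (\<forall>\<^sub>F \<epsilon> in at_right 0. \<forall>\<beta>. length \<beta> \<le> p \<longrightarrow> (\<forall>x\<in>\<Omega>s m. norm (partial_derivs \<beta> (u \<epsilon>) x) \<le> c * \<epsilon> powr a))"
      if "0 < c" for c
    proof (rule eventually_cong[OF eventually_small])
      fix \<epsilon> :: real assume "0 < \<epsilon> \<and> \<epsilon> < 1"
      then have s: "smooth_on \<Omega> (u \<epsilon>)" by (intro smooth_netsD[OF assms(2)]) auto
      show "(\<forall>\<beta>\<in>{\<beta>. length \<beta> \<le> p}. norm (sup_norm (\<Omega>s m) (partial_derivs \<beta> (u \<epsilon>))) \<le> c * norm (\<epsilon> powr a)) \<longleftrightarrow>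
         (\<forall>\<beta>. length \<beta> \<le> p \<longrightarrow> (\<forall>x\<in>\<Omega>s m. norm (partial_derivs \<beta> (u \<epsilon>) x) \<le> c * \<epsilon> powr a))"
        using sup_norm_le_iff[OF s exhaustionD(2,3)[OF assms(1)], of "c * \<epsilon> powr a" m]
          sup_norm_nonneg[OF s exhaustionD(2,3)[OF assms(1)], of m] that by simp
    qed
    then show ?thesis
      unfolding smallo_def decay_def mem_Collect_eq
      by (subst (asm) eventually_ball_finite_distrib[OF finite_lists_length_le_UNIV]) auto
  qed
  then show ?thesis unfolding net_valuation_def by (simp add: image_Collect)
qed

lemma decay_diff:
  assumes "open \<Omega>" "compact (closure A)" "closure A \<subseteq> \<Omega>" "u \<in> smooth_nets \<Omega>" "v \<in> smooth_nets \<Omega>"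
    "decay A p a u" "decay A p a v"
  shows "decay A p a (\<lambda>\<epsilon> x. u \<epsilon> x - v \<epsilon> x)"
proof -
  have "A \<subseteq> \<Omega>" using assms(3) closure_subset by blast
  from decay_add[OF assms(1) this assms(4) smooth_nets_minus[OF assms(1,5)] assms(6) decay_minus[OF assms(1-3,5,7)]]
  show ?thesis by simp
qed

lemma negligible_imp_decay:
  "u \<in> negligible_nets \<Omega> \<Longrightarrow> compact (closure A) \<Longrightarrow> closure A \<subseteq> \<Omega> \<Longrightarrow> decay A p a u"
  unfolding negligible_iff by (blast intro: decay_subset[OF _ closure_subset order_refl])

lemma moderate_imp_decay:
  "u \<in> moderate \<Omega> \<Longrightarrow> compact (closure A) \<Longrightarrow> closure A \<subseteq> \<Omega> \<Longrightarrow> \<exists>a. decay A p a u"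
  unfolding moderate_iff by (blast intro: decay_subset[OF _ closure_subset order_refl])

lemma decay_imp_negligible:
  assumes "exhaustion \<Omega> \<Omega>s" "u \<in> smooth_nets \<Omega>" "\<And>m a. decay (\<Omega>s m) m a u"
  shows "u \<in> negligible_nets \<Omega>"
  unfolding negligible_iff
proof (intro conjI allI impI assms(2))
  fix K p a assume K: "compact K \<and> K \<subseteq> \<Omega>"
  then obtain m where "p \<le> m" "K \<subseteq> \<Omega>s m" using exhaustion_absorbs[OF assms(1)] by metis
  then show "decay K p a u" by (intro decay_subset[OF assms(3)])
qed

text \<open>The contribution of one index to the distance, as a function of the valuation alone:
  decreasing on the reals, 1 at valuation 0 and 0 at \<infinity>.\<close>

definition sharp_size :: "ereal \<Rightarrow> real" where
  "sharp_size v = (let d = (if v = \<infinity> then 0 else exp (- real_of_ereal v)) in 2 * d / (1 + d))"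

lemma sharp_size_mono_aux: "0 \<le> d \<Longrightarrow> d \<le> e \<Longrightarrow> 2 * d / (1 + d) \<le> 2 * e / (1 + e :: real)"
  by (simp add: field_simps)

lemma sharp_size_nonneg: "0 \<le> sharp_size v"
  by (simp add: sharp_size_def Let_def)

lemma sharp_size_le_2: "sharp_size v \<le> 2"
proof -
  have "2 * d / (1 + d) \<le> 2" if "0 \<le> d" for d :: real using that by (simp add: field_simps)
  then show ?thesis by (simp add: sharp_size_def Let_def)
qed

lemma sharp_size_eq_0_iff: "sharp_size v = 0 \<longleftrightarrow> v = \<infinity>"
proof -
  have "1 + exp (- real_of_ereal v) \<noteq> 0" using exp_gt_zero[of "- real_of_ereal v"] by linarith
  then show ?thesis by (simp add: sharp_size_def Let_def)
qed

text \<open>\<open>-\<infinity>\<close> has to be excluded because \<open>real_of_ereal\<close>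
  sends it to 0 and its size would be 1. Moderate nets never attain it.\<close>

lemma sharp_size_antimono:
  assumes "v \<le> w" "v \<noteq> -\<infinity>"
  shows "sharp_size w \<le> sharp_size v"
proof (cases "w = \<infinity>")
  case True
  then show ?thesis using sharp_size_nonneg by (simp add: sharp_size_eq_0_iff[THEN iffD2])
next
  case False
  then have "real_of_ereal v \<le> real_of_ereal w" "v \<noteq> \<infinity>"
    using assms by (cases v; cases w; simp)+
  then show ?thesis
    using False unfolding sharp_size_def Let_def by (simp only: if_False) (rule sharp_size_mono_aux; simp)
qed

lemma sharp_size_less_1:
  assumes "sharp_size v < 1" "v \<noteq> -\<infinity>"
  shows "0 < v"
proof (rule ccontr)
  assume "\<not> 0 < v"
  then have "sharp_size 0 \<le> sharp_size v" using assms(2) by (intro sharp_size_antimono) auto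
  moreover have "sharp_size 0 = 1" by (simp add: sharp_size_def)
  ultimately show False using assms(1) by simp
qed

lemma sharp_dist_eq_SUP:
  "sharp_dist \<Omega> \<Omega>s f g = (SUP m. sharp_size (valuation \<Omega>s m m (colombeau_diff \<Omega> f g)))"
  by (simp add: sharp_dist_def sharp_pseudodist_def sharp_size_def Let_def)

lemma bdd_above_sharp_size: "bdd_above (range (\<lambda>m. sharp_size (v m)))"
  by (intro bdd_aboveI2[of _ _ 2] sharp_size_le_2)

section \<open>The sharp metric on the algebra\<close>

locale exhausted_domain =
  fixes \<Omega> :: "(real^'n) set" and \<Omega>s :: "nat \<Rightarrow> (real^'n) set"
  assumes open_domain: "open \<Omega>" and exhaustion: "exhaustion \<Omega> \<Omega>s"
begin

lemmas exh = exhaustionD[OF exhaustion]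

lemma decay_imp_valuation_ge:
  assumes "u \<in> smooth_nets \<Omega>" "decay (\<Omega>s m) p a u"
  shows "ereal a \<le> net_valuation \<Omega>s m p u"
  unfolding net_valuation_eq[OF exhaustion assms(1)]
  using assms(2) by (intro Sup_upper imageI CollectI)

lemma less_valuation_imp_decay:
  assumes "u \<in> smooth_nets \<Omega>" "ereal a < net_valuation \<Omega>s m p u"
  shows "decay (\<Omega>s m) p a u"
proof -
  obtain b where "decay (\<Omega>s m) p b u" "ereal a < ereal b"
    using assms(2) unfolding net_valuation_eq[OF exhaustion assms(1)] less_Sup_iff by auto
  then show ?thesis by (auto intro: decay_mono[of _ _ b])
qed

lemma valuation_not_MInfty:
  assumes "u \<in> moderate \<Omega>"
  shows "net_valuation \<Omega>s m p u \<noteq> -\<infinity>"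
proof -
  obtain a where "decay (\<Omega>s m) p a u" by (rule exE[OF moderate_imp_decay[OF assms exh(2,3)]])
  then have "ereal a \<le> net_valuation \<Omega>s m p u"
    by (rule decay_imp_valuation_ge[OF moderate_imp_smooth_nets[OF assms]])
  then show ?thesis by auto
qed

lemma valuation_negligible:
  assumes "u \<in> negligible_nets \<Omega>"
  shows "net_valuation \<Omega>s m p u = \<infinity>"
proof -
  have "ereal a \<le> net_valuation \<Omega>s m p u" for a
    by (intro decay_imp_valuation_ge negligible_imp_smooth_nets negligible_imp_decay[OF _ exh(2,3)] assms)
  then show ?thesis by (intro ereal_top) 
qed

lemma valuation_infinite_imp_negligible:
  assumes "u \<in> smooth_nets \<Omega>" "\<And>m. net_valuation \<Omega>s m m u = \<infinity>"
  shows "u \<in> negligible_nets \<Omega>"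
  using assms by (intro decay_imp_negligible[OF exhaustion] less_valuation_imp_decay) auto

lemma valuation_minus:
  assumes "u \<in> smooth_nets \<Omega>"
  shows "net_valuation \<Omega>s m p (\<lambda>\<epsilon> x. - u \<epsilon> x) = net_valuation \<Omega>s m p u"
proof -
  note s = smooth_nets_minus[OF open_domain assms]
  have "decay (\<Omega>s m) p a (\<lambda>\<epsilon> x. - u \<epsilon> x) \<longleftrightarrow> decay (\<Omega>s m) p a u" for a
    using decay_minus[OF open_domain exh(2,3) assms] decay_minus[OF open_domain exh(2,3) s] by auto
  then show ?thesis by (simp add: net_valuation_eq[OF exhaustion] s assms)
qed

text \<open>The ultrametric inequality. The supremum defining a valuation need not be attained, so
  the proof tests with reals strictly below both valuations, at which decay does hold.\<close>

lemma valuation_diff_ge: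
  assumes "u \<in> smooth_nets \<Omega>" "v \<in> smooth_nets \<Omega>"
  shows "min (net_valuation \<Omega>s m p u) (net_valuation \<Omega>s m p v) \<le> net_valuation \<Omega>s m p (\<lambda>\<epsilon> x. u \<epsilon> x - v \<epsilon> x)"
proof (rule dense_le)
  fix y assume y: "y < min (net_valuation \<Omega>s m p u) (net_valuation \<Omega>s m p v)"
  show "y \<le> net_valuation \<Omega>s m p (\<lambda>\<epsilon> x. u \<epsilon> x - v \<epsilon> x)"
  proof (cases y)
    case (real a)
    then have "decay (\<Omega>s m) p a u"
      using y by (intro less_valuation_imp_decay assms) auto
    moreover have "decay (\<Omega>s m) p a v"
      using y real by (intro less_valuation_imp_decay assms) auto
    ultimately have "decay (\<Omega>s m) p a (\<lambda>\<epsilon> x. u \<epsilon> x - v \<epsilon> x)"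
      by (rule decay_diff[OF open_domain exh(2,3) assms])
    then show ?thesis
      unfolding real by (rule decay_imp_valuation_ge[OF smooth_nets_diff[OF open_domain assms]])
  qed (use y in auto)
qed

text \<open>Since v = u - (u - v) and the negligible part has valuation \<infinity>, the ultrametric
  inequality bounds each valuation by the other.\<close>

lemma valuation_cong_negligible:
  fixes u v :: "('n, 'k::{real_normed_field,euclidean_space}) net"
  assumes "u \<in> smooth_nets \<Omega>" "v \<in> smooth_nets \<Omega>" "(\<lambda>\<epsilon> x. u \<epsilon> x - v \<epsilon> x) \<in> negligible_nets \<Omega>"
  shows "net_valuation \<Omega>s m p u = net_valuation \<Omega>s m p v"
proof (rule antisym)
  have 1: "(\<lambda>\<epsilon> x. v \<epsilon> x - u \<epsilon> x) \<in> negligible_nets \<Omega>"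
    using negligible_minus[OF open_domain assms(3)] by simp
  show "net_valuation \<Omega>s m p u \<le> net_valuation \<Omega>s m p v"
    using valuation_diff_ge[OF assms(1) negligible_imp_smooth_nets[OF assms(3)], of m p]
    by (simp add: valuation_negligible[OF assms(3)])
  show "net_valuation \<Omega>s m p v \<le> net_valuation \<Omega>s m p u"
    using valuation_diff_ge[OF assms(2) negligible_imp_smooth_nets[OF 1], of m p]
    by (simp add: valuation_negligible[OF 1])
qed

lemma valuation_class:
  fixes u :: "('n, 'k::{real_normed_field,euclidean_space}) net"
  assumes "u \<in> moderate \<Omega>"
  shows "valuation \<Omega>s m p (colombeau_class \<Omega> u) = net_valuation \<Omega>s m p u"
proof -
  have "net_valuation \<Omega>s m p v = net_valuation \<Omega>s m p u" if "v \<in> colombeau_class \<Omega> u" for v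
    using that valuation_cong_negligible[of u v m p] by (simp add: mem_colombeau_class moderate_imp_smooth_nets)
  then have "net_valuation \<Omega>s m p ` colombeau_class \<Omega> u = (\<lambda>v. net_valuation \<Omega>s m p u) ` colombeau_class \<Omega> u"
    by (rule image_cong[OF refl])
  also have "\<dots> = {net_valuation \<Omega>s m p u}"
    using colombeau_class_self[OF assms] by (rule image_constant)
  finally have "net_valuation \<Omega>s m p ` colombeau_class \<Omega> u = {net_valuation \<Omega>s m p u}" .
  then show ?thesis by (simp add: valuation_def)
qed

lemma sharp_dist_class:
  fixes u v :: "('n, 'k::{real_normed_field,euclidean_space}) net"
  assumes "u \<in> moderate \<Omega>" "v \<in> moderate \<Omega>"
  shows "sharp_dist \<Omega> \<Omega>s (colombeau_class \<Omega> u) (colombeau_class \<Omega> v)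
    = (SUP m. sharp_size (net_valuation \<Omega>s m m (\<lambda>\<epsilon> x. u \<epsilon> x - v \<epsilon> x)))"
  by (simp add: sharp_dist_eq_SUP colombeau_diff_class[OF open_domain assms]
      valuation_class[OF moderate_diff[OF open_domain assms]])

text \<open>A metric space here has to be symmetric on the whole type, also for sets that are not
  classes of nets. The argument therefore compares the images under \<open>net_valuation\<close> as
  sets, which settles \<open>the_elem\<close> whatever its value is.\<close>

lemma sharp_dist_commute:
  fixes f g :: "('n, 'k::{real_normed_field,euclidean_space}) net set"
  shows "sharp_dist \<Omega> \<Omega>s f g = sharp_dist \<Omega> \<Omega>s g f"
proof -
  have "net_valuation \<Omega>s m p ` colombeau_diff \<Omega> f g \<subseteq> net_valuation \<Omega>s m p ` colombeau_diff \<Omega> g f"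
    for m p and f g :: "('n, 'k) net set"
  proof
    fix y assume "y \<in> net_valuation \<Omega>s m p ` colombeau_diff \<Omega> f g"
    then obtain u v w where uv: "u \<in> f" "v \<in> g" and w: "w \<in> colombeau_class \<Omega> (\<lambda>\<epsilon> x. u \<epsilon> x - v \<epsilon> x)"
      and y: "y = net_valuation \<Omega>s m p w"
      by (auto simp: colombeau_diff_def)
    have "(\<lambda>\<epsilon> x. v \<epsilon> x - u \<epsilon> x) \<in> moderate \<Omega>" "(\<lambda>\<epsilon> x. - w \<epsilon> x) \<in> moderate \<Omega>"
      "(\<lambda>\<epsilon> x. (v \<epsilon> x - u \<epsilon> x) - (- w \<epsilon> x)) \<in> negligible_nets \<Omega>"
      using w moderate_minus[OF open_domain, of "\<lambda>\<epsilon> x. u \<epsilon> x - v \<epsilon> x"] moderate_minus[OF open_domain, of w]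
        negligible_minus[OF open_domain, of "\<lambda>\<epsilon> x. u \<epsilon> x - v \<epsilon> x - w \<epsilon> x"]
      by (simp_all add: mem_colombeau_class algebra_simps)
    then have "(\<lambda>\<epsilon> x. - w \<epsilon> x) \<in> colombeau_diff \<Omega> g f"
      using uv by (auto simp: colombeau_diff_def mem_colombeau_class)
    moreover have "y = net_valuation \<Omega>s m p (\<lambda>\<epsilon> x. - w \<epsilon> x)"
      using w y valuation_minus[of w m p] by (simp add: mem_colombeau_class moderate_imp_smooth_nets)
    ultimately show "y \<in> net_valuation \<Omega>s m p ` colombeau_diff \<Omega> g f" by blast
  qed
  then have "net_valuation \<Omega>s m p ` colombeau_diff \<Omega> f g = net_valuation \<Omega>s m p ` colombeau_diff \<Omega> g f" for m p
    by (intro subset_antisym)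
  then show ?thesis by (simp add: sharp_dist_eq_SUP valuation_def)
qed

text \<open>Zero distance makes every diagonal valuation infinite, and the diagonal absorbs every
  compact set and every order, so the difference is negligible. The triangle inequality is derived
  from the ultrametric one index by index.\<close>

lemma Metric_space_sharp_dist:
  "Metric_space (colombeau \<Omega> :: ('n, 'k::{real_normed_field,euclidean_space}) net set set) (sharp_dist \<Omega> \<Omega>s)"
proof
  fix f g h :: "('n, 'k) net set"
  show "0 \<le> sharp_dist \<Omega> \<Omega>s f g"
    unfolding sharp_dist_eq_SUP
    by (rule cSUP_upper2[OF bdd_above_sharp_size UNIV_I sharp_size_nonneg])
  show "sharp_dist \<Omega> \<Omega>s f g = sharp_dist \<Omega> \<Omega>s g f" by (rule sharp_dist_commute)
  assume f: "f \<in> colombeau \<Omega>" and g: "g \<in> colombeau \<Omega>"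
  obtain u v where u: "u \<in> moderate \<Omega>" "f = colombeau_class \<Omega> u" and v: "v \<in> moderate \<Omega>" "g = colombeau_class \<Omega> v"
    using f g by (metis colombeau_cases)
  let ?d = "\<lambda>u v m. sharp_size (net_valuation \<Omega>s m m (\<lambda>\<epsilon> x. u \<epsilon> x - v \<epsilon> x))"
  note uv = moderate_diff[OF open_domain u(1) v(1)]
  show "sharp_dist \<Omega> \<Omega>s f g = 0 \<longleftrightarrow> f = g"
  proof
    assume "sharp_dist \<Omega> \<Omega>s f g = 0"
    then have "?d u v m \<le> 0" for m
      using cSUP_upper[OF UNIV_I[of m] bdd_above_sharp_size, of "\<lambda>m. net_valuation \<Omega>s m m (\<lambda>\<epsilon> x. u \<epsilon> x - v \<epsilon> x)"]
      by (simp add: u v sharp_dist_class)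
    then have "?d u v m = 0" for m using sharp_size_nonneg antisym by blast
    then have "(\<lambda>\<epsilon> x. u \<epsilon> x - v \<epsilon> x) \<in> negligible_nets \<Omega>"
      by (intro valuation_infinite_imp_negligible moderate_imp_smooth_nets uv) (simp add: sharp_size_eq_0_iff)
    then show "f = g" using colombeau_class_eq_iff[OF open_domain u(1) v(1)] u(2) v(2) by simp
  next
    assume "f = g"
    then have "?d u v m = 0" for m
      using colombeau_class_eq_iff[OF open_domain u(1) v(1)] u(2) v(2)
      by (simp add: sharp_size_eq_0_iff valuation_negligible)
    then show "sharp_dist \<Omega> \<Omega>s f g = 0" by (simp add: u v sharp_dist_class)
  qed
  assume "h \<in> colombeau \<Omega>"
  then obtain w where w: "w \<in> moderate \<Omega>" "h = colombeau_class \<Omega> w" by (rule colombeau_cases)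
  have "?d u w m \<le> sharp_dist \<Omega> \<Omega>s f g + sharp_dist \<Omega> \<Omega>s g h" for m
  proof -
    \<comment> \<open>u - w is written as (u - v) - (w - v) to fit the ultrametric inequality for
      differences; the sign of the second term is turned afterwards.\<close>
    have wv: "(\<lambda>\<epsilon> x. w \<epsilon> x - v \<epsilon> x) \<in> moderate \<Omega>" using open_domain w(1) v(1) by (rule moderate_diff)
    let ?Vuv = "net_valuation \<Omega>s m m (\<lambda>\<epsilon> x. u \<epsilon> x - v \<epsilon> x)" and ?Vwv = "net_valuation \<Omega>s m m (\<lambda>\<epsilon> x. w \<epsilon> x - v \<epsilon> x)"
    have V: "min ?Vuv ?Vwv \<le> net_valuation \<Omega>s m m (\<lambda>\<epsilon> x. u \<epsilon> x - w \<epsilon> x)"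
      using valuation_diff_ge[OF uv[THEN moderate_imp_smooth_nets] wv[THEN moderate_imp_smooth_nets], of m m] by simp
    have "?d u w m \<le> sharp_size (min ?Vuv ?Vwv)"
      using V by (rule sharp_size_antimono) (use valuation_not_MInfty[OF uv] valuation_not_MInfty[OF wv] in \<open>simp add: min_def\<close>)
    \<comment> \<open>The minimum is one of the two valuations, and the size of the other is
      nonnegative.\<close>
    also have "\<dots> \<le> sharp_size ?Vuv + sharp_size ?Vwv"
      using sharp_size_nonneg by (simp add: min_def)
    also have "?Vwv = net_valuation \<Omega>s m m (\<lambda>\<epsilon> x. v \<epsilon> x - w \<epsilon> x)"
      using valuation_minus[OF moderate_imp_smooth_nets[OF wv]] by simp
    also have "sharp_size ?Vuv + sharp_size \<dots> \<le> sharp_dist \<Omega> \<Omega>s f g + sharp_dist \<Omega> \<Omega>s g h"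
      unfolding u v w sharp_dist_class[OF u(1) v(1)] sharp_dist_class[OF v(1) w(1)]
      by (intro add_mono cSUP_upper UNIV_I bdd_above_sharp_size)
    finally show ?thesis .
  qed
  then show "sharp_dist \<Omega> \<Omega>s f h \<le> sharp_dist \<Omega> \<Omega>s f g + sharp_dist \<Omega> \<Omega>s g h"
    unfolding u(2) w(2) sharp_dist_class[OF u(1) w(1)] by (intro cSUP_least) auto
qed

lemma sharp_dist_less_1_imp:
  fixes u v :: "('n, 'k::{real_normed_field,euclidean_space}) net"
  assumes "u \<in> moderate \<Omega>" "v \<in> moderate \<Omega>"
    and "sharp_dist \<Omega> \<Omega>s (colombeau_class \<Omega> u) (colombeau_class \<Omega> v) < 1" and "0 < c"
  shows "\<forall>\<^sub>F \<epsilon> in at_right 0. \<forall>x\<in>\<Omega>s m. norm (u \<epsilon> x - v \<epsilon> x) \<le> c"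
proof -
  let ?V = "\<lambda>m. net_valuation \<Omega>s m m (\<lambda>\<epsilon> x. u \<epsilon> x - v \<epsilon> x)"
  note uv = moderate_diff[OF open_domain assms(1,2)]
  have "sharp_size (?V m) < 1"
    using assms(3) cSUP_upper[OF UNIV_I[of m] bdd_above_sharp_size, of ?V]
    by (simp add: sharp_dist_class[OF assms(1,2)])
  then have "0 < ?V m" by (rule sharp_size_less_1) (rule valuation_not_MInfty[OF uv])
  \<comment> \<open>A positive exponent strictly below the valuation, at which decay is
    guaranteed.\<close>
  then obtain a where a: "0 < ereal a \<and> ereal a < ?V m" by (rule exE[OF ereal_dense2])
  then have "0 < a" by simp
  have "decay (\<Omega>s m) m a (\<lambda>\<epsilon> x. u \<epsilon> x - v \<epsilon> x)"
    using a by (intro less_valuation_imp_decay moderate_imp_smooth_nets uv) simp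
  from eventually_small decayD[OF this \<open>0 < c\<close>] show ?thesis
  proof eventually_elim
    case (elim \<epsilon>)
    have "c * \<epsilon> powr a \<le> c * \<epsilon> powr 0"
      using elim(1) \<open>0 < a\<close> \<open>0 < c\<close> by (intro mult_left_mono powr_le_powr_small) auto
    then show ?case using elim(1) elim(2)[rule_format, of "[]"] by fastforce
  qed
qed

lemma valuation_unit_mult:
  fixes u :: "('n, 'k::{real_normed_field,euclidean_space}) net"
  assumes h: "smooth_unit \<Omega> h" and u: "u \<in> smooth_nets \<Omega>"
  shows "net_valuation \<Omega>s m p (\<lambda>\<epsilon> x. h x * u \<epsilon> x) = net_valuation \<Omega>s m p u"
proof -
  obtain g where g: "smooth_on \<Omega> h" "smooth_on \<Omega> g" "\<And>x. x \<in> \<Omega> \<Longrightarrow> h x * g x = 1"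
    using h by (auto simp: smooth_unit_def)
  have hu: "(\<lambda>\<epsilon> x. h x * u \<epsilon> x) \<in> smooth_nets \<Omega>"
    using smooth_nets_mult[OF open_domain smooth_nets_const[OF g(1)] u] .
  have "decay (\<Omega>s m) p a (\<lambda>\<epsilon> x. h x * u \<epsilon> x) \<longleftrightarrow> decay (\<Omega>s m) p a u" for a
  proof
    assume "decay (\<Omega>s m) p a (\<lambda>\<epsilon> x. h x * u \<epsilon> x)"
    from decay_smooth_mult[OF open_domain exh(2,3) g(2) hu this]
    have "decay (\<Omega>s m) p a (\<lambda>\<epsilon> x. g x * (h x * u \<epsilon> x))" .
    then show "decay (\<Omega>s m) p a u"
    \<comment> \<open>The inverse cancels \<open>h\<close> on \<open>\<Omega>\<close> only, so
      equality of nets is available on the domain and not as functions.\<close>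
    proof (rule decay_cong[OF open_domain exh(4)])
      show "g y * (h y * u \<epsilon> y) = u \<epsilon> y" if "y \<in> \<Omega>" for \<epsilon> y
        using g(3)[OF that] by (simp add: mult.assoc[symmetric] mult.commute[of "g y"])
    qed
  qed (rule decay_smooth_mult[OF open_domain exh(2,3) g(1) u])
  then show ?thesis by (simp add: net_valuation_eq[OF exhaustion] hu u)
qed

lemma sharp_norm_unit_mult:
  fixes f :: "('n, 'k::{real_normed_field,euclidean_space}) net set"
  assumes "smooth_unit \<Omega> h" "f \<in> colombeau \<Omega>"
  shows "sharp_norm \<Omega> \<Omega>s (colombeau_mult \<Omega> (smooth_embed \<Omega> h) f) = sharp_norm \<Omega> \<Omega>s f"
proof -
  obtain u where u: "u \<in> moderate \<Omega>" "f = colombeau_class \<Omega> u" using assms(2) by (rule colombeau_cases)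
  have h: "(\<lambda>\<epsilon>. h) \<in> moderate \<Omega>" using assms(1) by (intro moderate_const) (simp add: smooth_unit_def)
  have zero: "(\<lambda>\<epsilon> x. 0 :: 'k) \<in> moderate \<Omega>" by (rule moderate_const) simp
  have "colombeau_mult \<Omega> (smooth_embed \<Omega> h) f = colombeau_class \<Omega> (\<lambda>\<epsilon> x. h x * u \<epsilon> x)"
    using colombeau_mult_class[OF open_domain h u(1)] by (simp add: smooth_embed_def u(2))
  moreover have "(\<lambda>\<epsilon> x. h x * u \<epsilon> x) \<in> moderate \<Omega>" using moderate_mult[OF open_domain h u(1)] .
  ultimately show ?thesis
    using assms(1) u zero
    by (simp add: sharp_norm_def colombeau_zero_def sharp_dist_class valuation_unit_mult moderate_imp_smooth_nets)
qed

end

section \<open>Regularisation of distributions\<close>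

lemma negligible_cong:
  assumes "open \<Omega>" "u \<in> negligible_nets \<Omega>" "\<And>\<epsilon> x. x \<in> \<Omega> \<Longrightarrow> u \<epsilon> x = v \<epsilon> x"
  shows "v \<in> negligible_nets \<Omega>"
  unfolding negligible_iff
proof (intro conjI allI impI)
  show "v \<in> smooth_nets \<Omega>"
    using negligible_imp_smooth_nets[OF assms(2)] assms(3) smooth_on_cong[OF assms(1)]
    unfolding smooth_nets_def by blast
  fix K p a assume "compact K \<and> K \<subseteq> \<Omega>"
  then show "decay K p a v"
    using assms(2) unfolding negligible_iff by (intro decay_cong[OF assms(1) _ _ assms(3)]) auto
qed

lemma moderate_cong:
  assumes "open \<Omega>" "u \<in> moderate \<Omega>" "\<And>\<epsilon> x. x \<in> \<Omega> \<Longrightarrow> u \<epsilon> x = v \<epsilon> x"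
  shows "v \<in> moderate \<Omega>"
proof -
  have "(\<lambda>\<epsilon> x. v \<epsilon> x - u \<epsilon> x) \<in> negligible_nets \<Omega>"
    by (rule negligible_cong[OF assms(1) negligible_zero]) (simp add: assms(3))
  from moderate_add[OF assms(1) assms(2) negligible_imp_moderate[OF this]] show ?thesis by simp
qed

lemma smooth_nets_local:
  assumes "open \<Omega>" "\<And>x. x \<in> \<Omega> \<Longrightarrow> \<exists>\<omega>. open \<omega> \<and> x \<in> \<omega> \<and> u \<in> smooth_nets \<omega>"
  shows "u \<in> smooth_nets \<Omega>"
proof -
  have "smooth_on \<Omega> (u \<epsilon>)" if \<epsilon>: "\<epsilon> \<in> {0<..1}" for \<epsilon>
    unfolding smooth_on_def differentiable_on_eq_differentiable_at[OF assms(1)]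
  proof (intro allI ballI)
    fix \<beta> x assume "x \<in> \<Omega>"
    then obtain \<omega> where "open \<omega>" "x \<in> \<omega>" "u \<in> smooth_nets \<omega>" using assms(2) by blast
    then show "partial_derivs \<beta> (u \<epsilon>) differentiable at x"
      using \<epsilon> by (intro smooth_on_differentiable[of \<omega>] smooth_on_partial_derivs) (auto simp: smooth_nets_def)
  qed
  then show ?thesis by (simp add: smooth_nets_def)
qed

text \<open>Closed balls inside the given neighbourhoods are compact, so decay is known on them, and
  finitely many of them cover a compact set.\<close>

lemma negligible_local:
  assumes "open \<Omega>" and loc: "\<And>x. x \<in> \<Omega> \<Longrightarrow> \<exists>\<omega>. open \<omega> \<and> x \<in> \<omega> \<and> u \<in> negligible_nets \<omega>"
  shows "u \<in> negligible_nets \<Omega>"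
  unfolding negligible_iff
proof (intro conjI allI impI)
  show "u \<in> smooth_nets \<Omega>"
    using loc negligible_imp_smooth_nets by (intro smooth_nets_local[OF assms(1)]) blast
  fix K p a assume K: "compact K \<and> K \<subseteq> \<Omega>"
  have "\<forall>x\<in>K. \<exists>e. 0 < e \<and> decay (cball x e) p a u"
  proof
    fix x assume "x \<in> K"
    then obtain \<omega> where \<omega>: "open \<omega>" "x \<in> \<omega>" "u \<in> negligible_nets \<omega>" using loc K by blast
    obtain e where e: "0 < e" "cball x e \<subseteq> \<omega>" using \<omega>(1,2) open_contains_cball by blast
    then have "decay (cball x e) p a u" using \<omega>(3) unfolding negligible_iff by simp
    with e(1) show "\<exists>e. 0 < e \<and> decay (cball x e) p a u" by blast
  qed
  then obtain e where e: "\<forall>x\<in>K. 0 < e x \<and> decay (cball x (e x)) p a u" by (rule exE[OF bchoice])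
  have "K \<subseteq> (\<Union>x\<in>K. ball x (e x))" using e by force
  then obtain D where D: "D \<subseteq> K" "finite D" "K \<subseteq> (\<Union>x\<in>D. ball x (e x))"
    using compactE_image[of K K "\<lambda>x. ball x (e x)"] K by auto
  have "decay (\<Union>x\<in>D. cball x (e x)) p a u" using D(1,2) e by (intro decay_Union) auto
  then show "decay K p a u"
    by (rule decay_subset[OF _ order_trans[OF D(3) UN_mono[OF subset_refl ball_subset_cball]] order_refl])
qed

text \<open>Neighbourhoods of compact sets are required rather than of points, so no common exponent
  has to be chosen over a cover. The gluing construction supplies them through its
  exhaustion.\<close>

lemma moderate_local:
  assumes "open \<Omega>" and loc: "\<And>K. compact K \<Longrightarrow> K \<subseteq> \<Omega> \<Longrightarrow> \<exists>\<omega>. open \<omega> \<and> K \<subseteq> \<omega> \<and> u \<in> moderate \<omega>"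
  shows "u \<in> moderate \<Omega>"
  unfolding moderate_iff
proof (intro conjI allI impI)
  show "u \<in> smooth_nets \<Omega>"
  proof (rule smooth_nets_local[OF assms(1)])
    show "\<exists>\<omega>. open \<omega> \<and> x \<in> \<omega> \<and> u \<in> smooth_nets \<omega>" if "x \<in> \<Omega>" for x
      using loc[of "{x}"] that moderate_imp_smooth_nets by auto
  qed
  fix K p assume K: "compact K \<and> K \<subseteq> \<Omega>"
  then obtain \<omega> where "K \<subseteq> \<omega>" "u \<in> moderate \<omega>" using loc by blast
  with K show "\<exists>a. decay K p a u" unfolding moderate_iff by blast
qed

lemma moderate_sum:
  assumes "open \<Omega>" "\<And>j. j \<in> J \<Longrightarrow> u j \<in> moderate \<Omega>"
  shows "(\<lambda>\<epsilon> x. \<Sum>j\<in>J. u j \<epsilon> x) \<in> moderate \<Omega>"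
  using assms(2)
  by (induction J rule: infinite_finite_induct)
    (auto simp: negligible_imp_moderate[OF negligible_zero] intro: moderate_add[OF assms(1)])

lemma negligible_sum:
  assumes "open \<Omega>" "\<And>j. j \<in> J \<Longrightarrow> u j \<in> negligible_nets \<Omega>"
  shows "(\<lambda>\<epsilon> x. \<Sum>j\<in>J. u j \<epsilon> x) \<in> negligible_nets \<Omega>"
  using assms(2)
  by (induction J rule: infinite_finite_induct) (auto simp: negligible_zero intro: negligible_add[OF assms(1)])

text \<open>The norm is at most \<open>CARD('n)\<close> times the largest coordinate in absolute
  value, and the k-th power of a coordinate is a monomial.\<close>

lemma schwartz_decay:
  fixes \<rho> :: "real^'n \<Rightarrow> 'k::{real_normed_field,euclidean_space}"
  assumes "schwartz \<rho>"
  shows "\<exists>M. \<forall>z. norm z ^ k * norm (partial_derivs \<beta> \<rho> z) \<le> M"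
proof -
  have "\<exists>M. \<forall>z. norm (monomial (\<lambda>j. if j = i then k else 0) z *\<^sub>R partial_derivs \<beta> \<rho> z) \<le> M" for i
    using assms unfolding schwartz_def bounded_iff by blast
  moreover have "monomial (\<lambda>j. if j = i then k else 0) z = (z $ i) ^ k" for i and z :: "real^'n"
    by (simp add: monomial_def if_distrib[of "\<lambda>n. _ ^ n"] cong: if_cong)
  ultimately obtain M where M: "\<And>i z. \<bar>z $ i\<bar> ^ k * norm (partial_derivs \<beta> \<rho> z) \<le> M i"
    by (simp add: power_abs) metis
  have "norm z ^ k * norm (partial_derivs \<beta> \<rho> z) \<le> real CARD('n) ^ k * (\<Sum>i\<in>UNIV. M i)" for z
  proof -
    have M0: "0 \<le> M i" for i using M[of 0 i] by (rule order_trans[rotated]) simp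
    obtain i where i: "\<And>j. \<bar>z $ j\<bar> \<le> \<bar>z $ i\<bar>"
    proof -
      have "Max (range (\<lambda>j. \<bar>z $ j\<bar>)) \<in> range (\<lambda>j. \<bar>z $ j\<bar>)" by (intro Max_in) auto
      then obtain i where "Max (range (\<lambda>j. \<bar>z $ j\<bar>)) = \<bar>z $ i\<bar>" by blast
      then show ?thesis using that[of i] by (metis Max_ge finite finite_imageI rangeI)
    qed
    have "norm z \<le> (\<Sum>j\<in>UNIV. \<bar>z $ j\<bar>)" by (rule norm_le_l1_cart)
    also have "\<dots> \<le> (\<Sum>j\<in>(UNIV::'n set). \<bar>z $ i\<bar>)" using i by (intro sum_mono)
    finally have "norm z ^ k \<le> (real CARD('n) * \<bar>z $ i\<bar>) ^ k" by (intro power_mono) auto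
    then have "norm z ^ k * norm (partial_derivs \<beta> \<rho> z)
        \<le> real CARD('n) ^ k * (\<bar>z $ i\<bar> ^ k * norm (partial_derivs \<beta> \<rho> z))"
      by (simp add: power_mult_distrib mult_right_mono mult.assoc[symmetric])
    also have "\<dots> \<le> real CARD('n) ^ k * (\<Sum>i\<in>UNIV. M i)"
      using M[of z i] member_le_sum[of i UNIV M] M0 by (intro mult_left_mono) (auto intro: order_trans)
    finally show ?thesis .
  qed
  then show ?thesis by blast
qed

lemma schwartz_bounded_smooth: "schwartz \<rho> \<Longrightarrow> bounded_smooth \<rho>"
  using schwartz_decay[of \<rho> 0] by (intro bounded_smoothI) (auto simp: schwartz_def)

lemma scaled_mollifier_smooth:
  fixes \<rho> :: "real^'n \<Rightarrow> 'k::{real_normed_field,euclidean_space}"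
  assumes "bounded_smooth \<rho>"
  shows bounded_smooth_scaled_mollifier: "bounded_smooth (scaled_mollifier \<rho> \<epsilon>)"
    and partial_derivs_scaled_mollifier: "partial_derivs \<beta> (scaled_mollifier \<rho> \<epsilon>) x
      = inverse (\<epsilon> ^ (CARD('n) + length \<beta>)) *\<^sub>R partial_derivs \<beta> \<rho> (inverse \<epsilon> *\<^sub>R x)"
proof -
  have eq: "scaled_mollifier \<rho> \<epsilon> = (\<lambda>x. inverse (\<epsilon> ^ CARD('n)) *\<^sub>R \<rho> (0 + inverse \<epsilon> *\<^sub>R x))"
    by (simp add: scaled_mollifier_def fun_eq_iff)
  show "bounded_smooth (scaled_mollifier \<rho> \<epsilon>)"
    unfolding eq by (intro bounded_smooth_scaleR bounded_smooth_affine assms)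
  note s = bounded_smooth_smooth[OF assms]
  show "partial_derivs \<beta> (scaled_mollifier \<rho> \<epsilon>) x
      = inverse (\<epsilon> ^ (CARD('n) + length \<beta>)) *\<^sub>R partial_derivs \<beta> \<rho> (inverse \<epsilon> *\<^sub>R x)"
    unfolding eq partial_derivs_scaleR[OF open_UNIV smooth_on_affine(2)[OF s] UNIV_I] partial_derivs_affine[OF s]
    by (simp add: power_add power_inverse)
qed

section \<open>Regularisation by scaled mollifiers\<close>

abbreviation regularise ::
    "(real^'n \<Rightarrow> 'k::{real_normed_field,euclidean_space}) \<Rightarrow> (real^'n \<Rightarrow> 'k) \<Rightarrow> ((real^'n \<Rightarrow> 'k) \<Rightarrow> 'k) \<Rightarrow> ('n, 'k) net" where
  "regularise \<rho> \<psi> T \<equiv> (\<lambda>\<epsilon> x. dist_convolve (cutoff_dist \<psi> T) (scaled_mollifier \<rho> \<epsilon>) x)"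

lemma regularise_eq:
  "regularise \<rho> \<psi> T \<epsilon> x = (\<lambda>a. cutoff_dist \<psi> T (\<lambda>y. a (- y))) (\<lambda>y. scaled_mollifier \<rho> \<epsilon> (x + y))"
  by (simp add: dist_convolve_def)

context
  fixes \<Omega> :: "(real^'n) set" and T :: "(real^'n \<Rightarrow> 'k::{real_normed_field,euclidean_space}) \<Rightarrow> 'k" and \<rho> :: "real^'n \<Rightarrow> 'k"
  assumes T: "T \<in> distributions \<Omega>" and \<rho>: "schwartz \<rho>"
begin

lemma partial_derivs_regularise:
  assumes "\<psi> \<in> test_functions \<Omega>"
  shows "bounded_smooth (regularise \<rho> \<psi> T \<epsilon>)"
    and "partial_derivs \<beta> (regularise \<rho> \<psi> T \<epsilon>) x
      = cutoff_dist \<psi> T (\<lambda>y. partial_derivs \<beta> (scaled_mollifier \<rho> \<epsilon>) (x - y))"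
proof -
  obtain C N where CN: "smooth_functional (cutoff_dist \<psi> T) (closure {x. \<psi> x \<noteq> 0}) C N"
    using cutoff_dist_smooth_functional[OF T assms] by blast
  interpret smooth_functional "\<lambda>a. cutoff_dist \<psi> T (\<lambda>y. a (- y))" "uminus ` closure {x. \<psi> x \<noteq> 0}" C N
    by (rule smooth_functional_reflect[OF CN])
  note bs = bounded_smooth_scaled_mollifier[OF schwartz_bounded_smooth[OF \<rho>], of \<epsilon>]
  show "bounded_smooth (regularise \<rho> \<psi> T \<epsilon>)"
    unfolding regularise_eq by (rule bounded_smooth_apply_translate[OF bs])
  show "partial_derivs \<beta> (regularise \<rho> \<psi> T \<epsilon>) x
      = cutoff_dist \<psi> T (\<lambda>y. partial_derivs \<beta> (scaled_mollifier \<rho> \<epsilon>) (x - y))"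
    unfolding regularise_eq partial_derivs_apply_translate[OF bs] by simp
qed

lemma regularise_smooth_nets: "\<psi> \<in> test_functions \<Omega> \<Longrightarrow> regularise \<rho> \<psi> T \<in> smooth_nets A"
  using smooth_on_subset[OF bounded_smooth_smooth[OF partial_derivs_regularise(1)] subset_UNIV]
  by (simp add: smooth_nets_def)

text \<open>\<open>M\<close> only has to bound \<open>\<rho>\<close> at the rescaled points that the
  support of \<open>\<psi>\<close> makes visible from \<open>x\<close>. A global \<open>M\<close>
  yields moderateness, a small one far from the support yields negligibility. The exponent collects
  \<open>CARD('n)\<close> from the normalisation, \<open>N\<close> from the order of the functional
  and \<open>p\<close> from the derivatives outside.\<close>

lemma regularise_bound:
  assumes "\<psi> \<in> test_functions \<Omega>"
  obtains C q where "0 \<le> C" "\<And>\<epsilon> \<beta> x M. 0 < \<epsilon> \<Longrightarrow> \<epsilon> < 1 \<Longrightarrow> 0 \<le> M \<Longrightarrow> length \<beta> \<le> p \<Longrightarrow>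
     (\<And>\<gamma> y. length \<gamma> \<le> q \<Longrightarrow> y \<in> closure {x. \<psi> x \<noteq> 0} \<Longrightarrow> norm (partial_derivs \<gamma> \<rho> (inverse \<epsilon> *\<^sub>R (x - y))) \<le> M) \<Longrightarrow>
     norm (partial_derivs \<beta> (regularise \<rho> \<psi> T \<epsilon>) x) \<le> C * (inverse (\<epsilon> ^ q) * M)"
proof -
  obtain C N where CN: "smooth_functional (cutoff_dist \<psi> T) (closure {x. \<psi> x \<noteq> 0}) C N"
    using cutoff_dist_smooth_functional[OF T assms] by blast
  interpret smooth_functional "cutoff_dist \<psi> T" "closure {x. \<psi> x \<noteq> 0}" C N by (rule CN)
  let ?q = "CARD('n) + N + p"
  show ?thesis
  proof (rule that[OF C_nonneg])
    fix \<beta> :: "'n list" and \<epsilon> x M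
    assume \<epsilon>: "0 < \<epsilon>" "\<epsilon> < (1::real)" and "0 \<le> M" and \<beta>: "length \<beta> \<le> p"
      and M: "\<And>\<gamma> y. length \<gamma> \<le> ?q \<Longrightarrow> y \<in> closure {x. \<psi> x \<noteq> 0} \<Longrightarrow>
        norm (partial_derivs \<gamma> \<rho> (inverse \<epsilon> *\<^sub>R (x - y))) \<le> M"
    let ?f = "partial_derivs \<beta> (scaled_mollifier \<rho> \<epsilon>)"
    note bsm = bounded_smooth_partial_derivs[OF bounded_smooth_scaled_mollifier[OF schwartz_bounded_smooth[OF \<rho>]], of \<beta> \<epsilon>]
    have bs: "bounded_smooth (\<lambda>y. ?f (x - y))"
      using bounded_smooth_affine[OF bsm, of x "-1"] by simp
    show "norm (partial_derivs \<beta> (regularise \<rho> \<psi> T \<epsilon>) x) \<le> C * (inverse (\<epsilon> ^ ?q) * M)"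
      unfolding partial_derivs_regularise(2)[OF assms]
    proof (rule apply_bound[OF bs])
      show "0 \<le> inverse (\<epsilon> ^ ?q) * M" using \<open>0 \<le> M\<close> \<epsilon>(1) by simp
      fix \<gamma> :: "'n list" and y assume \<gamma>: "length \<gamma> \<le> N" and y: "y \<in> closure {x. \<psi> x \<noteq> 0}"
      have "norm (partial_derivs \<gamma> (\<lambda>y. ?f (x - y)) y) = norm (partial_derivs \<gamma> ?f (x - y))"
        using partial_derivs_affine[OF bounded_smooth_smooth[OF bsm], of \<gamma> x "-1"] by (simp add: power_abs)
      also have "\<dots> = inverse (\<epsilon> ^ (CARD('n) + length (\<gamma> @ \<beta>))) * norm (partial_derivs (\<gamma> @ \<beta>) \<rho> (inverse \<epsilon> *\<^sub>R (x - y)))"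
        unfolding partial_derivs_append[symmetric]
          partial_derivs_scaled_mollifier[OF schwartz_bounded_smooth[OF \<rho>]] norm_scaleR
        using \<epsilon>(1) by simp
      also have "\<dots> \<le> inverse (\<epsilon> ^ ?q) * M"
        using \<gamma> \<beta> y \<epsilon> by (intro mult_mono le_imp_inverse_le power_decreasing M) auto
      finally show "norm (partial_derivs \<gamma> (\<lambda>y. ?f (x - y)) y) \<le> inverse (\<epsilon> ^ ?q) * M" .
    qed
  qed
qed

lemma regularise_moderate:
  assumes "\<psi> \<in> test_functions \<Omega>"
  shows "regularise \<rho> \<psi> T \<in> moderate A"
  unfolding moderate_iff
proof (intro conjI allI impI)
  show "regularise \<rho> \<psi> T \<in> smooth_nets A" using assms by (rule regularise_smooth_nets)
  fix K and p :: nat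
  show "\<exists>a. decay K p a (regularise \<rho> \<psi> T)"
  proof (rule regularise_bound[OF assms, of p])
    fix C :: real and q
    assume C: "\<And>\<epsilon> \<beta> x M. 0 < \<epsilon> \<Longrightarrow> \<epsilon> < 1 \<Longrightarrow> 0 \<le> M \<Longrightarrow> length \<beta> \<le> p \<Longrightarrow>
     (\<And>\<gamma> y. length \<gamma> \<le> q \<Longrightarrow> y \<in> closure {x. \<psi> x \<noteq> 0} \<Longrightarrow> norm (partial_derivs \<gamma> \<rho> (inverse \<epsilon> *\<^sub>R (x - y))) \<le> M) \<Longrightarrow>
     norm (partial_derivs \<beta> (regularise \<rho> \<psi> T \<epsilon>) x) \<le> C * (inverse (\<epsilon> ^ q) * M)"
    obtain M where M: "0 \<le> M" "\<And>\<gamma> x. length \<gamma> \<le> q \<Longrightarrow> norm (partial_derivs \<gamma> \<rho> x) \<le> M"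
      using bounded_smooth_uniform_bound[OF schwartz_bounded_smooth[OF \<rho>], of q] by metis
    have "\<forall>\<^sub>F \<epsilon> in at_right 0. \<forall>\<beta>. length \<beta> \<le> p \<longrightarrow>
      (\<forall>x\<in>K. norm (partial_derivs \<beta> (regularise \<rho> \<psi> T \<epsilon>) x) \<le> (C * M) * \<epsilon> powr (- real q))"
      using eventually_small
    proof (eventually_elim, intro allI impI ballI)
      fix \<epsilon> :: real and \<beta> :: "'n list" and x assume \<epsilon>: "0 < \<epsilon> \<and> \<epsilon> < 1" and \<beta>: "length \<beta> \<le> p"
      have "norm (partial_derivs \<beta> (regularise \<rho> \<psi> T \<epsilon>) x) \<le> C * (inverse (\<epsilon> ^ q) * M)"
        using \<epsilon> \<beta> M by (intro C) auto
      then show "norm (partial_derivs \<beta> (regularise \<rho> \<psi> T \<epsilon>) x) \<le> (C * M) * \<epsilon> powr (- real q)"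
        using \<epsilon> by (simp add: powr_minus powr_realpow mult_ac)
    qed
    from decayI[OF this, of "- real q - 1"] show "\<exists>a. decay K p a (regularise \<rho> \<psi> T)" by auto
  qed
qed

text \<open>At distance \<open>d\<close> from the support of \<open>\<psi>\<close> the rescaled
  argument has norm at least d/\<epsilon>. Schwartz decay of order q + r compensates the loss
  \<epsilon>^(-q) and leaves \<epsilon>^r, with r above the requested exponent.\<close>

lemma regularise_negligible:
  assumes \<psi>: "\<psi> \<in> test_functions \<Omega>" and "open \<omega>" "\<And>x. x \<in> \<omega> \<Longrightarrow> \<psi> x = 0"
  shows "regularise \<rho> \<psi> T \<in> negligible_nets \<omega>"
  unfolding negligible_iff
proof (intro conjI allI impI)
  show "regularise \<rho> \<psi> T \<in> smooth_nets \<omega>" using \<psi> by (rule regularise_smooth_nets)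
  fix K and p :: nat and a assume K: "compact K \<and> K \<subseteq> \<omega>"
  let ?S = "closure {x. \<psi> x \<noteq> 0}"
  have "\<omega> \<inter> ?S = {}"
    using assms(2,3) open_Int_closure_eq_empty[of \<omega> "{x. \<psi> x \<noteq> 0}"] by auto
  then have "K \<inter> ?S = {}" using K by blast
  then obtain d where d: "0 < d" "\<And>x y. x \<in> K \<Longrightarrow> y \<in> ?S \<Longrightarrow> d \<le> dist x y"
    using separate_compact_closed[of K ?S] K by auto
  obtain r :: nat where r: "a < real r" using reals_Archimedean2 by blast
  show "decay K p a (regularise \<rho> \<psi> T)"
  proof (rule regularise_bound[OF \<psi>, of p])
    fix C :: real and q
    assume C: "\<And>\<epsilon> \<beta> x M. 0 < \<epsilon> \<Longrightarrow> \<epsilon> < 1 \<Longrightarrow> 0 \<le> M \<Longrightarrow> length \<beta> \<le> p \<Longrightarrow>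
     (\<And>\<gamma> y. length \<gamma> \<le> q \<Longrightarrow> y \<in> ?S \<Longrightarrow> norm (partial_derivs \<gamma> \<rho> (inverse \<epsilon> *\<^sub>R (x - y))) \<le> M) \<Longrightarrow>
     norm (partial_derivs \<beta> (regularise \<rho> \<psi> T \<epsilon>) x) \<le> C * (inverse (\<epsilon> ^ q) * M)"
    define k where "k = q + r"
    obtain M where M: "0 \<le> M" "\<And>\<gamma>. length \<gamma> \<le> q \<Longrightarrow> \<forall>z. norm z ^ k * norm (partial_derivs \<gamma> \<rho> z) \<le> M"
    proof (rule uniform_bound_lists[where N = q and P = "\<lambda>\<gamma> M. \<forall>z. norm z ^ k * norm (partial_derivs \<gamma> \<rho> z) \<le> M"])
      show "\<exists>M. \<forall>z. norm z ^ k * norm (partial_derivs \<gamma> \<rho> z) \<le> M" for \<gamma>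
        by (rule schwartz_decay[OF \<rho>])
    qed (auto intro: order_trans)
    have "\<forall>\<^sub>F \<epsilon> in at_right 0. \<forall>\<beta>. length \<beta> \<le> p \<longrightarrow>
      (\<forall>x\<in>K. norm (partial_derivs \<beta> (regularise \<rho> \<psi> T \<epsilon>) x) \<le> (C * M / d ^ k) * \<epsilon> powr real r)"
      using eventually_small
    proof (eventually_elim, intro allI impI ballI)
      fix \<epsilon> :: real and \<beta> :: "'n list" and x
      assume \<epsilon>: "0 < \<epsilon> \<and> \<epsilon> < 1" and \<beta>: "length \<beta> \<le> p" and x: "x \<in> K"
      have "norm (partial_derivs \<beta> (regularise \<rho> \<psi> T \<epsilon>) x) \<le> C * (inverse (\<epsilon> ^ q) * (M * (\<epsilon> / d) ^ k))"
      proof (rule C[OF _ _ _ \<beta>])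
        show "0 \<le> M * (\<epsilon> / d) ^ k" using M(1) d(1) \<epsilon> by simp
        fix \<gamma> :: "'n list" and y assume \<gamma>: "length \<gamma> \<le> q" and y: "y \<in> ?S"
        let ?z = "inverse \<epsilon> *\<^sub>R (x - y)"
        have "d / \<epsilon> \<le> norm ?z"
          using d(2)[OF x y] \<epsilon> unfolding norm_scaleR by (simp add: dist_norm field_simps)
        then have "(d / \<epsilon>) ^ k \<le> norm ?z ^ k" using d(1) \<epsilon> by (intro power_mono) auto
        then have "(d / \<epsilon>) ^ k * norm (partial_derivs \<gamma> \<rho> ?z) \<le> norm ?z ^ k * norm (partial_derivs \<gamma> \<rho> ?z)"
          by (intro mult_right_mono) auto
        also have "\<dots> \<le> M" using M(2)[OF \<gamma>] by blast
        finally show "norm (partial_derivs \<gamma> \<rho> ?z) \<le> M * (\<epsilon> / d) ^ k"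
          using d(1) \<epsilon> by (simp add: field_simps)
      qed (use \<epsilon> in auto)
      also have "\<dots> = (C * M / d ^ k) * \<epsilon> powr real r"
        using \<epsilon> d(1) by (simp add: k_def power_add power_divide powr_realpow field_simps)
      finally show "norm (partial_derivs \<beta> (regularise \<rho> \<psi> T \<epsilon>) x) \<le> (C * M / d ^ k) * \<epsilon> powr real r" .
    qed
    then show "decay K p a (regularise \<rho> \<psi> T)" using r by (rule decayI)
  qed
qed

text \<open>Regularisation is linear in the cutoff, so the difference belongs to a cutoff that
  vanishes on \<open>\<omega>\<close>.\<close>

lemma regularise_diff_negligible:
  assumes \<psi>: "\<psi> \<in> test_functions \<Omega>" "\<psi>' \<in> test_functions \<Omega>"
    and "open \<omega>" "\<And>x. x \<in> \<omega> \<Longrightarrow> \<psi> x = \<psi>' x"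
  shows "(\<lambda>\<epsilon> x. regularise \<rho> \<psi> T \<epsilon> x - regularise \<rho> \<psi>' T \<epsilon> x) \<in> negligible_nets \<omega>"
proof -
  have "regularise \<rho> (\<lambda>x. \<psi> x - \<psi>' x) T \<epsilon> x = regularise \<rho> \<psi> T \<epsilon> x - regularise \<rho> \<psi>' T \<epsilon> x" for \<epsilon> x
  proof -
    have s: "smooth_on UNIV (\<lambda>y. scaled_mollifier \<rho> \<epsilon> (x - y))"
      using bounded_smooth_smooth[OF bounded_smooth_affine[OF bounded_smooth_scaled_mollifier[OF
            schwartz_bounded_smooth[OF \<rho>]], where x = x and c = "-1"]] by simp
    show ?thesis
      using distributions_diff[OF T test_functions_mult(1)[OF \<psi>(1) s] test_functions_mult(1)[OF \<psi>(2) s]]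
      by (simp add: dist_convolve_def cutoff_dist_def left_diff_distrib)
  qed
  then show ?thesis
    using regularise_negligible[OF test_functions_diff[OF \<psi>] assms(3)] assms(4) by simp
qed

end

section \<open>The embedding of distributions\<close>

lemma mollifierD:
  assumes "mollifier \<rho>"
  shows "schwartz \<rho>" "(LINT x|lborel. \<rho> x) = 1" "integrable lborel \<rho>"
  using assms not_integrable_integral_eq[of lborel \<rho>] by (auto simp: mollifier_def)

context exhausted_domain
begin

text \<open>Dependent choice, because the next neighbourhood has to contain the support of the
  cutoff just chosen. With this nesting, a difference of consecutive cutoffs is supported where the
  following cutoff is 1.\<close>

lemma cutoff_sequence_exists:
  obtains \<theta> :: "nat \<Rightarrow> real^'n \<Rightarrow> 'k::{real_normed_field,euclidean_space}" and U
  where "\<And>m. \<theta> m \<in> test_functions \<Omega>" "\<And>m. open (U m)" "\<And>m x. x \<in> U m \<Longrightarrow> \<theta> m x = 1"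
    "\<And>m. \<Omega>s m \<subseteq> U m" "\<And>m. closure {x. \<theta> m x \<noteq> 0} \<subseteq> U (Suc m)"
proof -
  let ?P = "\<lambda>m p. fst p \<in> test_functions \<Omega> \<and> open (snd p) \<and> (\<forall>x\<in>snd p. fst p x = (1::'k)) \<and> \<Omega>s m \<subseteq> snd p"
  have step: "\<exists>p. ?P m p \<and> C \<subseteq> snd p" if C: "compact C" "C \<subseteq> \<Omega>" for m C
  proof -
    have K: "compact (closure (\<Omega>s m) \<union> C)" "closure (\<Omega>s m) \<union> C \<subseteq> \<Omega>"
      using C exh(2,3) by auto
    obtain \<theta> :: "real^'n \<Rightarrow> 'k" and V where "\<theta> \<in> test_functions \<Omega>" "open V" "closure (\<Omega>s m) \<union> C \<subseteq> V"
      "\<And>x. x \<in> V \<Longrightarrow> \<theta> x = 1"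
      using cutoff_test_function_exists[OF K(1) open_domain K(2)] by blast
    then show ?thesis using closure_subset[of "\<Omega>s m"] by (intro exI[of _ "(\<theta>, V)"]) auto
  qed
  have "\<exists>f. \<forall>m. ?P m (f m) \<and> closure {x. fst (f m) x \<noteq> 0} \<subseteq> snd (f (Suc m))"
  proof (rule dependent_nat_choice)
    show "\<exists>p. ?P 0 p" using step[of "{}" 0] by auto
    fix p m assume "?P m p"
    then show "\<exists>q. ?P (Suc m) q \<and> closure {x. fst p x \<noteq> 0} \<subseteq> snd q"
      by (intro step test_functions_support) auto
  qed
  then obtain f where f: "\<forall>m. ?P m (f m) \<and> closure {x. fst (f m) x \<noteq> 0} \<subseteq> snd (f (Suc m))" by (rule exE)
  show ?thesis by (rule that[of "\<lambda>m. fst (f m)" "\<lambda>m. snd (f m)"]) (use f in auto)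
qed

text \<open>The differences \<open>\<eta> m\<close> of consecutive cutoffs form a locally finite partition of unity, which
  glues the local regularisations.\<close>

lemma dist_embed_nonempty:
  fixes T :: "(real^'n \<Rightarrow> 'k::{real_normed_field,euclidean_space}) \<Rightarrow> 'k"
  assumes T: "T \<in> distributions \<Omega>" and \<rho>: "schwartz \<rho>"
  shows "\<exists>u. u \<in> dist_embed \<rho> \<Omega> T"
proof (rule cutoff_sequence_exists)
  fix \<theta> :: "nat \<Rightarrow> real^'n \<Rightarrow> 'k" and U
  assume \<theta>: "\<And>m. \<theta> m \<in> test_functions \<Omega>" and U: "\<And>m. open (U m)" and \<theta>_1: "\<And>m x. x \<in> U m \<Longrightarrow> \<theta> m x = 1"
    and \<Omega>s_U: "\<And>m. \<Omega>s m \<subseteq> U m" and supp: "\<And>m. closure {x. \<theta> m x \<noteq> 0} \<subseteq> U (Suc m)"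
  have U_supp: "U m \<subseteq> closure {x. \<theta> m x \<noteq> 0}" for m
    using closure_subset[of "{x. \<theta> m x \<noteq> 0}"] \<theta>_1[of _ m] by (force simp: subset_eq)
  have U_Suc: "U m \<subseteq> U (Suc m)" for m using U_supp supp by blast
  then have U_mono: "U i \<subseteq> U j" if "i \<le> j" for i j using that by (rule lift_Suc_mono_le)
  have U_sub: "U m \<subseteq> \<Omega>" for m using U_supp[of m] test_functions_support(2)[OF \<theta>[of m]] by blast
  have absorb: "\<exists>k. K \<subseteq> U k" if "compact K" "K \<subseteq> \<Omega>" for K
    using exhaustion_absorbs[OF exhaustion that, of 0] \<Omega>s_U by (metis subset_trans)
  define \<eta> where "\<eta> m x = \<theta> m x - (case m of 0 \<Rightarrow> 0 | Suc j \<Rightarrow> \<theta> j x)" for m x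
  \<comment> \<open>The index is shifted by one: the support of \<open>\<eta> m\<close> lies in
    \<open>U (Suc m)\<close>, where \<open>\<theta> (Suc m)\<close> is 1, so there
    \<open>F m\<close> is a valid regularisation of \<open>T\<close>.\<close>
  define F where "F m = regularise \<rho> (\<theta> (Suc m)) T" for m
  \<comment> \<open>On \<open>U k\<close> all \<open>\<eta> m\<close> with k < m vanish, so the
    index set is finite there and the sum does not fall back to the default 0.\<close>
  define u where "u \<epsilon> x = (\<Sum>m | \<eta> m x \<noteq> 0. \<eta> m x * F m \<epsilon> x)" for \<epsilon> x
  have \<eta>_smooth: "smooth_on A (\<eta> m)" for A m
  proof -
    have "smooth_on UNIV (\<eta> m)"
      unfolding \<eta>_def using test_functions_smooth[OF \<theta>]
      by (cases m) (auto intro: smooth_on_diff(2)[OF open_UNIV])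
    then show ?thesis by (rule smooth_on_subset) simp
  qed
  have \<eta>_far: "\<eta> m x = 0" if x: "x \<in> U k" and "k < m" for m k x
  proof -
    obtain j where m: "m = Suc j" "k \<le> j" using \<open>k < m\<close> by (cases m) auto
    then have "x \<in> U j" "x \<in> U (Suc j)" using x U_mono[of k j] U_Suc[of j] by auto
    then show ?thesis by (simp add: m(1) \<eta>_def \<theta>_1)
  qed
  have \<eta>_outside: "\<eta> m x = 0" if "x \<notin> closure {x. \<theta> m x \<noteq> 0}" for m x
  proof -
    have "\<theta> m x = 0" using that by (rule not_in_support_eq_0)
    moreover have "\<theta> j x = 0" if "m = Suc j" for j
      using \<open>x \<notin> closure {x. \<theta> m x \<noteq> 0}\<close> supp[of j] U_supp[of m] that by (intro not_in_support_eq_0) blast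
    ultimately show ?thesis by (simp add: \<eta>_def split: nat.split)
  qed
  have \<eta>_sum: "(\<Sum>m\<le>k. \<eta> m x) = \<theta> k x" for k x
    by (induction k) (simp_all add: \<eta>_def)
  have u_eq: "u \<epsilon> x = (\<Sum>m\<le>k. \<eta> m x * F m \<epsilon> x)" if "x \<in> U k" for k x \<epsilon>
    unfolding u_def using \<eta>_far[OF that] by (intro sum.mono_neutral_left) (auto simp: not_less[symmetric])
  have F_moderate: "F m \<in> moderate A" for m A
    unfolding F_def by (rule regularise_moderate[OF T \<rho> \<theta>])
  have "u \<in> moderate \<Omega>"
  proof (rule moderate_local[OF open_domain])
    fix K assume "compact K" "K \<subseteq> \<Omega>"
    then obtain k where k: "K \<subseteq> U k" using absorb by blast
    have "(\<lambda>\<epsilon> x. \<Sum>m\<le>k. \<eta> m x * F m \<epsilon> x) \<in> moderate (U k)"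
      by (intro moderate_sum U moderate_mult[OF U moderate_const[OF \<eta>_smooth] F_moderate])
    then have "u \<in> moderate (U k)"
      by (rule moderate_cong[OF U]) (simp add: u_eq)
    with U k show "\<exists>\<omega>. open \<omega> \<and> K \<subseteq> \<omega> \<and> u \<in> moderate \<omega>" by blast
  qed
  moreover have "(\<lambda>\<epsilon> x. u \<epsilon> x - regularise \<rho> \<psi> T \<epsilon> x) \<in> negligible_nets \<omega>"
    if \<omega>: "open \<omega>" "\<omega> \<subseteq> \<Omega>" and \<psi>: "\<psi> \<in> test_functions \<Omega>" "\<forall>x\<in>\<omega>. \<psi> x = 1" for \<omega> \<psi>
  proof -
    let ?G = "regularise \<rho> \<psi> T"
    have summand: "(\<lambda>\<epsilon> x. \<eta> m x * (F m \<epsilon> x - ?G \<epsilon> x)) \<in> negligible_nets \<omega>" for m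
    proof (rule negligible_local[OF \<omega>(1)])
      fix x assume x: "x \<in> \<omega>"
      show "\<exists>\<omega>'. open \<omega>' \<and> x \<in> \<omega>' \<and> (\<lambda>\<epsilon> x. \<eta> m x * (F m \<epsilon> x - ?G \<epsilon> x)) \<in> negligible_nets \<omega>'"
      \<comment> \<open>Inside \<open>U (Suc m)\<close> both cutoffs are 1 and the regularisations
        differ negligibly. A point outside keeps away from the support of \<open>\<theta> m\<close>,
        near which alone \<open>\<eta> m\<close> can be nonzero.\<close>
      proof (cases "x \<in> U (Suc m)")
        case True
        have op: "open (\<omega> \<inter> U (Suc m))" using \<omega>(1) U by blast
        have "(\<lambda>\<epsilon> x. F m \<epsilon> x - ?G \<epsilon> x) \<in> negligible_nets (\<omega> \<inter> U (Suc m))"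
          unfolding F_def using \<psi>(2) \<theta>_1
          by (intro regularise_diff_negligible[OF T \<rho> \<theta> \<psi>(1) op]) auto
        from negligible_mult[OF op this moderate_const[OF \<eta>_smooth[of _ m]]]
        have "(\<lambda>\<epsilon> x. \<eta> m x * (F m \<epsilon> x - ?G \<epsilon> x)) \<in> negligible_nets (\<omega> \<inter> U (Suc m))"
          by (simp add: mult.commute)
        with op True x show ?thesis by blast
      next
        case False
        have op: "open (- closure {x. \<theta> m x \<noteq> 0})" by (rule open_Compl[OF closed_closure])
        have "(\<lambda>\<epsilon> x. \<eta> m x * (F m \<epsilon> x - ?G \<epsilon> x)) \<in> negligible_nets (- closure {x. \<theta> m x \<noteq> 0})"
          by (rule negligible_cong[OF op negligible_zero]) (simp add: \<eta>_outside)
        with op False supp[of m] show ?thesis by blast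
      qed
    qed
    show ?thesis
    proof (rule negligible_local[OF \<omega>(1)])
      fix x assume x: "x \<in> \<omega>"
      then obtain k where k: "x \<in> U k" using absorb[of "{x}"] \<omega>(2) by auto
      have op: "open (\<omega> \<inter> U k)" using \<omega>(1) U by blast
      have "(\<lambda>\<epsilon> x. \<Sum>m\<le>k. \<eta> m x * (F m \<epsilon> x - ?G \<epsilon> x)) \<in> negligible_nets (\<omega> \<inter> U k)"
        by (intro negligible_sum op negligible_subset[OF summand]) auto
      then have "(\<lambda>\<epsilon> x. u \<epsilon> x - ?G \<epsilon> x) \<in> negligible_nets (\<omega> \<inter> U k)"
      proof (rule negligible_cong[OF op])
        fix \<epsilon> x assume x: "x \<in> \<omega> \<inter> U k"
        \<comment> \<open>The partition telescopes to \<open>\<theta> k\<close>, which is 1 on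
          \<open>U k\<close>, so the second sum is just the regularisation with
          \<open>\<psi>\<close>.\<close>
        have "(\<Sum>m\<le>k. \<eta> m x * (F m \<epsilon> x - ?G \<epsilon> x)) = (\<Sum>m\<le>k. \<eta> m x * F m \<epsilon> x) - (\<Sum>m\<le>k. \<eta> m x) * ?G \<epsilon> x"
          by (simp add: right_diff_distrib sum_subtractf sum_distrib_right)
        then show "(\<Sum>m\<le>k. \<eta> m x * (F m \<epsilon> x - ?G \<epsilon> x)) = u \<epsilon> x - ?G \<epsilon> x"
          using x by (simp add: \<eta>_sum \<theta>_1 u_eq[of x k])
      qed
      with op x k show "\<exists>\<omega>'. open \<omega>' \<and> x \<in> \<omega>' \<and> (\<lambda>\<epsilon> x. u \<epsilon> x - ?G \<epsilon> x) \<in> negligible_nets \<omega>'" by blast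
    qed
  qed
  ultimately have "u \<in> dist_embed \<rho> \<Omega> T" by (simp add: dist_embed_def)
  then show "\<exists>u. u \<in> dist_embed \<rho> \<Omega> T" by (rule exI[of _ u])
qed

lemma dist_embedD:
  assumes "u \<in> dist_embed \<rho> \<Omega> T" "open \<omega>" "\<omega> \<subseteq> \<Omega>" "\<psi> \<in> test_functions \<Omega>" "\<And>x. x \<in> \<omega> \<Longrightarrow> \<psi> x = 1"
  shows "(\<lambda>\<epsilon> x. u \<epsilon> x - regularise \<rho> \<psi> T \<epsilon> x) \<in> negligible_nets \<omega>"
  using assms by (simp add: dist_embed_def)

text \<open>The uniqueness half of the sheaf property: near each point both nets agree with the same
  regularisation up to a negligible net, and negligibility is local. Conversely, a negligible change
  on \<open>\<Omega>\<close> remains negligible on every smaller open set.\<close>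

lemma dist_embed_eq_class:
  fixes T :: "(real^'n \<Rightarrow> 'k::{real_normed_field,euclidean_space}) \<Rightarrow> 'k"
  assumes u: "u \<in> dist_embed \<rho> \<Omega> T"
  shows "dist_embed \<rho> \<Omega> T = colombeau_class \<Omega> u"
proof (intro subset_antisym subsetI)
  have mu: "u \<in> moderate \<Omega>" using u by (simp add: dist_embed_def)
  fix v
  {
    assume v: "v \<in> dist_embed \<rho> \<Omega> T"
    have "(\<lambda>\<epsilon> x. u \<epsilon> x - v \<epsilon> x) \<in> negligible_nets \<Omega>"
    proof (rule negligible_local[OF open_domain])
      fix x assume "x \<in> \<Omega>"
      then obtain \<psi> :: "real^'n \<Rightarrow> 'k" and V where \<psi>: "\<psi> \<in> test_functions \<Omega>" "open V" "{x} \<subseteq> V"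
        "\<And>x. x \<in> V \<Longrightarrow> \<psi> x = 1"
        using cutoff_test_function_exists[OF compact_sing[of x] open_domain] by (metis empty_subsetI insert_subset)
      have op: "open (V \<inter> \<Omega>)" using \<psi>(2) open_domain by blast
      have "(\<lambda>\<epsilon> x. u \<epsilon> x - regularise \<rho> \<psi> T \<epsilon> x) \<in> negligible_nets (V \<inter> \<Omega>)"
        "(\<lambda>\<epsilon> x. v \<epsilon> x - regularise \<rho> \<psi> T \<epsilon> x) \<in> negligible_nets (V \<inter> \<Omega>)"
        using \<psi>(4) by (auto intro!: dist_embedD[OF u op _ \<psi>(1)] dist_embedD[OF v op _ \<psi>(1)])
      from negligible_diff[OF op this]
      have "(\<lambda>\<epsilon> x. u \<epsilon> x - v \<epsilon> x) \<in> negligible_nets (V \<inter> \<Omega>)" by simp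
      with op \<psi>(3) \<open>x \<in> \<Omega>\<close> show "\<exists>\<omega>. open \<omega> \<and> x \<in> \<omega> \<and> (\<lambda>\<epsilon> x. u \<epsilon> x - v \<epsilon> x) \<in> negligible_nets \<omega>" by blast
    qed
    then show "v \<in> colombeau_class \<Omega> u" using mu v by (simp add: mem_colombeau_class dist_embed_def)
  next
    assume "v \<in> colombeau_class \<Omega> u"
    then have v: "v \<in> moderate \<Omega>" "(\<lambda>\<epsilon> x. u \<epsilon> x - v \<epsilon> x) \<in> negligible_nets \<Omega>"
      by (simp_all add: mem_colombeau_class)
    have "(\<lambda>\<epsilon> x. v \<epsilon> x - regularise \<rho> \<psi> T \<epsilon> x) \<in> negligible_nets \<omega>"
      if \<omega>: "open \<omega>" "\<omega> \<subseteq> \<Omega>" and \<psi>: "\<psi> \<in> test_functions \<Omega>" "\<forall>x\<in>\<omega>. \<psi> x = 1" for \<omega> \<psi>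
      using negligible_diff[OF \<omega>(1) dist_embedD[OF u \<omega> \<psi>(1)] negligible_subset[OF v(2) \<omega>(2)]] \<psi>(2) by simp
    with v(1) show "v \<in> dist_embed \<rho> \<Omega> T" by (simp add: dist_embed_def)
  }
qed

text \<open>For a test function \<phi>, let L be the difference of T and S cut off near the support
  of \<phi>. The functions L(\<rho>_\<epsilon>(x - .)) become uniformly small on that support.
  Averaged with weight \<phi> they bound L at the average of \<phi> against \<rho>_\<epsilon>, and
  these averages converge to \<phi>; hence L(\<phi>) = 0.\<close>

lemma distribution_eqI:
  fixes T S :: "(real^'n \<Rightarrow> 'k::{real_normed_field,euclidean_space}) \<Rightarrow> 'k"
  assumes T: "T \<in> distributions \<Omega>" and S: "S \<in> distributions \<Omega>" and \<rho>: "mollifier \<rho>"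
    and u: "u \<in> dist_embed \<rho> \<Omega> T" and v: "v \<in> dist_embed \<rho> \<Omega> S"
    and small: "\<And>m c. 0 < c \<Longrightarrow> \<forall>\<^sub>F \<epsilon> in at_right 0. \<forall>x\<in>\<Omega>s m. norm (u \<epsilon> x - v \<epsilon> x) \<le> c"
  shows "T = S"
proof -
  have "T \<phi> = S \<phi>" if \<phi>: "\<phi> \<in> test_functions \<Omega>" for \<phi>
  proof -
    let ?K = "closure {x. \<phi> x \<noteq> 0}"
    note K = test_functions_support[OF \<phi>]
    obtain m where m: "?K \<subseteq> \<Omega>s m" using exhaustion_absorbs[OF exhaustion K, of 0] by blast
    \<comment> \<open>One cutoff for both distributions, equal to 1 on an open set around the
      support of \<open>\<phi>\<close>: there both nets are described by regularisations with
      \<open>\<psi>\<close>, and \<open>\<psi>\<close> leaves \<open>\<phi>\<close>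
      unchanged.\<close>
    obtain \<psi> :: "real^'n \<Rightarrow> 'k" and V where \<psi>: "\<psi> \<in> test_functions \<Omega>" "open V" "?K \<subseteq> V"
      "\<And>x. x \<in> V \<Longrightarrow> \<psi> x = 1"
      using cutoff_test_function_exists[OF K(1) open_domain K(2)] by blast
    define \<omega> where "\<omega> = V \<inter> \<Omega>"
    have \<omega>: "open \<omega>" "\<omega> \<subseteq> \<Omega>" "?K \<subseteq> \<omega>" "\<And>x. x \<in> \<omega> \<Longrightarrow> \<psi> x = 1"
      using \<psi> open_domain K(2) by (auto simp: \<omega>_def)
    have est: "\<forall>\<^sub>F \<epsilon> in at_right 0. \<forall>x\<in>?K. norm (regularise \<rho> \<psi> T \<epsilon> x - regularise \<rho> \<psi> S \<epsilon> x) \<le> c" if "0 < c" for c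
    proof -
      have neg: "\<forall>\<^sub>F \<epsilon> in at_right 0. \<forall>x\<in>?K. norm (w \<epsilon> x) \<le> \<epsilon>"
        if "w \<in> negligible_nets \<omega>" for w :: "('n, 'k) net"
      proof -
        have "decay ?K 0 1 w" using that K(1) \<omega>(3) unfolding negligible_iff by blast
        from eventually_small decayD[OF this zero_less_one] show ?thesis by eventually_elim auto
      qed
      \<comment> \<open>Half of \<open>c\<close> is spent on u - v, the other half on the two
        negligible errors of size \<epsilon> each.\<close>
      have "0 < c / 2" using that by simp
      then have "\<forall>\<^sub>F \<epsilon>::real in at_right 0. 2 * \<epsilon> \<le> c / 2"
        using that unfolding eventually_at_right_field by (intro exI[of _ "c / 4"]) auto
      moreover have "\<forall>\<^sub>F \<epsilon> in at_right 0. \<forall>x\<in>?K. norm (u \<epsilon> x - regularise \<rho> \<psi> T \<epsilon> x) \<le> \<epsilon>"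
        by (rule neg[OF dist_embedD[OF u \<omega>(1,2) \<psi>(1)]]) (rule \<omega>(4))
      moreover have "\<forall>\<^sub>F \<epsilon> in at_right 0. \<forall>x\<in>?K. norm (v \<epsilon> x - regularise \<rho> \<psi> S \<epsilon> x) \<le> \<epsilon>"
        by (rule neg[OF dist_embedD[OF v \<omega>(1,2) \<psi>(1)]]) (rule \<omega>(4))
      ultimately show ?thesis using small[OF \<open>0 < c / 2\<close>, of m]
      proof eventually_elim
        case (elim \<epsilon>)
        show ?case
        proof
          fix x assume x: "x \<in> ?K"
          define a b where "a = u \<epsilon> x - regularise \<rho> \<psi> T \<epsilon> x" and "b = v \<epsilon> x - regularise \<rho> \<psi> S \<epsilon> x"
          have "norm (regularise \<rho> \<psi> T \<epsilon> x - regularise \<rho> \<psi> S \<epsilon> x) = norm ((u \<epsilon> x - v \<epsilon> x) - (a - b))"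
            by (simp add: a_def b_def)
          also have "\<dots> \<le> norm (u \<epsilon> x - v \<epsilon> x) + (norm a + norm b)"
            using norm_triangle_ineq4[of "u \<epsilon> x - v \<epsilon> x" "a - b"] norm_triangle_ineq4[of a b] by linarith
          finally have "norm (regularise \<rho> \<psi> T \<epsilon> x - regularise \<rho> \<psi> S \<epsilon> x) \<le> norm (u \<epsilon> x - v \<epsilon> x) + (norm a + norm b)" .
          moreover have "norm (u \<epsilon> x - v \<epsilon> x) \<le> c / 2" using elim(4) x m by blast
          moreover have "norm a \<le> \<epsilon>" "norm b \<le> \<epsilon>" using elim(2,3) x by (simp_all add: a_def b_def)
          ultimately show "norm (regularise \<rho> \<psi> T \<epsilon> x - regularise \<rho> \<psi> S \<epsilon> x) \<le> c"
            using elim(1) by linarith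
        qed
      qed
    qed
    obtain C N where CN: "smooth_functional (cutoff_dist \<psi> T) (closure {x. \<psi> x \<noteq> 0}) C N"
      by (rule cutoff_dist_smooth_functional[OF T \<psi>(1)])
    obtain C' N' where CN': "smooth_functional (cutoff_dist \<psi> S) (closure {x. \<psi> x \<noteq> 0}) C' N'"
      by (rule cutoff_dist_smooth_functional[OF S \<psi>(1)])
    define L where "L a = cutoff_dist \<psi> T a - cutoff_dist \<psi> S a" for a
    interpret L: smooth_functional L "closure {x. \<psi> x \<noteq> 0} \<union> closure {x. \<psi> x \<noteq> 0}" "C + C'" "max N N'"
      unfolding L_def by (rule smooth_functional_diff[OF CN CN'])
    \<comment> \<open>The mollifier enters as \<open>\<lambda>y. \<rho>_\<epsilon> (x - y)\<close>,
      a translate only after reflection; the averages of \<open>\<phi>\<close> are handled by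
      \<open>L\<close> itself.\<close>
    interpret R: smooth_functional "\<lambda>a. L (\<lambda>y. a (- y))"
      "uminus ` (closure {x. \<psi> x \<noteq> 0} \<union> closure {x. \<psi> x \<noteq> 0})" "C + C'" "max N N'"
      by (rule smooth_functional_reflect) (rule L.smooth_functional_axioms)
    note \<rho>' = mollifierD[OF \<rho>]
    note bs\<rho> = schwartz_bounded_smooth[OF \<rho>'(1)]
    note bs\<phi> = test_functions_bounded_smooth[OF \<phi>]
    have int\<phi>: "integrable lborel \<phi>"
    proof -
      have "integrable lborel (\<lambda>x. indicator ?K x *\<^sub>R \<phi> x)"
        using smooth_on_imp_continuous_on[OF bounded_smooth_smooth[OF bs\<phi>]]
        by (intro borel_integrable_compact K(1)) (rule continuous_on_subset, auto)
      moreover have "(\<lambda>x. indicator ?K x *\<^sub>R \<phi> x) = \<phi>"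
      proof
        fix x show "indicator ?K x *\<^sub>R \<phi> x = \<phi> x"
          using not_in_support_eq_0[of x \<phi>] by (cases "x \<in> ?K") simp_all
      qed
      ultimately show ?thesis by simp
    qed
    \<comment> \<open>The substitution x = y + \<epsilon> z exchanges the roles: translates of the
      mollifier weighted by \<open>\<phi>\<close> become translates of \<open>\<phi>\<close>
      weighted by \<open>\<rho>\<close>. The Jacobian cancels the normalisation of the
      mollifier.\<close>
    have average: "(\<lambda>y. LINT x|lborel. scaled_mollifier \<rho> \<epsilon> (- y + x) * \<phi> x)
        = (\<lambda>y. LINT z|lborel. \<phi> (y + \<epsilon> *\<^sub>R z) * \<rho> z)" if "0 < \<epsilon>" for \<epsilon>
    proof
      fix y
      have [measurable]: "\<phi> \<in> borel_measurable borel" "scaled_mollifier \<rho> \<epsilon> \<in> borel_measurable borel"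
        by (intro smooth_on_UNIV_borel_measurable bounded_smooth_smooth bs\<phi> bounded_smooth_scaled_mollifier bs\<rho>)+
      have "(LINT x|lborel. scaled_mollifier \<rho> \<epsilon> (- y + x) * \<phi> x)
          = \<bar>\<epsilon>\<bar> ^ CARD('n) *\<^sub>R (LINT z|lborel. scaled_mollifier \<rho> \<epsilon> (- y + (y + \<epsilon> *\<^sub>R z)) * \<phi> (y + \<epsilon> *\<^sub>R z))"
        using that by (intro lborel_integral_affine) auto
      also have "\<dots> = (LINT z|lborel. \<epsilon> ^ CARD('n) *\<^sub>R (scaled_mollifier \<rho> \<epsilon> (\<epsilon> *\<^sub>R z) * \<phi> (y + \<epsilon> *\<^sub>R z)))"
        using that by simp
      also have "\<dots> = (LINT z|lborel. \<phi> (y + \<epsilon> *\<^sub>R z) * \<rho> z)"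
        using that by (intro Bochner_Integration.integral_cong refl) (simp add: scaled_mollifier_def mult.commute)
      finally show "(LINT x|lborel. scaled_mollifier \<rho> \<epsilon> (- y + x) * \<phi> x) = (LINT z|lborel. \<phi> (y + \<epsilon> *\<^sub>R z) * \<rho> z)" .
    qed
    \<comment> \<open>The limit is taken along a sequence because dominated convergence is a
      statement about sequences.\<close>
    let ?e = "\<lambda>k. inverse (real (Suc k))"
    have e0: "?e \<longlonglongrightarrow> 0" by (rule LIMSEQ_inverse_real_of_nat)
    then have e0': "filterlim ?e (at_right 0) sequentially"
      by (intro tendsto_imp_filterlim_at_right) auto
    have lim: "(\<lambda>k. L (\<lambda>y. LINT z|lborel. \<phi> (y + ?e k *\<^sub>R z) * \<rho> z)) \<longlonglongrightarrow> L \<phi>"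
      by (rule L.apply_average_tendsto[OF \<rho>'(3,2) bs\<phi> e0])
    have "norm (L \<phi>) \<le> c * (LINT x|lborel. norm (\<phi> x))" if "0 < c" for c
    proof (rule Lim_norm_ubound[OF _ lim])
      show "\<forall>\<^sub>F k in sequentially. norm (L (\<lambda>y. LINT z|lborel. \<phi> (y + ?e k *\<^sub>R z) * \<rho> z)) \<le> c * (LINT x|lborel. norm (\<phi> x))"
        using eventually_compose_filterlim[OF est[OF that] e0']
      proof eventually_elim
        case (elim k)
        have "norm (L (\<lambda>y. LINT x|lborel. scaled_mollifier \<rho> (?e k) (- y + x) * \<phi> x)) \<le> c * (LINT x|lborel. norm (\<phi> x))"
        proof (rule R.norm_apply_average_le[OF bounded_smooth_scaled_mollifier[OF bs\<rho>] int\<phi> K(1)])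
          show "\<phi> x = 0" if "x \<notin> ?K" for x using that by (rule not_in_support_eq_0)
          show "norm (L (\<lambda>y. scaled_mollifier \<rho> (?e k) (x + - y))) \<le> c" if "x \<in> ?K" for x
            using elim that by (simp add: L_def dist_convolve_def)
        qed
        then show ?case by (simp only: average[of "?e k"] inverse_positive_iff_positive of_nat_0_less_iff zero_less_Suc)
      qed
    qed simp
    then have "norm (L \<phi>) \<le> 0"
    proof -
      assume *: "\<And>c. 0 < c \<Longrightarrow> norm (L \<phi>) \<le> c * (LINT x|lborel. norm (\<phi> x))"
      \<comment> \<open>The integral may be 0, so the division below is by
        \<open>?B + 1\<close>.\<close>
      let ?B = "LINT x|lborel. norm (\<phi> x)"
      have B: "0 \<le> ?B" by simp
      then have pos: "0 < ?B + 1" by linarith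
      show "norm (L \<phi>) \<le> 0"
      proof (rule field_le_epsilon)
        fix e :: real assume "0 < e"
        then have "norm (L \<phi>) \<le> e / (?B + 1) * ?B" by (intro * divide_pos_pos pos)
        also have "\<dots> \<le> e / (?B + 1) * (?B + 1)"
          using \<open>0 < e\<close> pos by (intro mult_left_mono divide_nonneg_pos) auto
        also have "\<dots> = e" using less_imp_neq[OF pos] by (simp only: times_divide_eq_left nonzero_mult_div_cancel_right not_sym)
        finally show "norm (L \<phi>) \<le> 0 + e" by simp
      qed
    qed
    moreover have "(\<lambda>y. \<psi> y * \<phi> y) = \<phi>"
    proof
      fix y show "\<psi> y * \<phi> y = \<phi> y"
        using \<omega>(3,4) not_in_support_eq_0[of y \<phi>] by (cases "y \<in> ?K") auto
    qed
    ultimately show ?thesis by (simp add: L_def cutoff_dist_def)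
  qed
  \<comment> \<open>Distributions are extensional, so agreement on test functions is equality as
    functions.\<close>
  then show ?thesis
    using T S by (intro extensionalityI[of T "test_functions \<Omega>" S]) (auto simp: distributions_def)
qed

text \<open>The unit ball around an image point contains no other image point, so no image point is
  an accumulation point of the image; disjointness from the derived set characterises discreteness
  of a subspace.\<close>

lemma dist_embed_discrete:
  fixes \<rho> :: "real^'n \<Rightarrow> 'k::{real_normed_field,euclidean_space}"
  assumes \<rho>: "mollifier \<rho>"
  shows "subtopology (sharp_topology \<Omega> \<Omega>s) (dist_embed \<rho> \<Omega> ` distributions \<Omega>) =
    discrete_topology (dist_embed \<rho> \<Omega> ` distributions \<Omega>)"
proof -
  interpret Metric_space "colombeau \<Omega> :: ('n, 'k) net set set" "sharp_dist \<Omega> \<Omega>s"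
    by (rule Metric_space_sharp_dist)
  let ?E = "dist_embed \<rho> \<Omega> ` distributions \<Omega>"
  \<comment> \<open>Membership in the algebra combines existence of a glued net with the
    identification of the image as its class.\<close>
  have mem: "dist_embed \<rho> \<Omega> T \<in> colombeau \<Omega>" if T: "T \<in> distributions \<Omega>" for T
  proof -
    obtain u where u: "u \<in> dist_embed \<rho> \<Omega> T"
      by (rule exE[OF dist_embed_nonempty[OF T mollifierD(1)[OF \<rho>]]])
    then have "u \<in> moderate \<Omega>" by (simp add: dist_embed_def)
    then show ?thesis unfolding dist_embed_eq_class[OF u] by (rule colombeau_class_in)
  qed
  have sep: "dist_embed \<rho> \<Omega> T = dist_embed \<rho> \<Omega> S"
    if T: "T \<in> distributions \<Omega>" and S: "S \<in> distributions \<Omega>"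
      and less: "sharp_dist \<Omega> \<Omega>s (dist_embed \<rho> \<Omega> T) (dist_embed \<rho> \<Omega> S) < 1" for T S
  proof -
    obtain u where u: "u \<in> dist_embed \<rho> \<Omega> T"
      by (rule exE[OF dist_embed_nonempty[OF T mollifierD(1)[OF \<rho>]]])
    obtain v where v: "v \<in> dist_embed \<rho> \<Omega> S"
      by (rule exE[OF dist_embed_nonempty[OF S mollifierD(1)[OF \<rho>]]])
    have "u \<in> moderate \<Omega>" "v \<in> moderate \<Omega>" using u v by (simp_all add: dist_embed_def)
    from sharp_dist_less_1_imp[OF this] less
    have "T = S" unfolding dist_embed_eq_class[OF u] dist_embed_eq_class[OF v]
      by (intro distribution_eqI[OF T S \<rho> u v])
    then show ?thesis by simp
  qed
  have "?E \<inter> mtopology derived_set_of ?E = {}"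
  proof (rule equals0I)
    fix f assume f: "f \<in> ?E \<inter> mtopology derived_set_of ?E"
    then obtain g where g: "g \<in> ?E" "g \<noteq> f" "g \<in> mball f 1"
      unfolding metric_derived_set_of using zero_less_one by blast
    then show False using f sep by auto
  qed
  moreover have "?E \<subseteq> topspace mtopology" using mem by auto
  ultimately show ?thesis
    unfolding sharp_topology_def by (intro subtopology_eq_discrete_topology conjI)
qed

end

theorem corollary1:
  fixes \<Omega> :: "(real^'n) set"
    and \<Omega>s :: "nat \<Rightarrow> (real^'n) set"
  assumes "open \<Omega>" and "exhaustion \<Omega> \<Omega>s"
  shows "(\<forall>\<rho> :: real^'n \<Rightarrow> 'k::{real_normed_field,euclidean_space}. mollifier \<rho> \<longrightarrow>
            subtopology (sharp_topology \<Omega> \<Omega>s) (dist_embed \<rho> \<Omega> ` distributions \<Omega>) =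
              discrete_topology (dist_embed \<rho> \<Omega> ` distributions \<Omega>)) \<and>
         (\<forall>(h :: real^'n \<Rightarrow> 'k) f. smooth_unit \<Omega> h \<and> f \<in> colombeau \<Omega> \<longrightarrow>
            sharp_norm \<Omega> \<Omega>s (colombeau_mult \<Omega> (smooth_embed \<Omega> h) f) = sharp_norm \<Omega> \<Omega>s f)"
proof -
  interpret exhausted_domain \<Omega> \<Omega>s by unfold_locales (fact assms)+
  show ?thesis using dist_embed_discrete sharp_norm_unit_mult by blast
qed

end
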